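(* Let $z_1,z_2$ be distinct points on $\mathbb P$ (different from the base-point $P$) and $v_1,v_2\in\mathbf g$. The current operators $j^{v_1}(z_1)$ and $j^{v_2}(z_2)$ can be composed and commute. As $z_2\to z_1$ one has $$\begin{aligned} j^{v_2}(z_2)j^{v_1}(z_1)&+\frac{(v_1,v_2)\,du_{z_1}du_{z_2}}{(u(z_1)-u(z_2))^2}-\frac{1}{u(z_2)-u(z_1)}\,du_{z_2}\,j^{[v_2,v_1]}(z_1)\\ &\longrightarrow\ \iota^{v_2}(z_1)\iota^{v_1}(z_1)+\epsilon^{v_2}(z_1)\epsilon^{v_1}(z_1)+\epsilon^{v_2}(z_1)\iota^{v_1}(z_1)+\epsilon^{v_1}(z_1)\iota^{v_2}(z_1)+\frac{d\hat\iota^{[v_2,v_1]}}{dz}(z_1)\,du_{z_1}^2 .\end{aligned}$$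
   Context: $\mathbb P$ is a complex projective line with canonical bundle $K$ (fibre $K_z$ at $z$); $P\in\mathbb P$ is a fixed base-point and $u$ is a coordinate (meromorphic function with exactly one pole, which is simple) with its pole at $P$. $\mathbf g$ is a complex Lie algebra with a nondegenerate invariant symmetric bilinear form $(\cdot,\cdot)$. $\mathfrak g_-$ is the Lie algebra of meromorphic maps $\alpha:\mathbb P\to\mathbf g$ regular and vanishing at $P$; $\mathfrak g_-^{z}$ and $\mathfrak g_-^{z_1,z_2}$ are the subalgebras of those that are moreover regular at $z$, respectively at $z_1$ and $z_2$. $U$ denotes the universal enveloping algebra, and $\mathbf 1=1\in\mathbb C\subset U\mathfrak g_-$. For $v\in\mathbf g$ and $z\ne P$: $\epsilon^v(z):U\mathfrak g_-\to U\mathfrak g_-\otimes K_z$ is left multiplication by $\epsilon^v_z=\frac{v}{u-u(z)}\otimes du_z$; and $\iota^v(z):U\mathfrak g_-^z\to U\mathfrak g_-^z\otimes K_z$ is defined inductively (simultaneously for all $v$) by $\iota^v(z)\mathbf 1=0$ and, for $\alpha\in\mathfrak g_-^z$ acting by left multiplication, $$\iota^v(z)\circ\alpha-\alpha\circ\iota^v(z)=-[\epsilon^v(z),\alpha]-(v,d\alpha(z))+\iota^{[v,\alpha(z)]}(z)+\epsilon^{[v,\alpha(z)]}(z).$$ The current is $j^v(z)=\epsilon^v(z)+\iota^v(z):U\mathfrak g_-^z\to U\mathfrak g_-\otimes K_z$. One writes $\iota^v(z)=\hat\iota^v(z)\,du_z$, and $d\hat\iota^v/dz$ is the derivative with respect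 to the coordinate $u(z)$. The factors $du_{z_1},du_{z_2}$ commute with each other and with everything else without signs. Products of currents at $z_1\ne z_2$ are composed on $U\mathfrak g_-^{z_1,z_2}$; the limit is taken after applying the operators to a fixed vector of $U\mathfrak g_-^{z_1}$, for which the products are defined when $z_2\neq z_1$ is near $z_1$.
   Formalization: The double-pole term is subtracted, not added: with the given recursion for ι the plus sign leaves 2(v₁,v₂)/(u(z₁)−u(z₂))², which diverges (e.g. g=ℂ). The limit holds in every Hausdorff vector topology with separately continuous product in which ε^v(z) is continuous in z. *)

theory Defs
  imports "HOL-Complex_Analysis.Complex_Analysis" "HOL-Library.Poly_Mapping"
begin

section \<open>Complex Lie algebras with an invariant form\<close>

class complex_vector = ab_group_add +
  fixes scaleC :: "complex \<Rightarrow> 'a \<Rightarrow> 'a"  (infixr \<open>*\<^sub>C\<close> 75)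
  assumes scaleC_add_right: "a *\<^sub>C (x + y) = a *\<^sub>C x + a *\<^sub>C y"
    and scaleC_add_left: "(a + b) *\<^sub>C x = a *\<^sub>C x + b *\<^sub>C x"
    and scaleC_scaleC: "a *\<^sub>C b *\<^sub>C x = (a * b) *\<^sub>C x"
    and scaleC_one: "1 *\<^sub>C x = x"

global_interpretation complex_vector: vector_space "scaleC :: complex \<Rightarrow> 'a \<Rightarrow> 'a::complex_vector"
  by unfold_locales
    (rule scaleC_add_right scaleC_add_left scaleC_scaleC scaleC_one)+

class complex_lie_algebra = complex_vector +
  fixes lie :: "'a \<Rightarrow> 'a \<Rightarrow> 'a"
  assumes lie_add_left: "lie (x + y) z = lie x z + lie y z"
    and lie_add_right: "lie x (y + z) = lie x y + lie x z"
    and lie_scaleC_left: "lie (a *\<^sub>C x) y = a *\<^sub>C lie x y"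
    and lie_scaleC_right: "lie x (a *\<^sub>C y) = a *\<^sub>C lie x y"
    and lie_self: "lie x x = 0"
    and jacobi: "lie x (lie y z) + lie y (lie z x) + lie z (lie x y) = 0"

class quadratic_lie_algebra = complex_lie_algebra +
  fixes form :: "'a \<Rightarrow> 'a \<Rightarrow> complex"
  assumes form_add_left: "form (x + y) z = form x z + form y z"
    and form_scaleC_left: "form (a *\<^sub>C x) y = a * form x y"
    and form_sym: "form x y = form y x"
    and form_invariant: "form (lie x y) z = form x (lie y z)"
    and form_nondegenerate: "(\<And>y. form x y = 0) \<Longrightarrow> x = 0"

lemma lie_zero_left [simp]: "lie 0 (y::'a::complex_lie_algebra) = 0"
  using lie_add_left[of 0 0 y] by simp

lemma lie_zero_right [simp]: "lie (x::'a::complex_lie_algebra) 0 = 0"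
  using lie_add_right[of x 0 0] by simp


section \<open>The universal enveloping algebra\<close>

text \<open>The free associative algebra on a set of letters is the monoid algebra of the free monoid,
  whose elements are the words in these letters.\<close>

datatype 'a word_monoid = Word (letters: "'a list")

instantiation word_monoid :: (type) monoid_add
begin
definition "0 = Word []"
definition "v + w = Word (letters v @ letters w)"
instance
  by standard (simp_all add: zero_word_monoid_def plus_word_monoid_def)
end

type_synonym 'a free_algebra = "'a word_monoid \<Rightarrow>\<^sub>0 complex"

abbreviation letter :: "'a \<Rightarrow> 'a free_algebra"
  where "letter x \<equiv> Poly_Mapping.single (Word [x]) 1"

abbreviation const :: "complex \<Rightarrow> 'a free_algebra"
  where "const c \<equiv> Poly_Mapping.single 0 c"

text \<open>The two-sided ideal generated by the linear relations between letters (the quotient by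
  these alone is the tensor algebra) and by the relations \<open>xy - yx = [x, y]\<close>.\<close>

inductive uea_null :: "'a::complex_lie_algebra free_algebra \<Rightarrow> bool" where
  letter_add: "uea_null (letter (x + y) - letter x - letter y)"
| letter_scaleC: "uea_null (letter (c *\<^sub>C x) - const c * letter x)"
| letter_lie: "uea_null (letter x * letter y - letter y * letter x - letter (lie x y))"
| add: "uea_null p \<Longrightarrow> uea_null q \<Longrightarrow> uea_null (p + q)"
| mult: "uea_null p \<Longrightarrow> uea_null (a * p * b)"

lemma uea_null_zero: "uea_null 0"
  using uea_null.mult[OF uea_null.letter_add, of 0 undefined undefined 0] by simp

lemma uea_null_eqI: "p = q \<Longrightarrow> uea_null (p - q)"
  by (simp add: uea_null_zero)

lemma uea_null_mult_left: "uea_null p \<Longrightarrow> uea_null (a * p)"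
  using uea_null.mult[of p a 1] by simp

lemma uea_null_mult_right: "uea_null p \<Longrightarrow> uea_null (p * b)"
  using uea_null.mult[of p 1 b] by simp

lemma uea_null_minus: "uea_null p \<Longrightarrow> uea_null (- p)"
  using uea_null_mult_left[of p "- 1"] by simp

quotient_type (overloaded) 'a uea = "'a::complex_lie_algebra free_algebra" / "\<lambda>p q. uea_null (p - q)"
proof (rule equivpI)
  show "reflp (\<lambda>p q. uea_null (p - q :: 'a free_algebra))"
    by (rule reflpI) (simp add: uea_null_zero)
  show "symp (\<lambda>p q. uea_null (p - q :: 'a free_algebra))"
    by (rule sympI) (drule uea_null_minus, simp)
  show "transp (\<lambda>p q. uea_null (p - q :: 'a free_algebra))"
    by (rule transpI) (drule (1) uea_null.add, simp)
qed

lemma Word_neq_zero: "Word [x] \<noteq> 0"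
  by (simp add: zero_word_monoid_def)

lemma lookup_mult_zero:
  "Poly_Mapping.lookup (p * q :: 'a free_algebra) 0 = Poly_Mapping.lookup p 0 * Poly_Mapping.lookup q 0"
proof -
  have *: "(0 = l + k) \<longleftrightarrow> l = 0 \<and> k = 0" for l k :: "'a word_monoid"
    by (auto simp: zero_word_monoid_def plus_word_monoid_def word_monoid.expand)
  have "Poly_Mapping.lookup (p * q) 0 =
      (\<Sum>l. Poly_Mapping.lookup p l * (\<Sum>k. Poly_Mapping.lookup q k when 0 = l + k))"
    by (simp add: lookup_mult)
  also have "\<dots> = (\<Sum>l. Poly_Mapping.lookup p l * Poly_Mapping.lookup q 0 when l = 0)"
  proof (rule Sum_any.cong)
    fix l :: "'a word_monoid"
    show "Poly_Mapping.lookup p l * (\<Sum>k. Poly_Mapping.lookup q k when 0 = l + k)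
        = (Poly_Mapping.lookup p l * Poly_Mapping.lookup q 0 when l = 0)"
      by (cases "l = 0") (auto simp: *)
  qed
  also have "\<dots> = Poly_Mapping.lookup p 0 * Poly_Mapping.lookup q 0"
    by simp
  finally show ?thesis .
qed

lemma uea_null_lookup_zero: "uea_null p \<Longrightarrow> Poly_Mapping.lookup p 0 = 0"
proof (induction rule: uea_null.induct)
qed (simp_all add: lookup_mult_zero lookup_minus lookup_add lookup_single Word_neq_zero)

instantiation uea :: (complex_lie_algebra) ring_1
begin

lift_definition zero_uea :: "'a uea" is 0 .
lift_definition one_uea :: "'a uea" is 1 .
lift_definition plus_uea :: "'a uea \<Rightarrow> 'a uea \<Rightarrow> 'a uea" is "(+)"
  by (simp only: add_diff_add uea_null.add)
lift_definition uminus_uea :: "'a uea \<Rightarrow> 'a uea" is uminus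
  by (simp only: minus_diff_minus uea_null_minus)
lift_definition minus_uea :: "'a uea \<Rightarrow> 'a uea \<Rightarrow> 'a uea" is "(-)"
proof -
  fix p q r s :: "'a free_algebra"
  assume "uea_null (p - q)" "uea_null (r - s)"
  then have "uea_null ((p - q) + - (r - s))"
    by (intro uea_null.add uea_null_minus)
  then show "uea_null (p - r - (q - s))"
    by (simp add: algebra_simps)
qed
lift_definition times_uea :: "'a uea \<Rightarrow> 'a uea \<Rightarrow> 'a uea" is "(*)"
proof -
  fix p q r s :: "'a free_algebra"
  assume "uea_null (p - q)" "uea_null (r - s)"
  then have "uea_null ((p - q) * r + q * (r - s))"
    by (intro uea_null.add uea_null_mult_left uea_null_mult_right)
  then show "uea_null (p * r - q * s)"
    by (simp add: algebra_simps)
qed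

instance
proof
  show "(0::'a uea) \<noteq> 1"
    by transfer (auto dest: uea_null_lookup_zero simp: lookup_minus)
next
  fix a b c :: "'a uea"
  show "a * b * c = a * (b * c)"
    by transfer (rule uea_null_eqI, rule mult.assoc)
  show "1 * a = a"
    by transfer (rule uea_null_eqI, rule mult_1_left)
  show "a * 1 = a"
    by transfer (rule uea_null_eqI, rule mult_1_right)
  show "a + b + c = a + (b + c)"
    by transfer (rule uea_null_eqI, rule add.assoc)
  show "a + b = b + a"
    by transfer (rule uea_null_eqI, rule add.commute)
  show "0 + a = a"
    by transfer (rule uea_null_eqI, rule add_0_left)
  show "- a + a = 0"
    by transfer (rule uea_null_eqI, rule left_minus)
  show "a - b = a + - b"
    by transfer (rule uea_null_eqI, rule diff_conv_add_uminus)
  show "(a + b) * c = a * c + b * c"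
    by transfer (rule uea_null_eqI, rule distrib_right)
  show "a * (b + c) = a * b + a * c"
    by transfer (rule uea_null_eqI, rule distrib_left)
qed

end

instantiation uea :: (complex_lie_algebra) complex_vector
begin

lift_definition scaleC_uea :: "complex \<Rightarrow> 'a uea \<Rightarrow> 'a uea" is "\<lambda>c p. const c * p"
proof -
  fix c and p q :: "'a free_algebra"
  assume "uea_null (p - q)"
  then have "uea_null (const c * (p - q))"
    by (rule uea_null_mult_left)
  then show "uea_null (const c * p - const c * q)"
    by (simp only: right_diff_distrib)
qed

instance
proof
  fix a b :: complex and x y :: "'a uea"
  show "a *\<^sub>C (x + y) = a *\<^sub>C x + a *\<^sub>C y"
    by transfer (rule uea_null_eqI, rule distrib_left)
  show "(a + b) *\<^sub>C x = a *\<^sub>C x + b *\<^sub>C x"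
    by transfer (rule uea_null_eqI, simp only: single_add distrib_right)
  show "a *\<^sub>C b *\<^sub>C x = (a * b) *\<^sub>C x"
    by transfer (rule uea_null_eqI, simp only: mult.assoc[symmetric] mult_single add_0_left)
  show "1 *\<^sub>C x = x"
    by transfer (rule uea_null_eqI, simp only: single_one mult_1_left)
qed

end

lift_definition uea_of :: "'a::complex_lie_algebra \<Rightarrow> 'a uea" is letter .

text \<open>For a Lie subalgebra \<open>S\<close> of \<open>'a\<close> this is the enveloping algebra of \<open>S\<close>: by the
  Poincare--Birkhoff--Witt theorem it embeds into that of \<open>'a\<close>, and its image consists of the
  linear combinations of products of elements of \<open>S\<close>.\<close>

definition uea_sub :: "'a::complex_lie_algebra set \<Rightarrow> 'a uea set"
  where "uea_sub S = abs_uea ` {p. \<forall>w \<in> Poly_Mapping.keys p. set (letters w) \<subseteq> S}"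


section \<open>The projective line\<close>

text \<open>A projective line with a base-point and a coordinate having its only (and simple) pole there.
  Such a coordinate identifies the complement of the base-point with the complex plane,
  and the complex structure is the one for which \<open>coord\<close> is a chart on this complement and
  \<open>inverse coord\<close> is a chart at the base-point (where the value of \<open>coord\<close> is immaterial).\<close>

class projective_line =
  fixes base_point :: 'a
    and coord :: "'a \<Rightarrow> complex"
  assumes bij_coord: "bij_betw coord (- {base_point}) UNIV"

text \<open>A local parameter vanishing at \<open>z\<close>.\<close>

definition local_param :: "'p::projective_line \<Rightarrow> 'p \<Rightarrow> complex"
  where "local_param z y = (if z = base_point then inverse (coord y) else coord y - coord z)"

text \<open>The filter of punctured neighbourhoods of \<open>z\<close>.\<close>

definition at_point :: "'p::projective_line \<Rightarrow> 'p filter"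
  where "at_point z = inf (filtercomap (local_param z) (at 0)) (principal (- {base_point}))"

lemma eventually_at_pointD:
  assumes "\<forall>\<^sub>F t in at 0. P t"
  shows "\<forall>\<^sub>F y in at_point z. P (local_param z y)"
  unfolding at_point_def eventually_inf_principal
  by (rule eventually_mono[OF eventually_filtercomapI[OF assms]]) simp


section \<open>Meromorphic maps into a complex vector space\<close>

text \<open>Lists of pairs \<open>(f, v)\<close> stand for the vector-valued functions \<open>\<Sum> f v\<close>; a map into a vector
  space without topology is holomorphic or meromorphic if it is locally of this form with
  holomorphic or meromorphic \<open>f\<close>. All notions here only depend on the map on punctured
  neighbourhoods: removable singularities are regular points, and values at poles are irrelevant.\<close>

definition lin_comb :: "((complex \<Rightarrow> complex) \<times> 'g::complex_vector) list \<Rightarrow> complex \<Rightarrow> 'g"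
  where "lin_comb L t = (\<Sum>(f, v) \<leftarrow> L. f t *\<^sub>C v)"

definition meromorphic_at :: "('p::projective_line \<Rightarrow> 'g::complex_vector) \<Rightarrow> 'p \<Rightarrow> bool"
  where "meromorphic_at \<alpha> z \<longleftrightarrow> (\<exists>L. (\<forall>(f, v) \<in> set L. f meromorphic_on {0}) \<and>
    (\<forall>\<^sub>F y in at_point z. \<alpha> y = lin_comb L (local_param z y)))"

definition value_at :: "('p::projective_line \<Rightarrow> 'g::complex_vector) \<Rightarrow> 'p \<Rightarrow> 'g \<Rightarrow> bool"
  where "value_at \<alpha> z c \<longleftrightarrow> (\<exists>L. (\<forall>(f, v) \<in> set L. f analytic_on {0}) \<and>
    (\<forall>\<^sub>F y in at_point z. \<alpha> y = lin_comb L (local_param z y)) \<and> c = lin_comb L 0)"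

text \<open>For \<open>z\<close> other than the base-point, the differential at \<open>z\<close> of a map regular at \<open>z\<close> is
  \<open>d \<otimes> du\<^sub>z\<close>, as the local parameter at \<open>z\<close> is \<open>u - u(z)\<close>.\<close>

definition deriv_at :: "('p::projective_line \<Rightarrow> 'g::complex_vector) \<Rightarrow> 'p \<Rightarrow> 'g \<Rightarrow> bool"
  where "deriv_at \<alpha> z d \<longleftrightarrow> (\<exists>L. (\<forall>(f, v) \<in> set L. f analytic_on {0}) \<and>
    (\<forall>\<^sub>F y in at_point z. \<alpha> y = lin_comb L (local_param z y)) \<and>
    d = (\<Sum>(f, v) \<leftarrow> L. deriv f 0 *\<^sub>C v))"

lemma lin_comb_append: "lin_comb (L @ M) t = lin_comb L t + lin_comb M t"
  by (simp add: lin_comb_def)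

lemma lin_comb_scaleC: "lin_comb (map (\<lambda>(f, v). (f, a *\<^sub>C v)) L) t = a *\<^sub>C lin_comb L t"
  by (induction L)
    (auto simp: lin_comb_def complex_vector.scale_right_distrib complex_vector.scale_left_commute)

definition lin_comb_lie :: "((complex \<Rightarrow> complex) \<times> 'g::complex_lie_algebra) list \<Rightarrow>
    ((complex \<Rightarrow> complex) \<times> 'g) list \<Rightarrow> ((complex \<Rightarrow> complex) \<times> 'g) list"
  where "lin_comb_lie L M =
    concat (map (\<lambda>(f, v). map (\<lambda>(g, w). (\<lambda>t. f t * g t, lie v w)) M) L)"

lemma lin_comb_lie: "lin_comb (lin_comb_lie L M) t = lie (lin_comb L t) (lin_comb M t)"
proof (induction L)
  case Nil
  then show ?case by (simp add: lin_comb_def lin_comb_lie_def)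
next
  case (Cons p L)
  obtain f v where p: "p = (f, v)" by (cases p)
  have "lin_comb (map (\<lambda>(g, w). (\<lambda>t. f t * g t, lie v w)) M) t = lie (f t *\<^sub>C v) (lin_comb M t)"
    by (induction M)
      (auto simp: lin_comb_def lie_add_right lie_scaleC_left lie_scaleC_right scaleC_add_right
        scaleC_scaleC)
  then show ?case
    using Cons by (simp add: lin_comb_lie_def lin_comb_append p lie_add_left lin_comb_def)
qed

lemma meromorphic_at_add:
  assumes "meromorphic_at \<alpha> z" "meromorphic_at \<beta> z"
  shows "meromorphic_at (\<lambda>y. \<alpha> y + \<beta> y) z"
proof -
  obtain L M where "\<forall>(f, v) \<in> set L. f meromorphic_on {0}" "\<forall>(f, v) \<in> set M. f meromorphic_on {0}"
    and ev: "\<forall>\<^sub>F y in at_point z. \<alpha> y = lin_comb L (local_param z y)"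
      "\<forall>\<^sub>F y in at_point z. \<beta> y = lin_comb M (local_param z y)"
    using assms by (auto simp: meromorphic_at_def)
  then show ?thesis
    unfolding meromorphic_at_def
    by (intro exI[of _ "L @ M"] conjI eventually_mono[OF eventually_conj[OF ev]])
      (auto simp: lin_comb_append)
qed

lemma value_at_add:
  assumes "value_at \<alpha> z c" "value_at \<beta> z d"
  shows "value_at (\<lambda>y. \<alpha> y + \<beta> y) z (c + d)"
proof -
  obtain L M where "\<forall>(f, v) \<in> set L. f analytic_on {0}" "\<forall>(f, v) \<in> set M. f analytic_on {0}"
    "c = lin_comb L 0" "d = lin_comb M 0"
    and ev: "\<forall>\<^sub>F y in at_point z. \<alpha> y = lin_comb L (local_param z y)"
      "\<forall>\<^sub>F y in at_point z. \<beta> y = lin_comb M (local_param z y)"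
    using assms by (auto simp: value_at_def)
  then show ?thesis
    unfolding value_at_def
    by (intro exI[of _ "L @ M"] conjI eventually_mono[OF eventually_conj[OF ev]])
      (auto simp: lin_comb_append)
qed

lemma meromorphic_at_scaleC:
  assumes "meromorphic_at \<alpha> z"
  shows "meromorphic_at (\<lambda>y. a *\<^sub>C \<alpha> y) z"
proof -
  obtain L where "\<forall>(f, v) \<in> set L. f meromorphic_on {0}"
    and ev: "\<forall>\<^sub>F y in at_point z. \<alpha> y = lin_comb L (local_param z y)"
    using assms by (auto simp: meromorphic_at_def)
  then show ?thesis
    unfolding meromorphic_at_def
    by (intro exI[of _ "map (\<lambda>(f, v). (f, a *\<^sub>C v)) L"] conjI eventually_mono[OF ev])
      (auto simp: lin_comb_scaleC)
qed

lemma value_at_scaleC: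
  assumes "value_at \<alpha> z c"
  shows "value_at (\<lambda>y. a *\<^sub>C \<alpha> y) z (a *\<^sub>C c)"
proof -
  obtain L where "\<forall>(f, v) \<in> set L. f analytic_on {0}" "c = lin_comb L 0"
    and ev: "\<forall>\<^sub>F y in at_point z. \<alpha> y = lin_comb L (local_param z y)"
    using assms by (auto simp: value_at_def)
  then show ?thesis
    unfolding value_at_def
    by (intro exI[of _ "map (\<lambda>(f, v). (f, a *\<^sub>C v)) L"] conjI eventually_mono[OF ev])
      (auto simp: lin_comb_scaleC)
qed

lemma meromorphic_at_lie:
  assumes "meromorphic_at \<alpha> z" "meromorphic_at \<beta> z"
  shows "meromorphic_at (\<lambda>y. lie (\<alpha> y) (\<beta> y)) z"
proof -
  obtain L M where "\<forall>(f, v) \<in> set L. f meromorphic_on {0}" "\<forall>(f, v) \<in> set M. f meromorphic_on {0}"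
    and ev: "\<forall>\<^sub>F y in at_point z. \<alpha> y = lin_comb L (local_param z y)"
      "\<forall>\<^sub>F y in at_point z. \<beta> y = lin_comb M (local_param z y)"
    using assms by (auto simp: meromorphic_at_def)
  moreover from this(1,2) have "\<forall>(f, v) \<in> set (lin_comb_lie L M). f meromorphic_on {0}"
    by (fastforce simp: lin_comb_lie_def intro!: meromorphic_intros)
  ultimately show ?thesis
    unfolding meromorphic_at_def
    by (intro exI[of _ "lin_comb_lie L M"] conjI eventually_mono[OF eventually_conj[OF ev]])
      (auto simp: lin_comb_lie)
qed

lemma value_at_lie:
  assumes "value_at \<alpha> z c" "value_at \<beta> z d"
  shows "value_at (\<lambda>y. lie (\<alpha> y) (\<beta> y)) z (lie c d)"
proof -
  obtain L M where "\<forall>(f, v) \<in> set L. f analytic_on {0}" "\<forall>(f, v) \<in> set M. f analytic_on {0}"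
    "c = lin_comb L 0" "d = lin_comb M 0"
    and ev: "\<forall>\<^sub>F y in at_point z. \<alpha> y = lin_comb L (local_param z y)"
      "\<forall>\<^sub>F y in at_point z. \<beta> y = lin_comb M (local_param z y)"
    using assms by (auto simp: value_at_def)
  moreover from this(1,2) have "\<forall>(f, v) \<in> set (lin_comb_lie L M). f analytic_on {0}"
    by (fastforce simp: lin_comb_lie_def intro!: analytic_intros)
  ultimately show ?thesis
    unfolding value_at_def
    by (intro exI[of _ "lin_comb_lie L M"] conjI eventually_mono[OF eventually_conj[OF ev]])
      (auto simp: lin_comb_lie)
qed

lemma value_at_cong:
  assumes "\<forall>\<^sub>F y in at_point z. \<alpha> y = \<beta> y"
  shows "value_at \<alpha> z c = value_at \<beta> z c"
  unfolding value_at_def using assms by (intro ex_cong conj_cong refl eventually_subst) (auto elim: eventually_mono)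

lemma deriv_at_cong:
  assumes "\<forall>\<^sub>F y in at_point z. \<alpha> y = \<beta> y"
  shows "deriv_at \<alpha> z d = deriv_at \<beta> z d"
  unfolding deriv_at_def using assms by (intro ex_cong conj_cong refl eventually_subst) (auto elim: eventually_mono)


section \<open>The Lie algebra of meromorphic maps regular and vanishing at the base-point\<close>

definition in_gminus :: "('p::projective_line \<Rightarrow> 'g::complex_vector) \<Rightarrow> bool"
  where "in_gminus \<alpha> \<longleftrightarrow> (\<forall>z. meromorphic_at \<alpha> z) \<and> value_at \<alpha> base_point 0"

text \<open>A meromorphic map is represented by any total function that agrees with it on a punctured
  neighbourhood of every point.\<close>

quotient_type (overloaded) ('p, 'g) gminus = "'p::projective_line \<Rightarrow> 'g::complex_vector" /
  partial: "\<lambda>\<alpha> \<beta>. in_gminus \<alpha> \<and> in_gminus \<beta> \<and> (\<forall>z. \<forall>\<^sub>F y in at_point z. \<alpha> y = \<beta> y)"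
proof (rule part_equivpI)
  have "value_at (\<lambda>_. 0) z 0" for z :: 'p
    unfolding value_at_def by (rule exI[of _ "[]"]) (simp add: lin_comb_def)
  moreover have "meromorphic_at (\<lambda>_. 0 :: 'g) z" for z :: 'p
    unfolding meromorphic_at_def by (rule exI[of _ "[]"]) (simp add: lin_comb_def)
  ultimately have "in_gminus (\<lambda>_::'p. 0::'g)"
    by (simp add: in_gminus_def)
  then show "\<exists>\<alpha>::'p \<Rightarrow> 'g. in_gminus \<alpha> \<and> in_gminus \<alpha> \<and> (\<forall>z. \<forall>\<^sub>F y in at_point z. \<alpha> y = \<alpha> y)"
    by auto
next
  show "symp (\<lambda>\<alpha> \<beta> :: 'p \<Rightarrow> 'g.
      in_gminus \<alpha> \<and> in_gminus \<beta> \<and> (\<forall>z. \<forall>\<^sub>F y in at_point z. \<alpha> y = \<beta> y))"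
    by (rule sympI) (simp add: eq_commute)
next
  show "transp (\<lambda>\<alpha> \<beta> :: 'p \<Rightarrow> 'g.
      in_gminus \<alpha> \<and> in_gminus \<beta> \<and> (\<forall>z. \<forall>\<^sub>F y in at_point z. \<alpha> y = \<beta> y))"
  proof (rule transpI, intro conjI allI; elim conjE)
    fix \<alpha> \<beta> \<gamma> :: "'p \<Rightarrow> 'g" and z
    assume "\<forall>z. \<forall>\<^sub>F y in at_point z. \<alpha> y = \<beta> y" "\<forall>z. \<forall>\<^sub>F y in at_point z. \<beta> y = \<gamma> y"
    from this[THEN spec, of z] show "\<forall>\<^sub>F y in at_point z. \<alpha> y = \<gamma> y"
      by eventually_elim simp
  qed
qed

lemma eventually_eq_cong2:
  assumes "\<forall>\<^sub>F y in F. \<alpha> y = \<alpha>' y" "\<forall>\<^sub>F y in F. \<beta> y = \<beta>' y"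
  shows "\<forall>\<^sub>F y in F. g (\<alpha> y) (\<beta> y) = g (\<alpha>' y) (\<beta>' y)"
  using assms by eventually_elim simp

lemma in_gminus_zero: "in_gminus (\<lambda>_. 0)"
  unfolding in_gminus_def meromorphic_at_def value_at_def
  by (auto intro!: exI[of _ "[]"] simp: lin_comb_def)

lemma in_gminus_add: "in_gminus \<alpha> \<Longrightarrow> in_gminus \<beta> \<Longrightarrow> in_gminus (\<lambda>y. \<alpha> y + \<beta> y)"
  using value_at_add[of \<alpha> base_point 0 \<beta> 0] by (simp add: in_gminus_def meromorphic_at_add)

lemma in_gminus_scaleC: "in_gminus \<alpha> \<Longrightarrow> in_gminus (\<lambda>y. a *\<^sub>C \<alpha> y)"
  using value_at_scaleC[of \<alpha> base_point 0 a] by (simp add: in_gminus_def meromorphic_at_scaleC)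

lemma in_gminus_uminus: "in_gminus \<alpha> \<Longrightarrow> in_gminus (\<lambda>y. - \<alpha> y)"
  using in_gminus_scaleC[of \<alpha> "- 1"] by simp

lemma in_gminus_diff: "in_gminus \<alpha> \<Longrightarrow> in_gminus \<beta> \<Longrightarrow> in_gminus (\<lambda>y. \<alpha> y - \<beta> y)"
  using in_gminus_add[of \<alpha> "\<lambda>y. - \<beta> y"] in_gminus_uminus[of \<beta>] by simp

lemma in_gminus_lie: "in_gminus \<alpha> \<Longrightarrow> in_gminus \<beta> \<Longrightarrow> in_gminus (\<lambda>y. lie (\<alpha> y) (\<beta> y))"
  using value_at_lie[of \<alpha> base_point 0 \<beta> 0] by (simp add: in_gminus_def meromorphic_at_lie)

instantiation gminus :: (projective_line, complex_vector) complex_vector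
begin

lift_definition zero_gminus :: "('a, 'b) gminus" is "\<lambda>_. 0"
  by (simp add: in_gminus_zero)
lift_definition plus_gminus :: "('a, 'b) gminus \<Rightarrow> ('a, 'b) gminus \<Rightarrow> ('a, 'b) gminus"
  is "\<lambda>\<alpha> \<beta> y. \<alpha> y + \<beta> y"
  by (simp add: in_gminus_add eventually_eq_cong2)
lift_definition uminus_gminus :: "('a, 'b) gminus \<Rightarrow> ('a, 'b) gminus" is "\<lambda>\<alpha> y. - \<alpha> y"
  by (auto simp: in_gminus_uminus elim: eventually_mono)
lift_definition minus_gminus :: "('a, 'b) gminus \<Rightarrow> ('a, 'b) gminus \<Rightarrow> ('a, 'b) gminus"
  is "\<lambda>\<alpha> \<beta> y. \<alpha> y - \<beta> y"
  by (simp add: in_gminus_diff eventually_eq_cong2)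
lift_definition scaleC_gminus :: "complex \<Rightarrow> ('a, 'b) gminus \<Rightarrow> ('a, 'b) gminus"
  is "\<lambda>a \<alpha> y. a *\<^sub>C \<alpha> y"
  by (auto simp: in_gminus_scaleC elim: eventually_mono)

instance
  by standard
    (transfer; simp add: in_gminus_zero in_gminus_add in_gminus_uminus in_gminus_diff
      in_gminus_scaleC scaleC_add_right scaleC_add_left scaleC_scaleC scaleC_one algebra_simps)+

end

instantiation gminus :: (projective_line, complex_lie_algebra) complex_lie_algebra
begin

lift_definition lie_gminus :: "('a, 'b) gminus \<Rightarrow> ('a, 'b) gminus \<Rightarrow> ('a, 'b) gminus"
  is "\<lambda>\<alpha> \<beta> y. lie (\<alpha> y) (\<beta> y)"
  by (simp add: in_gminus_lie eventually_eq_cong2)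

instance
  by standard
    (transfer; simp add: in_gminus_zero in_gminus_add in_gminus_scaleC in_gminus_lie
      lie_add_left lie_add_right lie_scaleC_left lie_scaleC_right lie_self jacobi)+

end

lift_definition gm_value_at :: "('p::projective_line, 'g::complex_vector) gminus \<Rightarrow> 'p \<Rightarrow> 'g \<Rightarrow> bool"
  is value_at
  using value_at_cong by blast

lift_definition gm_deriv_at :: "('p::projective_line, 'g::complex_vector) gminus \<Rightarrow> 'p \<Rightarrow> 'g \<Rightarrow> bool"
  is deriv_at
  using deriv_at_cong by blast

definition gm_regular :: "('p::projective_line, 'g::complex_vector) gminus \<Rightarrow> 'p \<Rightarrow> bool"
  where "gm_regular \<alpha> z \<longleftrightarrow> (\<exists>c. gm_value_at \<alpha> z c)"

definition gm_value :: "('p::projective_line, 'g::complex_vector) gminus \<Rightarrow> 'p \<Rightarrow> 'g"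
  where "gm_value \<alpha> z = (THE c. gm_value_at \<alpha> z c)"

definition gm_deriv :: "('p::projective_line, 'g::complex_vector) gminus \<Rightarrow> 'p \<Rightarrow> 'g"
  where "gm_deriv \<alpha> z = (THE d. gm_deriv_at \<alpha> z d)"

text \<open>The enveloping algebra of the subalgebra of maps that are regular on \<open>Z\<close>.\<close>

definition Ugm :: "'p::projective_line set \<Rightarrow> ('p, 'g::complex_lie_algebra) gminus uea set"
  where "Ugm Z = uea_sub {\<alpha>. \<forall>z \<in> Z. gm_regular \<alpha> z}"


section \<open>Currents\<close>

text \<open>Elements of the tensor product with the fibre \<open>K\<^sub>z\<close> of the canonical bundle
  are represented throughout by their coefficient with respect to the basis vector \<open>du\<^sub>z\<close>.\<close>

lemma in_gminus_pole:
  "in_gminus (\<lambda>y::'p::projective_line. (1 / (coord y - c)) *\<^sub>C (v::'g::complex_vector))"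
proof -
  have "meromorphic_at (\<lambda>y. (1 / (coord y - c)) *\<^sub>C v) z" if "z \<noteq> base_point" for z :: 'p
    unfolding meromorphic_at_def
  proof (intro exI[of _ "[(\<lambda>t. 1 / (coord z + t - c), v)]"] conjI)
    show "\<forall>(f, w) \<in> set [(\<lambda>t. 1 / (coord z + t - c), v)]. f meromorphic_on {0}"
      by (auto intro!: meromorphic_intros)
  qed (use that in \<open>simp add: lin_comb_def local_param_def\<close>)
  moreover
  define L where "L = [(\<lambda>t. t / (1 - c * t), v)]"
  have L: "\<forall>(f, w) \<in> set L. f analytic_on {0}"
    by (auto simp: L_def intro!: analytic_intros)
  have "\<forall>\<^sub>F y in at_point (base_point :: 'p). local_param base_point y \<noteq> 0"
    by (rule eventually_at_pointD) (simp add: eventually_at_filter)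
  then have ev: "\<forall>\<^sub>F y in at_point (base_point :: 'p).
      (1 / (coord y - c)) *\<^sub>C v = lin_comb L (local_param base_point y)"
    by eventually_elim (auto simp: local_param_def lin_comb_def L_def divide_simps)
  have "meromorphic_at (\<lambda>y. (1 / (coord y - c)) *\<^sub>C v) (base_point :: 'p)"
    unfolding meromorphic_at_def using L ev
    by (intro exI[of _ L]) (auto intro: analytic_on_imp_meromorphic_on)
  moreover have "value_at (\<lambda>y. (1 / (coord y - c)) *\<^sub>C v) (base_point :: 'p) 0"
    unfolding value_at_def using L ev
    by (intro exI[of _ L]) (auto simp: L_def lin_comb_def)
  ultimately show ?thesis
    unfolding in_gminus_def by metis
qed

lift_definition eps_elt :: "'g::complex_vector \<Rightarrow> 'p::projective_line \<Rightarrow> ('p, 'g) gminus"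
  is "\<lambda>v z y. (1 / (coord y - coord z)) *\<^sub>C v"
  by (simp add: in_gminus_pole)

definition eps ::
    "'g::complex_lie_algebra \<Rightarrow> 'p::projective_line \<Rightarrow> ('p, 'g) gminus uea \<Rightarrow> ('p, 'g) gminus uea"
  where "eps v z X = uea_of (eps_elt v z) * X"

text \<open>The recursion determining the family of operators \<open>\<iota>\<^sup>v(z)\<close> for fixed \<open>z\<close>.
  Note the sign of the form term: for \<open>\<alpha> = eps_elt v' w\<close> the derivative of \<open>\<alpha>\<close> at \<open>z\<close> is
  \<open>- v' / (u(z) - u(w))\<^sup>2\<close>, so this term contributes \<open>+ (v, v') / (u(z) - u(w))\<^sup>2\<close> to the
  product of the currents at \<open>z\<close> and \<open>w\<close>.\<close>

definition is_iota :: "'p::projective_line \<Rightarrow>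
    ('g::quadratic_lie_algebra \<Rightarrow> ('p, 'g) gminus uea \<Rightarrow> ('p, 'g) gminus uea) \<Rightarrow> bool"
  where "is_iota z I \<longleftrightarrow>
    (\<forall>v. I v \<in> Ugm {z} \<rightarrow>\<^sub>E Ugm {z}) \<and>
    (\<forall>v. \<forall>X \<in> Ugm {z}. \<forall>Y \<in> Ugm {z}. I v (X + Y) = I v X + I v Y) \<and>
    (\<forall>v a. \<forall>X \<in> Ugm {z}. I v (a *\<^sub>C X) = a *\<^sub>C I v X) \<and>
    (\<forall>v. I v 1 = 0) \<and>
    (\<forall>v \<alpha>. \<forall>X \<in> Ugm {z}. gm_regular \<alpha> z \<longrightarrow>
      I v (uea_of \<alpha> * X) - uea_of \<alpha> * I v X =
        - (eps v z (uea_of \<alpha> * X) - uea_of \<alpha> * eps v z X)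
        - form v (gm_deriv \<alpha> z) *\<^sub>C X
        + I (lie v (gm_value \<alpha> z)) X
        + eps (lie v (gm_value \<alpha> z)) z X)"

definition iota :: "'g::quadratic_lie_algebra \<Rightarrow> 'p::projective_line \<Rightarrow>
    ('p, 'g) gminus uea \<Rightarrow> ('p, 'g) gminus uea"
  where "iota v z = (THE I. is_iota z I) v"

definition current :: "'g::quadratic_lie_algebra \<Rightarrow> 'p::projective_line \<Rightarrow>
    ('p, 'g) gminus uea \<Rightarrow> ('p, 'g) gminus uea"
  where "current v z X = eps v z X + iota v z X"

text \<open>Limits are taken in a Hausdorff vector space topology on the enveloping algebra for which
  the product is separately continuous and the left multiplier \<open>\<epsilon>\<^sup>v\<^sub>z\<close> depends continuously
  on \<open>z\<close>.\<close>

definition current_topology ::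
    "('p::projective_line, 'g::complex_lie_algebra) gminus uea topology \<Rightarrow> bool"
  where "current_topology T \<longleftrightarrow>
    topspace T = UNIV \<and> Hausdorff_space T \<and>
    continuous_map (prod_topology T T) T (\<lambda>(X, Y). X + Y) \<and>
    continuous_map (prod_topology euclidean T) T (\<lambda>(a, X). a *\<^sub>C X) \<and>
    (\<forall>Y. continuous_map T T (\<lambda>X. X * Y)) \<and>
    (\<forall>X. continuous_map T T (\<lambda>Y. X * Y)) \<and>
    (\<forall>v. \<forall>z. z \<noteq> base_point \<longrightarrow>
      limitin T (\<lambda>y. uea_of (eps_elt v y)) (uea_of (eps_elt v z)) (at_point z))"

text \<open>The derivative of \<open>\<iota>\<^sup>v(z) X\<close> (more precisely of its coefficient of \<open>du\<^sub>z\<close>) with respect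
  to \<open>u(z)\<close>.\<close>

definition iota_deriv ::
    "('p::projective_line, 'g::quadratic_lie_algebra) gminus uea topology \<Rightarrow> 'g \<Rightarrow> 'p \<Rightarrow>
      ('p, 'g) gminus uea \<Rightarrow> ('p, 'g) gminus uea"
  where "iota_deriv T v z X =
    (THE D. limitin T (\<lambda>y. (1 / (coord y - coord z)) *\<^sub>C (iota v y X - iota v z X)) D (at_point z))"

end

theory Submission
  imports Defs
begin

text \<open>For every \<open>\<alpha>\<close> that is regular at \<open>z\<close>, the current satisfies
  \<open>j\<^sup>v(\<alpha>X) = \<alpha> j\<^sup>v(X) - (v, d\<alpha>(z)) X + j\<^bsup>[v,\<alpha>(z)]\<^esup>(X)\<close> and \<open>j\<^sup>v(1) = \<epsilon>\<^sup>v\<close>, a recursion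
  in which the two \<open>\<epsilon>\<close>-terms in the rule for \<open>\<iota>\<close> have cancelled. All statements about currents are
  proved by induction along it.

  Existence of \<open>\<iota>\<close>. The recursion respects the relations of the enveloping algebra of
  the Lie algebra \<open>S\<close> of maps regular at \<open>z\<close>, because \<open>S\<close> acts as a Lie algebra on
  \<open>\<gg> \<oplus> \<complex>\<close>, with \<open>\<gg>\<close> the algebra of values (\<open>uea_map_on_current_word\<close>). But \<open>\<iota>\<close> lives on the image of this algebra in the enveloping algebra
  of all of \<open>\<gg>\<^sub>-\<close>, so one also needs that this image satisfies no further relations. This case of
  the Poincare--Birkhoff--Witt theorem is easy because \<open>S\<close> has a complement \<open>C\<close> that is a
  subalgebra as well, namely the polynomials without constant term in \<open>1 / (u - u(z))\<close>
  (\<open>split_at_point\<close>): then \<open>\<gg>\<^sub>-\<close> acts on \<open>U S\<close>, as on the module induced from the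
  trivial module of \<open>C\<close>, and this action extends the left multiplication by \<open>S\<close>. The transposed action
  extends every linear map on \<open>U S\<close> to \<open>U \<gg>\<^sub>-\<close> (\<open>uea_sub_lift\<close>).

  Commutation. The commutator of two currents at different points satisfies a homogeneous
  recursion, so it vanishes as soon as it vanishes on \<open>1\<close>. There it is the identity
  \<open>[\<epsilon>\<^sup>v(a), \<epsilon>\<^sup>w(b)] = (\<epsilon>\<^bsup>[v,w]\<^esup>(a) - \<epsilon>\<^bsup>[v,w]\<^esup>(b)) / (u(a) - u(b))\<close> (\<open>lie_eps_elt\<close>), which is the
  partial fraction decomposition of \<open>1 / ((u - u(a)) (u - u(b)))\<close>.

  The limit. Write \<open>j\<^sub>1 X = \<epsilon>\<^sub>1 X + \<iota>\<^sub>1 X\<close> at \<open>z\<^sub>1\<close> and apply the recursion of the current \<open>j\<^sub>2\<close> at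
  \<open>z\<close> to \<open>\<epsilon>\<^sub>1 X\<close>: the result is \<open>\<epsilon>\<^sub>1 j\<^sub>2(z) X\<close> plus the two subtracted polar terms, except that
  \<open>j\<^bsup>[v\<^sub>2,v\<^sub>1]\<^esup>\<close> is taken at \<open>z\<close> instead of \<open>z\<^sub>1\<close>. Therefore the left-hand side equals
  \<open>\<epsilon>\<^sub>1 j\<^sub>2(z) X + j\<^sub>2(z) \<iota>\<^sub>1 X\<close> plus a difference quotient of \<open>j\<^bsup>[v\<^sub>2,v\<^sub>1]\<^esup> X\<close>, and it remains to show
  that \<open>j\<^sup>v(z) X\<close> is continuous in \<open>z\<close>, and differentiable if \<open>v\<close> is a bracket
  (\<open>current_cont_has_deriv\<close>). The topology only provides the continuity of \<open>\<epsilon>\<^sup>v\<close>. But the difference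
  quotient of \<open>\<epsilon>\<^bsup>[a,b]\<^esup>\<close> between \<open>z\<close> and \<open>z\<^sub>1\<close> is the commutator \<open>[\<epsilon>\<^sup>a(z), \<epsilon>\<^sup>b(z\<^sub>1)]\<close>, by the same
  partial fraction identity, and the brackets are stable under the recursion. The derivative of
  \<open>\<epsilon>\<^bsup>[v\<^sub>2,v\<^sub>1]\<^esup>\<close>, which is \<open>\<epsilon>\<^sub>2 \<epsilon>\<^sub>1 - \<epsilon>\<^sub>1 \<epsilon>\<^sub>2\<close>, turns the term \<open>\<epsilon>\<^sub>1 \<epsilon>\<^sub>2 X\<close> of \<open>\<epsilon>\<^sub>1 j\<^sub>2 X\<close> into the term
  \<open>\<epsilon>\<^sub>2 \<epsilon>\<^sub>1 X\<close> of the limit.\<close>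


section \<open>Signs and linearity of brackets and forms\<close>

lemma lie_minus_left: "lie (- x) (y::'a::complex_lie_algebra) = - lie x y"
  using lie_add_left[of x "- x" y] by (simp add: add_eq_0_iff)

lemma lie_minus_right: "lie x (- y::'a::complex_lie_algebra) = - lie x y"
  using lie_add_right[of x y "- y"] by (simp add: add_eq_0_iff)

lemma lie_diff_left: "lie (x - y) (z::'a::complex_lie_algebra) = lie x z - lie y z"
  using lie_add_left[of x "- y" z] by (simp add: lie_minus_left)

lemma lie_diff_right: "lie x (y - z::'a::complex_lie_algebra) = lie x y - lie x z"
  using lie_add_right[of x y "- z"] by (simp add: lie_minus_right)

lemma lie_anticomm: "lie x y = - lie y (x::'a::complex_lie_algebra)"
proof -
  have "lie x x + lie x y + (lie y x + lie y y) = lie (x + y) (x + y)"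
    by (simp add: lie_add_left lie_add_right)
  then show ?thesis by (simp add: lie_self eq_neg_iff_add_eq_0)
qed

lemma lie_derivation_right: "lie (lie x y) (z::'a::complex_lie_algebra) = lie (lie x z) y + lie x (lie y z)"
proof -
  have "lie x (lie y z) + lie y (lie z x) + lie z (lie x y) = 0" by (rule jacobi)
  moreover have "lie z (lie x y) = - lie (lie x y) z" "lie y (lie z x) = lie (lie x z) y"
    by (rule lie_anticomm) (metis lie_anticomm lie_minus_left lie_minus_right minus_minus)
  ultimately show ?thesis by (simp add: algebra_simps)
qed

lemma form_add_right: "form (x::'g::quadratic_lie_algebra) (y + z) = form x y + form x z"
  by (metis form_add_left form_sym)

lemma form_scaleC_right: "form (x::'g::quadratic_lie_algebra) (a *\<^sub>C y) = a * form x y"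
  by (metis form_scaleC_left form_sym)

lemma form_minus_right: "form (x::'g::quadratic_lie_algebra) (- y) = - form x y"
  using form_scaleC_right[of x "- 1" y] by simp


section \<open>Extension of linear maps from the enveloping algebra of a subalgebra\<close>

text \<open>A function on words that respects the defining relations of the enveloping algebra of \<open>S\<close>,
  that is, a linear map on this algebra given by its values on products of elements of \<open>S\<close>. Working
  with such functions avoids a type for the enveloping algebra of a subset of a type.\<close>

definition uea_map_on :: "'a::complex_lie_algebra set \<Rightarrow> ('a list \<Rightarrow> 'v::complex_vector) \<Rightarrow> bool"
  where "uea_map_on S h \<longleftrightarrow>
    (\<forall>xs \<in> lists S. \<forall>ys \<in> lists S.
      (\<forall>x \<in> S. \<forall>y \<in> S. h (xs @ (x + y) # ys) = h (xs @ x # ys) + h (xs @ y # ys)) \<and>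
      (\<forall>a. \<forall>x \<in> S. h (xs @ (a *\<^sub>C x) # ys) = a *\<^sub>C h (xs @ x # ys)) \<and>
      (\<forall>x \<in> S. \<forall>y \<in> S. h (xs @ x # y # ys) - h (xs @ y # x # ys) = h (xs @ lie x y # ys)))"

lemma uea_map_on_Cons: "uea_map_on S h \<Longrightarrow> s \<in> S \<Longrightarrow> uea_map_on S (\<lambda>w. h (s # w))"
  unfolding uea_map_on_def by (metis append_Cons lists.Cons)

lemma uea_map_on_headD:
  assumes "uea_map_on S h" "w \<in> lists S"
  shows "x \<in> S \<Longrightarrow> y \<in> S \<Longrightarrow> h ((x + y) # w) = h (x # w) + h (y # w)"
    and "x \<in> S \<Longrightarrow> h ((a *\<^sub>C x) # w) = a *\<^sub>C h (x # w)"
    and "x \<in> S \<Longrightarrow> y \<in> S \<Longrightarrow> h (x # y # w) - h (y # x # w) = h (lie x y # w)"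
  using assms unfolding uea_map_on_def by (metis append_Nil lists.Nil)+

text \<open>The projection onto a subalgebra \<open>S\<close> along a complementary subalgebra, the kernel of \<open>pr\<close>.\<close>

locale split_lie_algebra =
  fixes S :: "'a::complex_lie_algebra set" and pr :: "'a \<Rightarrow> 'a"
  assumes pr_add: "pr (x + y) = pr x + pr y"
    and pr_scaleC: "pr (a *\<^sub>C x) = a *\<^sub>C pr x"
    and pr_in: "pr x \<in> S"
    and pr_id: "x \<in> S \<Longrightarrow> pr x = x"
    and lie_in: "x \<in> S \<Longrightarrow> y \<in> S \<Longrightarrow> lie x y \<in> S"
    and kernel_lie: "pr x = 0 \<Longrightarrow> pr y = 0 \<Longrightarrow> pr (lie x y) = 0"
begin

lemma pr_minus: "pr (- x) = - pr x"
  using pr_scaleC[of "- 1" x] by simp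

lemma pr_diff: "pr (x - y) = pr x - pr y"
  using pr_add[of x "- y"] by (simp add: pr_minus)

text \<open>The difference of the two sides is the projection of a bracket of two elements of the kernel;
  this is where the kernel has to be a subalgebra.\<close>

lemma pr_lie_mixed: "pr (lie x (pr y)) + pr (lie (pr x) y) - pr (lie x y) = lie (pr x) (pr y)"
proof -
  have "lie x (pr y) + lie (pr x) y - lie x y = lie (pr x) (pr y) - lie (x - pr x) (y - pr y)"
    by (simp add: lie_diff_left lie_diff_right)
  moreover have "pr (lie (x - pr x) (y - pr y)) = 0"
    by (rule kernel_lie) (simp_all add: pr_diff pr_id pr_in)
  ultimately have "pr (lie x (pr y) + lie (pr x) y - lie x y) = pr (lie (pr x) (pr y))"
    by (simp add: pr_diff)
  then show ?thesis by (simp add: pr_diff pr_add pr_id lie_in pr_in)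
qed

text \<open>The whole Lie algebra acts on the enveloping algebra of \<open>S\<close> by \<open>x \<cdot> 1 = pr x\<close> and
  \<open>x \<cdot> (s w) = s (x \<cdot> w) + [x, s] \<cdot> w\<close>: this is the module induced from the trivial module of the
  kernel of \<open>pr\<close>. Here \<open>transpose_act h x\<close> is the map \<open>w \<mapsto> h (x \<cdot> w)\<close>.\<close>

fun transpose_act :: "('a list \<Rightarrow> 'v::complex_vector) \<Rightarrow> 'a \<Rightarrow> 'a list \<Rightarrow> 'v" where
  "transpose_act h x [] = h [pr x]"
| "transpose_act h x (s # w) = transpose_act (\<lambda>u. h (s # u)) x w + transpose_act h (lie x s) w"

lemma transpose_act_cong:
  assumes "\<And>u. u \<in> lists S \<Longrightarrow> h u = h' u" "w \<in> lists S"
  shows "transpose_act h x w = transpose_act h' x w"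
  using assms(2,1)
proof (induction w arbitrary: h h' x rule: lists.induct)
  case (Cons s w)
  have "transpose_act (\<lambda>u. h (s # u)) x w = transpose_act (\<lambda>u. h' (s # u)) x w"
    by (rule Cons.IH) (simp add: Cons)
  moreover have "transpose_act h (lie x s) w = transpose_act h' (lie x s) w"
    by (rule Cons.IH) (rule Cons)
  ultimately show ?case by simp
qed (simp add: pr_in)

lemma transpose_act_add: "transpose_act (\<lambda>u. h u + h' u) x w = transpose_act h x w + transpose_act h' x w"
proof (induction w arbitrary: h h' x)
  case (Cons s w)
  show ?case using Cons[of h h'] Cons[of "\<lambda>u. h (s # u)" "\<lambda>u. h' (s # u)"] by (simp add: algebra_simps)
qed simp

lemma transpose_act_scaleC: "transpose_act (\<lambda>u. a *\<^sub>C h u) x w = a *\<^sub>C transpose_act h x w"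
proof (induction w arbitrary: h x)
  case (Cons s w)
  show ?case using Cons[of h] Cons[of "\<lambda>u. h (s # u)"] by (simp add: scaleC_add_right)
qed simp

lemma transpose_act_diff: "transpose_act (\<lambda>u. h u - h' u) x w = transpose_act h x w - transpose_act h' x w"
  using transpose_act_add[of h "\<lambda>u. (- 1) *\<^sub>C h' u"] transpose_act_scaleC[of "- 1" h'] by simp

lemma transpose_act_add_right:
  assumes "w \<in> lists S" "uea_map_on S h"
  shows "transpose_act h (x + y) w = transpose_act h x w + transpose_act h y w"
  using assms
proof (induction w arbitrary: h x y rule: lists.induct)
  case Nil
  then show ?case using uea_map_on_headD(1)[OF Nil, of "[]"] by (simp add: pr_add pr_in)
next
  case (Cons s w)
  then show ?case using Cons.IH[OF Cons.prems] Cons.IH[OF uea_map_on_Cons[OF Cons.prems]]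
    by (simp add: lie_add_left algebra_simps)
qed

lemma transpose_act_scaleC_right:
  assumes "w \<in> lists S" "uea_map_on S h"
  shows "transpose_act h (a *\<^sub>C x) w = a *\<^sub>C transpose_act h x w"
  using assms
proof (induction w arbitrary: h x rule: lists.induct)
  case Nil
  then show ?case using uea_map_on_headD(2)[OF Nil, of "[]"] by (simp add: pr_scaleC pr_in)
next
  case (Cons s w)
  then show ?case using Cons.IH[OF Cons.prems] Cons.IH[OF uea_map_on_Cons[OF Cons.prems]]
    by (simp add: lie_scaleC_left scaleC_add_right)
qed

lemma transpose_act_diff_right:
  assumes "w \<in> lists S" "uea_map_on S h"
  shows "transpose_act h (x - y) w = transpose_act h x w - transpose_act h y w"
  using transpose_act_add_right[OF assms, of x "(- 1) *\<^sub>C y"]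
    transpose_act_scaleC_right[OF assms, of "- 1" y] by simp

lemma uea_map_on_transpose_act:
  assumes "uea_map_on S h"
  shows "uea_map_on S (transpose_act h x)"
proof -
  have "(\<forall>a \<in> S. \<forall>b \<in> S. transpose_act h x (us @ (a + b) # w)
            = transpose_act h x (us @ a # w) + transpose_act h x (us @ b # w)) \<and>
        (\<forall>c. \<forall>a \<in> S. transpose_act h x (us @ (c *\<^sub>C a) # w) = c *\<^sub>C transpose_act h x (us @ a # w)) \<and>
        (\<forall>a \<in> S. \<forall>b \<in> S. transpose_act h x (us @ a # b # w) - transpose_act h x (us @ b # a # w)
            = transpose_act h x (us @ lie a b # w))"
    if "us \<in> lists S" "w \<in> lists S" for us w
    using that(1) assms
  proof (induction us arbitrary: h x rule: lists.induct)
    case Nil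
    note h = Nil.prems
    show ?case
    proof (intro conjI ballI allI; unfold append_Nil)
      fix a b assume S: "a \<in> S" "b \<in> S"
      have "transpose_act (\<lambda>u. h ((a + b) # u)) x w = transpose_act (\<lambda>u. h (a # u) + h (b # u)) x w"
        by (rule transpose_act_cong) (use S that h in \<open>auto simp: uea_map_on_headD(1)\<close>)
      then show "transpose_act h x ((a + b) # w) = transpose_act h x (a # w) + transpose_act h x (b # w)"
        using that h by (simp add: transpose_act_add lie_add_right transpose_act_add_right algebra_simps)
      have "transpose_act (\<lambda>u. h (a # b # u)) x w - transpose_act (\<lambda>u. h (b # a # u)) x w
          = transpose_act (\<lambda>u. h (lie a b # u)) x w"
        unfolding transpose_act_diff[symmetric]
        by (rule transpose_act_cong) (use S that h in \<open>auto simp: uea_map_on_headD(3)\<close>)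
      moreover have "transpose_act h (lie (lie x a) b) w - transpose_act h (lie (lie x b) a) w
          = transpose_act h (lie x (lie a b)) w"
        unfolding transpose_act_diff_right[OF that(2) h, symmetric]
        by (simp add: lie_derivation_right[of x a b])
      ultimately show "transpose_act h x (a # b # w) - transpose_act h x (b # a # w)
          = transpose_act h x (lie a b # w)"
        by (simp add: algebra_simps)
    next
      fix c a assume S: "a \<in> S"
      have "transpose_act (\<lambda>u. h ((c *\<^sub>C a) # u)) x w = transpose_act (\<lambda>u. c *\<^sub>C h (a # u)) x w"
        by (rule transpose_act_cong) (use S that h in \<open>auto simp: uea_map_on_headD(2)\<close>)
      then show "transpose_act h x ((c *\<^sub>C a) # w) = c *\<^sub>C transpose_act h x (a # w)"
        using that h
        by (simp add: transpose_act_scaleC lie_scaleC_right transpose_act_scaleC_right scaleC_add_right)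
    qed
  next
    case (Cons s us)
    note IH1 = Cons.IH[OF Cons.prems, of "lie x s"]
      and IH2 = Cons.IH[OF uea_map_on_Cons[OF Cons.prems \<open>s \<in> S\<close>], of x]
    show ?case
    proof (intro conjI ballI allI)
      fix a b assume S: "a \<in> S" "b \<in> S"
      show "transpose_act h x ((s # us) @ (a + b) # w)
          = transpose_act h x ((s # us) @ a # w) + transpose_act h x ((s # us) @ b # w)"
        using IH1 IH2 S by (simp add: algebra_simps)
      show "transpose_act h x ((s # us) @ a # b # w) - transpose_act h x ((s # us) @ b # a # w)
            = transpose_act h x ((s # us) @ lie a b # w)"
        using IH1 IH2 S by (simp add: add_diff_add)
    next
      fix c a assume S: "a \<in> S"
      show "transpose_act h x ((s # us) @ (c *\<^sub>C a) # w) = c *\<^sub>C transpose_act h x ((s # us) @ a # w)"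
        using IH1 IH2 S by (simp add: scaleC_add_right)
    qed
  qed
  then show ?thesis unfolding uea_map_on_def by blast
qed

text \<open>The elements of \<open>S\<close> act by left multiplication: commuting \<open>s\<close> past \<open>a\<close> is the relation of the
  enveloping algebra.\<close>

lemma transpose_act_sub:
  assumes "w \<in> lists S" "uea_map_on S h" "s \<in> S"
  shows "transpose_act h s w = h (s # w)"
  using assms
proof (induction w arbitrary: h s rule: lists.induct)
  case Nil
  then show ?case by (simp add: pr_id)
next
  case (Cons a w)
  then show ?case
    using Cons.IH[OF Cons.prems(1) lie_in[OF Cons.prems(2) \<open>a \<in> S\<close>]]
      Cons.IH[OF uea_map_on_Cons[OF Cons.prems(1) \<open>a \<in> S\<close>] Cons.prems(2)]
      uea_map_on_headD(3)[OF Cons.prems(1), of w s a]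
    by (simp add: algebra_simps)
qed

text \<open>The action is one of Lie algebras. The defect \<open>x y - y x - [x, y]\<close> commutes with \<open>S\<close> up to
  defects of the same form, by the Jacobi identity, so that it suffices to see that it
  kills \<open>1\<close>; there it is the identity \<open>pr_lie_mixed\<close>.\<close>

lemma transpose_act_lie:
  assumes "w \<in> lists S" "uea_map_on S h"
  shows "transpose_act (transpose_act h x) y w - transpose_act (transpose_act h y) x w
    = transpose_act h (lie x y) w"
  using assms
proof (induction w arbitrary: h x y rule: lists.induct)
  case Nil
  note h1 = uea_map_on_headD[OF Nil, of "[]", simplified]
  have *: "h [- s] = - h [s]" if "s \<in> S" for s
    using h1(2)[OF that, of "- 1"] by simp
  have "h [pr (lie x (pr y))] + h [pr (lie (pr x) y)] = h [lie (pr x) (pr y)] + h [pr (lie x y)]"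
    using pr_lie_mixed[of x y] by (simp add: h1(1)[symmetric] pr_in lie_in algebra_simps)
  moreover have "h [pr y, pr x] - h [pr x, pr y] = - h [lie (pr x) (pr y)]"
    by (subst h1(3)) (simp_all add: pr_in *[symmetric] lie_in lie_anticomm[of "pr y"])
  moreover have "h [pr (lie y (pr x))] = - h [pr (lie (pr x) y)]"
    by (subst lie_anticomm) (simp add: pr_minus * pr_in)
  ultimately show ?case by (simp add: algebra_simps)
next
  case (Cons s w)
  let ?hs = "\<lambda>u. h (s # u)"
  note hs = uea_map_on_Cons[OF Cons.prems \<open>s \<in> S\<close>]
  have exp: "transpose_act (transpose_act h x) y (s # w)
      = transpose_act (transpose_act ?hs x) y w + transpose_act (transpose_act h (lie x s)) y w
        + transpose_act (transpose_act h x) (lie y s) w" for x y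
    by (simp add: transpose_act_add)
  have "transpose_act h (lie (lie x y) s) w = transpose_act h (lie (lie x s) y) w + transpose_act h (lie x (lie y s)) w"
    by (simp add: lie_derivation_right[of x y s] transpose_act_add_right Cons)
  then show ?case
    using Cons.IH[OF hs, of x y] Cons.IH[OF Cons.prems, of "lie x s" y] Cons.IH[OF Cons.prems, of x "lie y s"]
    unfolding exp by (simp add: algebra_simps)
qed

text \<open>The map \<open>x\<^sub>1 \<dots> x\<^sub>n \<mapsto> h (x\<^sub>1 \<cdot> (\<dots> (x\<^sub>n \<cdot> 1)))\<close>.\<close>

fun extension :: "('a list \<Rightarrow> 'v::complex_vector) \<Rightarrow> 'a list \<Rightarrow> 'v" where
  "extension h [] = h []"
| "extension h (x # w) = extension (transpose_act h x) w"

lemma extension_cong: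
  "(\<And>u. u \<in> lists S \<Longrightarrow> h u = h' u) \<Longrightarrow> extension h w = extension h' w"
proof (induction w arbitrary: h h')
  case (Cons x w)
  have "extension (transpose_act h x) w = extension (transpose_act h' x) w"
    by (rule Cons.IH) (rule transpose_act_cong, rule Cons.prems)
  then show ?case by simp
qed simp

lemma extension_add: "extension (\<lambda>u. h u + h' u) w = extension h w + extension h' w"
proof (induction w arbitrary: h h')
  case (Cons x w)
  show ?case by (simp add: transpose_act_add[abs_def] Cons)
qed simp

lemma extension_scaleC: "extension (\<lambda>u. a *\<^sub>C h u) w = a *\<^sub>C extension h w"
proof (induction w arbitrary: h)
  case (Cons x w)
  show ?case by (simp add: transpose_act_scaleC[abs_def] Cons)
qed simp

lemma extension_diff: "extension (\<lambda>u. h u - h' u) w = extension h w - extension h' w"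
  using extension_add[of h "\<lambda>u. (- 1) *\<^sub>C h' u"] extension_scaleC[of "- 1" h'] by simp

lemma extension_extends: "w \<in> lists S \<Longrightarrow> uea_map_on S h \<Longrightarrow> extension h w = h w"
proof (induction w arbitrary: h rule: lists.induct)
  case (Cons s w)
  then show ?case
    using Cons.IH[OF uea_map_on_transpose_act[OF Cons.prems]] by (simp add: transpose_act_sub)
qed simp

lemma uea_map_on_extension:
  assumes "uea_map_on S h"
  shows "uea_map_on UNIV (extension h)"
proof -
  have "extension h (us @ (a + b) # w) = extension h (us @ a # w) + extension h (us @ b # w) \<and>
        extension h (us @ (c *\<^sub>C a) # w) = c *\<^sub>C extension h (us @ a # w) \<and>
        extension h (us @ a # b # w) - extension h (us @ b # a # w) = extension h (us @ lie a b # w)"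
    for us w a b c
    using assms
  proof (induction us arbitrary: h)
    case Nil
    have "extension (transpose_act h (a + b)) w
        = extension (\<lambda>u. transpose_act h a u + transpose_act h b u) w"
      "extension (transpose_act h (c *\<^sub>C a)) w = extension (\<lambda>u. c *\<^sub>C transpose_act h a u) w"
      "extension (\<lambda>u. transpose_act (transpose_act h a) b u - transpose_act (transpose_act h b) a u) w
        = extension (transpose_act h (lie a b)) w"
      by (rule extension_cong;
        simp add: transpose_act_add_right transpose_act_scaleC_right transpose_act_lie Nil)+
    then show ?case by (simp add: extension_add extension_scaleC extension_diff)
  next
    case (Cons x us)
    from Cons.IH[OF uea_map_on_transpose_act[OF Cons.prems]] show ?case by simp
  qed
  then show ?thesis unfolding uea_map_on_def by simp
qed

end


section \<open>Linear maps on enveloping algebras\<close>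

definition word_ext :: "('a list \<Rightarrow> 'v::complex_vector) \<Rightarrow> 'a free_algebra \<Rightarrow> 'v"
  where "word_ext H p = (\<Sum>w \<in> Poly_Mapping.keys p. Poly_Mapping.lookup p w *\<^sub>C H (letters w))"

lemma word_ext_superset:
  assumes "finite A" "Poly_Mapping.keys p \<subseteq> A"
  shows "word_ext H p = (\<Sum>w \<in> A. Poly_Mapping.lookup p w *\<^sub>C H (letters w))"
  unfolding word_ext_def
  by (rule sum.mono_neutral_left[OF assms]) (simp add: in_keys_iff)

lemma word_ext_add: "word_ext H (p + q) = word_ext H p + word_ext H q"
proof -
  let ?A = "Poly_Mapping.keys p \<union> Poly_Mapping.keys q"
  have "finite ?A" by simp
  from word_ext_superset[OF this, of p H] word_ext_superset[OF this, of q H]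
    word_ext_superset[OF this, of "p + q" H] keys_add[of p q]
  show ?thesis by (simp add: lookup_add scaleC_add_left sum.distrib)
qed

lemma word_ext_zero [simp]: "word_ext H 0 = 0"
  by (simp add: word_ext_def)

lemma word_ext_single [simp]: "word_ext H (Poly_Mapping.single w c) = c *\<^sub>C H (letters w)"
  by (simp add: word_ext_def)

lemma word_ext_diff: "word_ext H (p - q) = word_ext H p - word_ext H q"
  using word_ext_add[of H "p - q" q] by (simp add: algebra_simps)

lemma word_ext_sum: "word_ext H (sum f A) = (\<Sum>i \<in> A. word_ext H (f i))"
  by (induction A rule: infinite_finite_induct) (simp_all add: word_ext_add)

lemma sum_single_lookup: "(\<Sum>w \<in> Poly_Mapping.keys p. Poly_Mapping.single w (Poly_Mapping.lookup p w)) = p"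
  by (rule poly_mapping_eqI) (simp add: lookup_sum lookup_single when_def in_keys_iff)

lemma word_ext_const_mult: "word_ext H (const c * p) = c *\<^sub>C word_ext H p"
proof -
  have "word_ext H (const c * p) = word_ext H (const c *
      (\<Sum>w \<in> Poly_Mapping.keys p. Poly_Mapping.single w (Poly_Mapping.lookup p w)))"
    by (simp only: sum_single_lookup)
  also have "\<dots> = c *\<^sub>C word_ext H p"
    unfolding word_ext_def[of H p]
    by (simp add: sum_distrib_left mult_single word_ext_sum complex_vector.scale_sum_right scaleC_scaleC)
  finally show ?thesis .
qed

text \<open>The linear extension kills the ideal of relations. The multipliers are kept in the induction since
  the ideal is closed under multiplication from both sides; for the generators they may
  be taken to be monomials.\<close>

lemma word_ext_null:
  assumes H: "uea_map_on UNIV H" and "uea_null p"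
  shows "word_ext H (a * p * b) = 0"
proof -
  have reduce: "word_ext H (a * r * b) = 0"
    if *: "\<And>u c v d. word_ext H (Poly_Mapping.single u c * r * Poly_Mapping.single v d) = 0" for a r b
  proof -
    have "a * r * b = (\<Sum>w \<in> Poly_Mapping.keys a. Poly_Mapping.single w (Poly_Mapping.lookup a w)) * r *
       (\<Sum>w \<in> Poly_Mapping.keys b. Poly_Mapping.single w (Poly_Mapping.lookup b w))"
      by (simp only: sum_single_lookup)
    also have "\<dots> = (\<Sum>v \<in> Poly_Mapping.keys b. \<Sum>u \<in> Poly_Mapping.keys a.
       Poly_Mapping.single u (Poly_Mapping.lookup a u) * r * Poly_Mapping.single v (Poly_Mapping.lookup b v))"
      by (simp only: sum_distrib_left sum_distrib_right)
    finally show ?thesis by (simp add: word_ext_sum *)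
  qed
  have H1: "H (us @ (x + y) # w) = H (us @ x # w) + H (us @ y # w)"
    and H2: "H (us @ (e *\<^sub>C x) # w) = e *\<^sub>C H (us @ x # w)"
    and H3: "H (us @ x # y # w) = H (us @ y # x # w) + H (us @ lie x y # w)" for us x y w e
  proof -
    have "H (us @ x # y # w) - H (us @ y # x # w) = H (us @ lie x y # w)"
      using H unfolding uea_map_on_def lists_UNIV by blast
    then show "H (us @ x # y # w) = H (us @ y # x # w) + H (us @ lie x y # w)"
      by (simp add: diff_eq_eq add.commute)
  qed (use H in \<open>unfold uea_map_on_def lists_UNIV, blast+\<close>)
  show ?thesis using assms(2)
  proof (induction arbitrary: a b)
    case (letter_add x y)
    show ?case
      by (rule reduce) (simp add: algebra_simps mult_single word_ext_diff word_ext_add plus_word_monoid_def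
        H1 scaleC_add_right)
  next
    case (letter_scaleC c x)
    show ?case
      by (rule reduce) (simp add: algebra_simps mult_single word_ext_diff word_ext_add plus_word_monoid_def
        zero_word_monoid_def H2 scaleC_scaleC)
  next
    case (letter_lie x y)
    show ?case
      by (rule reduce) (simp add: algebra_simps mult_single word_ext_diff word_ext_add plus_word_monoid_def
        H3[of _ x y] scaleC_add_right)
  next
    case (add p q)
    then show ?case by (simp add: distrib_left distrib_right word_ext_add)
  next
    case (mult p a' b')
    from mult.IH[of "a * a'" "b' * b"] show ?case by (simp add: mult.assoc)
  qed
qed

definition uea_word :: "'a::complex_lie_algebra list \<Rightarrow> 'a uea"
  where "uea_word xs = prod_list (map uea_of xs)"

lemma uea_word_Nil [simp]: "uea_word [] = 1"
  and uea_word_Cons: "uea_word (x # xs) = uea_of x * uea_word xs"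
  by (simp_all add: uea_word_def)

lemma uea_word_append: "uea_word (xs @ ys) = uea_word xs * uea_word ys"
  by (simp add: uea_word_def)

lemma abs_uea_add: "abs_uea (p + q) = abs_uea p + abs_uea q"
  by (simp add: plus_uea.abs_eq)

lemma abs_uea_eq_iff: "abs_uea p = abs_uea q \<longleftrightarrow> uea_null (p - q)"
  by (simp add: uea.abs_eq_iff)

lemma abs_uea_single: "abs_uea (Poly_Mapping.single (Word xs) c) = c *\<^sub>C uea_word xs"
proof -
  have "abs_uea (Poly_Mapping.single (Word xs) 1) = uea_word xs"
  proof (induction xs)
    case Nil
    then show ?case by (simp add: one_uea_def flip: zero_word_monoid_def)
  next
    case (Cons x xs)
    have "Poly_Mapping.single (Word (x # xs)) 1 = letter x * Poly_Mapping.single (Word xs) (1::complex)"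
      by (simp add: mult_single plus_word_monoid_def)
    then have "abs_uea (Poly_Mapping.single (Word (x # xs)) 1)
        = abs_uea (letter x) * abs_uea (Poly_Mapping.single (Word xs) 1)"
      by (simp only: times_uea.abs_eq)
    then show ?case using Cons by (simp add: uea_word_Cons uea_of.abs_eq)
  qed
  then have "c *\<^sub>C uea_word xs = c *\<^sub>C abs_uea (Poly_Mapping.single (Word xs) 1)" by simp
  also have "\<dots> = abs_uea (Poly_Mapping.single (Word xs) c)"
    by (simp add: scaleC_uea.abs_eq mult_single)
  finally show ?thesis ..
qed

lemma uea_scaleC_mult: "(a *\<^sub>C X) * Y = a *\<^sub>C (X * Y :: 'a::complex_lie_algebra uea)"
  by transfer (simp add: uea_null_zero mult.assoc)

lemma const_commute: "const c * p = p * (const c :: 'a free_algebra)"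
proof -
  have "const c * (\<Sum>w \<in> Poly_Mapping.keys p. Poly_Mapping.single w (Poly_Mapping.lookup p w))
    = (\<Sum>w \<in> Poly_Mapping.keys p. Poly_Mapping.single w (Poly_Mapping.lookup p w)) * const c"
    by (simp add: sum_distrib_left sum_distrib_right mult_single mult.commute)
  then show ?thesis by (simp only: sum_single_lookup)
qed

lemma uea_mult_scaleC: "X * (a *\<^sub>C Y) = a *\<^sub>C (X * Y :: 'a::complex_lie_algebra uea)"
proof transfer
  fix X Y :: "'a free_algebra" and a
  have "X * (const a * Y) = const a * (X * Y)"
    by (metis mult.assoc const_commute)
  then show "uea_null (X * (const a * Y) - const a * (X * Y))" by (rule uea_null_eqI)
qed

lemma uea_of_add: "uea_of (x + y) = uea_of x + (uea_of y :: 'a::complex_lie_algebra uea)"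
  by transfer (metis diff_diff_add uea_null.letter_add)

lemma uea_of_scaleC: "uea_of (a *\<^sub>C x) = a *\<^sub>C (uea_of x :: 'a::complex_lie_algebra uea)"
  by transfer (rule uea_null.letter_scaleC)

lemma uea_of_lie: "uea_of (lie x y) = uea_of x * uea_of y - (uea_of y * uea_of x :: 'a::complex_lie_algebra uea)"
  by transfer (metis minus_diff_eq uea_null.letter_lie uea_null_minus)

lemma uea_of_minus: "uea_of (- x) = - (uea_of x :: 'a::complex_lie_algebra uea)"
  using uea_of_scaleC[of "- 1" x] by simp

lemma uea_of_diff: "uea_of (x - y) = uea_of x - (uea_of y :: 'a::complex_lie_algebra uea)"
  using uea_of_add[of x "- y"] by (simp add: uea_of_minus)

text \<open>The universal property of the enveloping algebra, for linear maps instead of homomorphisms.\<close>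

lemma uea_map_on_lift:
  assumes "uea_map_on UNIV (H :: 'a::complex_lie_algebra list \<Rightarrow> 'v::complex_vector)"
  shows "\<exists>F :: 'a uea \<Rightarrow> 'v. (\<forall>X Y. F (X + Y) = F X + F Y) \<and> (\<forall>a X. F (a *\<^sub>C X) = a *\<^sub>C F X) \<and>
    (\<forall>xs. F (uea_word xs) = H xs)"
proof -
  define F where "F X = word_ext H (rep_uea X)" for X
  have F: "F (abs_uea p) = word_ext H p" for p
  proof -
    have "uea_null (rep_uea (abs_uea p) - p)"
      using abs_uea_eq_iff Quotient3_abs_rep[OF Quotient3_uea] by metis
    from word_ext_null[OF assms this, of 1 1] show ?thesis
      by (simp add: F_def word_ext_diff)
  qed
  have "F (X + Y) = F X + F Y" for X Y
    by (induction X; induction Y) (simp add: F word_ext_add flip: abs_uea_add)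
  moreover have "F (a *\<^sub>C X) = a *\<^sub>C F X" for a X
    by (induction X) (simp add: F word_ext_const_mult scaleC_uea.abs_eq)
  moreover have "F (uea_word xs) = H xs" for xs
    using F[of "Poly_Mapping.single (Word xs) 1"] by (simp add: abs_uea_single scaleC_one)
  ultimately show ?thesis by blast
qed

lemma uea_sub_add: "X \<in> uea_sub S \<Longrightarrow> Y \<in> uea_sub S \<Longrightarrow> X + Y \<in> uea_sub S"
  unfolding uea_sub_def using keys_add by (fastforce simp flip: abs_uea_add)

lemma uea_sub_word: "xs \<in> lists S \<Longrightarrow> c *\<^sub>C uea_word xs \<in> uea_sub S"
  unfolding uea_sub_def
  by (rule image_eqI[where x = "Poly_Mapping.single (Word xs) c"]) (auto simp: abs_uea_single)

lemma uea_sub_one: "1 \<in> uea_sub S"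
  using uea_sub_word[of "[]" S 1] by (simp add: scaleC_one)

lemma uea_sub_zero: "0 \<in> uea_sub S"
  using uea_sub_word[of "[]" S 0] by simp

lemma uea_sub_span_induct [consumes 1, case_names zero add word]:
  assumes "X \<in> uea_sub S" "P 0" "\<And>X Y. P X \<Longrightarrow> P Y \<Longrightarrow> X \<in> uea_sub S \<Longrightarrow> Y \<in> uea_sub S \<Longrightarrow> P (X + Y)"
    "\<And>c xs. xs \<in> lists S \<Longrightarrow> P (c *\<^sub>C uea_word xs)"
  shows "P X"
proof -
  obtain p where p: "X = abs_uea p" "\<And>w. w \<in> Poly_Mapping.keys p \<Longrightarrow> letters w \<in> lists S"
    using assms(1) unfolding uea_sub_def by auto
  have *: "P (abs_uea (\<Sum>w \<in> A. Poly_Mapping.single w (Poly_Mapping.lookup p w))) \<and>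
     abs_uea (\<Sum>w \<in> A. Poly_Mapping.single w (Poly_Mapping.lookup p w)) \<in> uea_sub S"
    if "A \<subseteq> Poly_Mapping.keys p" for A
    using finite_subset[OF that finite_keys] that
  proof (induction A)
    case empty
    then show ?case using assms(2) uea_sub_zero by (simp flip: zero_uea_def)
  next
    case (insert w A)
    obtain xs where w: "w = Word xs" by (cases w)
    with p(2)[of w] insert have "xs \<in> lists S" by auto
    from assms(4)[OF this] uea_sub_word[OF this] insert show ?case
      by (auto simp: abs_uea_add w abs_uea_single intro: assms(3) uea_sub_add)
  qed
  from this[OF subset_refl] show ?thesis by (simp add: sum_single_lookup p)
qed

lemma uea_sub_scaleC: "X \<in> uea_sub S \<Longrightarrow> a *\<^sub>C X \<in> uea_sub S"
  by (induction rule: uea_sub_span_induct)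
    (auto simp: uea_sub_zero uea_sub_add uea_sub_word scaleC_add_right scaleC_scaleC)

lemma uea_sub_uminus: "X \<in> uea_sub S \<Longrightarrow> - X \<in> uea_sub S"
  using uea_sub_scaleC[of X S "- 1"] by simp

lemma uea_sub_diff: "X \<in> uea_sub S \<Longrightarrow> Y \<in> uea_sub S \<Longrightarrow> X - Y \<in> uea_sub S"
  using uea_sub_add[of X S "- Y"] uea_sub_uminus[of Y S] by simp

lemma uea_sub_mult:
  assumes "s \<in> S" "X \<in> uea_sub S"
  shows "uea_of s * X \<in> uea_sub S"
  using assms(2)
proof (induction rule: uea_sub_span_induct)
  case (word c xs)
  then show ?case using assms(1) uea_sub_word[of "s # xs" S c] by (simp add: uea_mult_scaleC uea_word_Cons)
qed (auto simp: uea_sub_zero uea_sub_add distrib_left)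

lemma uea_sub_mono: "S \<subseteq> S' \<Longrightarrow> X \<in> uea_sub S \<Longrightarrow> X \<in> uea_sub S'"
  unfolding uea_sub_def by blast

text \<open>Induction on the number of factors of a product of elements of \<open>S\<close>.\<close>

lemma uea_sub_induct [consumes 1, case_names one mult add scaleC]:
  assumes "X \<in> uea_sub S" "P 1" "\<And>s X. s \<in> S \<Longrightarrow> X \<in> uea_sub S \<Longrightarrow> P X \<Longrightarrow> P (uea_of s * X)"
    "\<And>X Y. X \<in> uea_sub S \<Longrightarrow> Y \<in> uea_sub S \<Longrightarrow> P X \<Longrightarrow> P Y \<Longrightarrow> P (X + Y)"
    "\<And>c X. X \<in> uea_sub S \<Longrightarrow> P X \<Longrightarrow> P (c *\<^sub>C X)"
  shows "P X"
  using assms(1)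
proof (induction rule: uea_sub_span_induct)
  case zero
  show ?case using assms(5)[OF uea_sub_one assms(2), of 0] by simp
next
  case (word c xs)
  from word have "P (uea_word xs) \<and> uea_word xs \<in> uea_sub S"
    by (induction xs rule: lists.induct)
      (auto simp: uea_word_Cons assms(2) uea_sub_one intro: assms(3) uea_sub_mult)
  then show ?case by (auto intro: assms(5))
qed (rule assms(4))

context split_lie_algebra begin

text \<open>The form of the Poincare--Birkhoff--Witt theorem that is needed: the products of elements of
  \<open>S\<close> satisfy no relations in the large enveloping algebra beyond those of the small one.\<close>

lemma uea_sub_lift:
  assumes "uea_map_on S (h :: 'a list \<Rightarrow> 'v::complex_vector)"
  shows "\<exists>F :: 'a uea \<Rightarrow> 'v. (\<forall>X Y. F (X + Y) = F X + F Y) \<and> (\<forall>a X. F (a *\<^sub>C X) = a *\<^sub>C F X) \<and>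
    (\<forall>xs \<in> lists S. F (uea_word xs) = h xs)"
  using uea_map_on_lift[OF uea_map_on_extension[OF assms]] by (metis assms extension_extends)

end

lemma split_lie_algebraI:
  fixes S C :: "'a::complex_lie_algebra set"
  assumes S: "\<And>x y. x \<in> S \<Longrightarrow> y \<in> S \<Longrightarrow> x + y \<in> S" "\<And>a x. x \<in> S \<Longrightarrow> a *\<^sub>C x \<in> S"
      "\<And>x y. x \<in> S \<Longrightarrow> y \<in> S \<Longrightarrow> lie x y \<in> S"
    and C: "\<And>x y. x \<in> C \<Longrightarrow> y \<in> C \<Longrightarrow> x + y \<in> C" "\<And>a x. x \<in> C \<Longrightarrow> a *\<^sub>C x \<in> C"
      "\<And>x y. x \<in> C \<Longrightarrow> y \<in> C \<Longrightarrow> lie x y \<in> C"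
    and decomp: "\<And>x. \<exists>c \<in> C. x - c \<in> S" and disj: "\<And>x. x \<in> S \<Longrightarrow> x \<in> C \<Longrightarrow> x = 0"
  shows "\<exists>pr. split_lie_algebra S pr"
proof -
  have diff: "x - y \<in> S" if "x \<in> S" "y \<in> S" for x y
    using S(1)[OF that(1) S(2)[OF that(2), of "- 1"]] by simp
  have diffC: "x - y \<in> C" if "x \<in> C" "y \<in> C" for x y
    using C(1)[OF that(1) C(2)[OF that(2), of "- 1"]] by simp
  obtain c where c: "\<And>x. c x \<in> C" "\<And>x. x - c x \<in> S" using decomp by metis
  define pr where "pr x = x - c x" for x
  have unique: "pr x = s" if "s \<in> S" "x - s \<in> C" for x s
  proof -
    have "pr x - s \<in> S" using c that diff by (simp add: pr_def)
    moreover have "pr x - s = (x - s) - c x" by (simp add: pr_def)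
    ultimately have "pr x - s = 0" using disj diffC c(1) that by metis
    then show ?thesis by simp
  qed
  have pr_S: "pr x \<in> S" and pr_C: "x - pr x \<in> C" for x
    using c by (simp_all add: pr_def)
  have "split_lie_algebra S pr"
  proof
    fix x y a
    have "x + y - (pr x + pr y) = (x - pr x) + (y - pr y)" by simp
    then show "pr (x + y) = pr x + pr y" by (metis unique S(1) pr_S pr_C C(1))
    have "a *\<^sub>C x - a *\<^sub>C pr x = a *\<^sub>C (x - pr x)" by (simp add: complex_vector.scale_right_diff_distrib)
    then show "pr (a *\<^sub>C x) = a *\<^sub>C pr x" by (metis unique S(2) pr_S pr_C C(2))
    show "pr x \<in> S" by (rule pr_S)
    have z: "0 \<in> C" using diffC[OF pr_C pr_C] by (metis diff_self)
    show "pr x = x" if "x \<in> S" using unique[OF that] z by simp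
    show "lie x y \<in> S" if "x \<in> S" "y \<in> S" using that by (rule S)
    have "0 \<in> S" using diff[OF pr_S pr_S] by (metis diff_self)
    then show "pr (lie x y) = 0" if "pr x = 0" "pr y = 0"
      using pr_C[of x] pr_C[of y] that C(3) by (simp add: unique)
  qed
  then show ?thesis by blast
qed


section \<open>Local expansions\<close>

lemma ex_local_param: "\<exists>y. y \<noteq> base_point \<and> local_param z y = t" for z :: "'p::projective_line"
proof -
  have "\<exists>y::'p. y \<noteq> base_point \<and> coord y = c" for c
    using bij_betw_imp_surj_on[OF bij_coord] by (metis ComplD UNIV_I imageE singletonI)
  from this[of "if z = base_point then inverse t else coord z + t"] show ?thesis
    by (auto simp: local_param_def)
qed

lemma eventually_at_point_iff:
  "(\<forall>\<^sub>F y in at_point z. P (local_param z y)) \<longleftrightarrow> (\<forall>\<^sub>F t in at 0. P t)"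
proof
  assume "\<forall>\<^sub>F y in at_point z. P (local_param z y)"
  then obtain Q where Q: "\<forall>\<^sub>F t in at 0. Q t"
      "\<And>y. Q (local_param z y) \<Longrightarrow> y \<noteq> base_point \<Longrightarrow> P (local_param z y)"
    by (auto simp: at_point_def eventually_inf_principal eventually_filtercomap)
  have "Q t \<Longrightarrow> P t" for t using ex_local_param[of z t] Q(2) by metis
  then show "\<forall>\<^sub>F t in at 0. P t" by (rule eventually_mono[OF Q(1)])
qed (rule eventually_at_pointD)

lemma at_point_neq_bot: "at_point z \<noteq> bot"
proof
  assume "at_point z = bot"
  then have "\<forall>\<^sub>F y in at_point z. (\<lambda>_. False) (local_param z y)" by simp
  then have "\<forall>\<^sub>F t in at (0::complex). False" by (rule eventually_at_point_iff[THEN iffD1])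
  then show False by simp
qed

lemma eventually_at_point_neq_base: "\<forall>\<^sub>F y in at_point z. y \<noteq> base_point"
  by (simp add: at_point_def eventually_inf_principal)

lemma coord_eq_iff:
  "x \<noteq> base_point \<Longrightarrow> y \<noteq> base_point \<Longrightarrow> coord x = coord y \<longleftrightarrow> x = (y :: 'p::projective_line)"
  using bij_betw_imp_inj_on[OF bij_coord] by (auto simp: inj_on_def)

lemma eventually_at_point_coord_neq:
  assumes "z \<noteq> base_point" shows "\<forall>\<^sub>F y in at_point z. coord y \<noteq> coord z"
proof -
  have "\<forall>\<^sub>F t in at (0::complex). t \<noteq> 0" by (simp add: eventually_at_filter)
  from eventually_at_pointD[OF this, of z] assms show ?thesis by (simp add: local_param_def)
qed

lemma tendsto_local_param:
  assumes "(g \<longlongrightarrow> l) (at 0)" shows "((\<lambda>y. g (local_param z y)) \<longlongrightarrow> l) (at_point z)"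
  using assms eventually_at_pointD unfolding tendsto_def by fastforce

lemma eventually_eventually_at_point:
  assumes z: "z \<noteq> base_point" and ev: "\<forall>\<^sub>F y in at_point z. Q y"
  shows "\<forall>\<^sub>F y in at_point z. y \<noteq> base_point \<and> (\<forall>\<^sub>F y' in at_point y. Q y')"
proof -
  obtain P where P: "\<forall>\<^sub>F t in at 0. P t" "\<And>y. P (local_param z y) \<Longrightarrow> y \<noteq> base_point \<Longrightarrow> Q y"
    using ev by (auto simp: at_point_def eventually_inf_principal eventually_filtercomap)
  then obtain U where U: "open U" "0 \<in> U" "\<And>t. t \<in> U \<Longrightarrow> t \<noteq> 0 \<Longrightarrow> P t"
    by (auto simp: eventually_at_topological)
  have "\<forall>\<^sub>F t in at (0::complex). t \<in> U - {0}"
    using U(1,2) by (auto simp: eventually_at_topological)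
  from eventually_at_pointD[OF this, of z] eventually_at_point_neq_base[of z]
  show ?thesis
  proof eventually_elim
    case (elim y)
    let ?t = "local_param z y"
    have "\<forall>\<^sub>F t in at ?t. t \<in> U - {0}"
      using elim U(1) by (intro eventually_at_in_open') auto
    then have "\<forall>\<^sub>F s in at 0. ?t + s \<in> U - {0}"
      by (subst (asm) at_to_0) (simp add: eventually_filtermap add.commute)
    from eventually_at_pointD[OF this, of y] eventually_at_point_neq_base[of y]
    have "\<forall>\<^sub>F y' in at_point y. Q y'"
    proof eventually_elim
      case (elim y')
      with \<open>y \<noteq> base_point\<close> z have "local_param z y' \<in> U - {0}"
        by (simp add: local_param_def)
      with elim U(3) P(2) show ?case by blast
    qed
    with elim show ?case by blast
  qed
qed

text \<open>Coordinate functionals of a basis reduce uniqueness statements about vector-valued maps to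
  complex-valued functions; the vector space carries no topology.\<close>

lemma functionals_separate:
  fixes x :: "'g::complex_vector"
  assumes "\<And>\<phi> :: 'g \<Rightarrow> complex. (\<And>a b. \<phi> (a + b) = \<phi> a + \<phi> b) \<Longrightarrow> (\<And>c a. \<phi> (c *\<^sub>C a) = c * \<phi> a) \<Longrightarrow> \<phi> x = 0"
  shows "x = 0"
proof -
  let ?B = "complex_vector.extend_basis ({} :: 'g set)"
  have B: "complex_vector.independent ?B" "complex_vector.span ?B = UNIV"
    by (simp_all add: complex_vector.independent_extend_basis complex_vector.independent_empty)
  have "complex_vector.representation ?B x b = 0" for b
    by (rule assms) (simp_all add: complex_vector.representation_add complex_vector.representation_scale B)
  then show ?thesis
    using complex_vector.sum_nonzero_representation_eq[OF B(1), of x] B(2) by simp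
qed

definition deriv_list :: "((complex \<Rightarrow> complex) \<times> 'g) list \<Rightarrow> ((complex \<Rightarrow> complex) \<times> 'g) list"
  where "deriv_list L = map (\<lambda>(f, v). (deriv f, v)) L"

lemma lin_comb_Nil [simp]: "lin_comb [] t = 0"
  and lin_comb_Cons: "lin_comb ((f, v) # L) t = f t *\<^sub>C v + lin_comb L t"
  by (simp_all add: lin_comb_def)

lemma deriv_at_iff:
  "deriv_at \<alpha> z d \<longleftrightarrow> (\<exists>L. (\<forall>(f, v) \<in> set L. f analytic_on {0}) \<and>
    (\<forall>\<^sub>F y in at_point z. \<alpha> y = lin_comb L (local_param z y)) \<and> d = lin_comb (deriv_list L) 0)"
  by (simp add: deriv_at_def deriv_list_def lin_comb_def case_prod_unfold comp_def)

lemma functional_lin_comb: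
  fixes \<phi> :: "'g::complex_vector \<Rightarrow> complex"
  assumes add: "\<And>a b. \<phi> (a + b) = \<phi> a + \<phi> b" and scale: "\<And>c a. \<phi> (c *\<^sub>C a) = c * \<phi> a"
    and L: "\<forall>(f, v) \<in> set L. f analytic_on {0}"
  shows "(\<lambda>t. \<phi> (lin_comb L t)) analytic_on {0} \<and>
    deriv (\<lambda>t. \<phi> (lin_comb L t)) 0 = \<phi> (lin_comb (deriv_list L) 0)"
proof -
  have zero: "\<phi> 0 = 0" using add[of 0 0] by simp
  show ?thesis using L
  proof (induction L)
    case (Cons p L)
    obtain f v where p: "p = (f, v)" by (cases p)
    have f: "f analytic_on {0}" using Cons.prems p by simp
    from Cons have IH: "(\<lambda>t. \<phi> (lin_comb L t)) analytic_on {0}"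
      "deriv (\<lambda>t. \<phi> (lin_comb L t)) 0 = \<phi> (lin_comb (deriv_list L) 0)" by auto
    have eq: "(\<lambda>t. \<phi> (lin_comb (p # L) t)) = (\<lambda>t. f t * \<phi> v + \<phi> (lin_comb L t))"
      by (simp add: p lin_comb_Cons add scale)
    have "(f has_field_derivative deriv f 0) (at 0)"
      "((\<lambda>t. \<phi> (lin_comb L t)) has_field_derivative \<phi> (lin_comb (deriv_list L) 0)) (at 0)"
      using f IH by (metis analytic_on_imp_differentiable_at DERIV_deriv_iff_field_differentiable insertI1)+
    then have "((\<lambda>t. f t * \<phi> v + \<phi> (lin_comb L t)) has_field_derivative
        deriv f 0 * \<phi> v + \<phi> (lin_comb (deriv_list L) 0)) (at 0)"
      by (auto intro!: derivative_eq_intros)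
    then have "deriv (\<lambda>t. f t * \<phi> v + \<phi> (lin_comb L t)) 0 = deriv f 0 * \<phi> v + \<phi> (lin_comb (deriv_list L) 0)"
      by (rule DERIV_imp_deriv)
    moreover have "(\<lambda>t. f t * \<phi> v + \<phi> (lin_comb L t)) analytic_on {0}"
      by (intro analytic_intros f IH)
    ultimately show ?case
      unfolding eq by (simp add: p deriv_list_def lin_comb_Cons add scale)
  qed (simp add: zero deriv_list_def)
qed

lemma lin_comb_unique:
  assumes L: "\<forall>(f, v) \<in> set L. f analytic_on {0}" and M: "\<forall>(f, v) \<in> set M. f analytic_on {0}"
    and ev: "\<forall>\<^sub>F t in at 0. lin_comb L t = lin_comb M t"
  shows "lin_comb L 0 = lin_comb M 0" "lin_comb (deriv_list L) 0 = lin_comb (deriv_list M) 0"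
proof -
  have *: "\<phi> (lin_comb L 0 - lin_comb M 0) = 0 \<and>
      \<phi> (lin_comb (deriv_list L) 0 - lin_comb (deriv_list M) 0) = 0"
    if add: "\<And>a b. \<phi> (a + b) = \<phi> a + \<phi> b" and scale: "\<And>c a. \<phi> (c *\<^sub>C a) = c * \<phi> a" for \<phi>
  proof -
    note fL = functional_lin_comb[of \<phi> L, OF add scale L] and fM = functional_lin_comb[of \<phi> M, OF add scale M]
    have diff: "\<phi> (a - b) = \<phi> a - \<phi> b" for a b
      using add[of "a - b" b] by simp
    have lim: "(\<lambda>t. \<phi> (lin_comb L t)) \<midarrow>0\<rightarrow> \<phi> (lin_comb L 0)" "(\<lambda>t. \<phi> (lin_comb M t)) \<midarrow>0\<rightarrow> \<phi> (lin_comb M 0)"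
      using fL fM analytic_at_imp_isCont isContD by metis+
    have "\<forall>\<^sub>F t in at 0. \<phi> (lin_comb L t) = \<phi> (lin_comb M t)"
      using ev by eventually_elim simp
    from Lim_transform_eventually[OF lim(1) this] lim(2)
    have 0: "\<phi> (lin_comb L 0) = \<phi> (lin_comb M 0)" using LIM_unique by blast
    have "\<forall>\<^sub>F t in nhds 0. \<phi> (lin_comb L t) = \<phi> (lin_comb M t)"
      using ev 0 by (auto simp: eventually_at_filter elim!: eventually_mono)
    then have "deriv (\<lambda>t. \<phi> (lin_comb L t)) 0 = deriv (\<lambda>t. \<phi> (lin_comb M t)) 0"
      by (rule deriv_cong_ev) simp
    then show ?thesis using fL fM 0 by (simp add: diff)
  qed
  have "lin_comb L 0 - lin_comb M 0 = 0"
    by (rule functionals_separate) (simp add: *)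
  then show "lin_comb L 0 = lin_comb M 0" by simp
  have "lin_comb (deriv_list L) 0 - lin_comb (deriv_list M) 0 = 0"
    by (rule functionals_separate) (simp add: *)
  then show "lin_comb (deriv_list L) 0 = lin_comb (deriv_list M) 0" by simp
qed

text \<open>The list \<open>L\<close> is a holomorphic expansion of \<open>\<alpha>\<close> at \<open>z\<close>. Lists represent the same germ in many
  ways, but they determine its value and its derivative.\<close>

definition germ :: "('p::projective_line \<Rightarrow> 'g::complex_vector) \<Rightarrow> 'p \<Rightarrow> ((complex \<Rightarrow> complex) \<times> 'g) list \<Rightarrow> bool"
  where "germ \<alpha> z L \<longleftrightarrow> (\<forall>(f, v) \<in> set L. f analytic_on {0}) \<and>
    (\<forall>\<^sub>F y in at_point z. \<alpha> y = lin_comb L (local_param z y))"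

lift_definition gm_germ :: "('p::projective_line, 'g::complex_vector) gminus \<Rightarrow> 'p \<Rightarrow>
    ((complex \<Rightarrow> complex) \<times> 'g) list \<Rightarrow> bool" is germ
proof (intro ext)
  fix \<alpha> \<beta> :: "'p \<Rightarrow> 'g" and z L
  assume "in_gminus \<alpha> \<and> in_gminus \<beta> \<and> (\<forall>z. \<forall>\<^sub>F y in at_point z. \<alpha> y = \<beta> y)"
  then have *: "\<forall>\<^sub>F y in at_point z. \<alpha> y = \<beta> y" by blast
  have "(\<forall>\<^sub>F y in at_point z. \<alpha> y = lin_comb L (local_param z y)) \<longleftrightarrow>
      (\<forall>\<^sub>F y in at_point z. \<beta> y = lin_comb L (local_param z y))"
    by (rule eventually_subst) (use * in \<open>eventually_elim, simp\<close>)
  then show "germ \<alpha> z L = germ \<beta> z L" by (simp add: germ_def)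
qed

lemma gm_value_at_iff: "gm_value_at \<alpha> z c \<longleftrightarrow> (\<exists>L. gm_germ \<alpha> z L \<and> c = lin_comb L 0)"
  by transfer (auto simp: value_at_def germ_def)

lemma gm_deriv_at_iff: "gm_deriv_at \<alpha> z c \<longleftrightarrow> (\<exists>L. gm_germ \<alpha> z L \<and> c = lin_comb (deriv_list L) 0)"
  by transfer (auto simp: deriv_at_iff germ_def)

lemma gm_regular_iff: "gm_regular \<alpha> z \<longleftrightarrow> (\<exists>L. gm_germ \<alpha> z L)"
  by (auto simp: gm_regular_def gm_value_at_iff)

lemma gm_germ_analytic: "gm_germ \<alpha> z L \<Longrightarrow> (f, v) \<in> set L \<Longrightarrow> f analytic_on {0}"
  by transfer (auto simp: germ_def)

lemma gm_germ_unique: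
  assumes "gm_germ \<alpha> z L" "gm_germ \<alpha> z M"
  shows "lin_comb L 0 = lin_comb M 0 \<and> lin_comb (deriv_list L) 0 = lin_comb (deriv_list M) 0"
  using assms
proof transfer
  fix \<alpha> :: "'a \<Rightarrow> 'b" and z L M
  assume L: "germ \<alpha> z L" and M: "germ \<alpha> z M"
  then have "\<forall>\<^sub>F y in at_point z. \<alpha> y = lin_comb L (local_param z y)"
    "\<forall>\<^sub>F y in at_point z. \<alpha> y = lin_comb M (local_param z y)" by (auto simp: germ_def)
  then have "\<forall>\<^sub>F y in at_point z. lin_comb L (local_param z y) = lin_comb M (local_param z y)"
    by eventually_elim simp
  then have "\<forall>\<^sub>F t in at 0. lin_comb L t = lin_comb M t"
    by (rule eventually_at_point_iff[THEN iffD1])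
  with L M show "lin_comb L 0 = lin_comb M 0 \<and> lin_comb (deriv_list L) 0 = lin_comb (deriv_list M) 0"
    using lin_comb_unique by (auto simp: germ_def)
qed

lemma gm_value_eq: "gm_germ \<alpha> z L \<Longrightarrow> gm_value \<alpha> z = lin_comb L 0"
  unfolding gm_value_def gm_value_at_iff by (rule the_equality) (use gm_germ_unique in blast)+

lemma gm_deriv_eq: "gm_germ \<alpha> z L \<Longrightarrow> gm_deriv \<alpha> z = lin_comb (deriv_list L) 0"
  unfolding gm_deriv_def gm_deriv_at_iff by (rule the_equality) (use gm_germ_unique in blast)+

lemma gm_germ_add:
  assumes "gm_germ \<alpha> z L" "gm_germ \<beta> z M" shows "gm_germ (\<alpha> + \<beta>) z (L @ M)"
  using assms
proof transfer
  fix \<alpha> \<beta> :: "'a \<Rightarrow> 'b" and z L M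
  assume *: "germ \<alpha> z L" "germ \<beta> z M"
  then have "\<forall>\<^sub>F y in at_point z. \<alpha> y = lin_comb L (local_param z y)"
    "\<forall>\<^sub>F y in at_point z. \<beta> y = lin_comb M (local_param z y)" by (auto simp: germ_def)
  then have "\<forall>\<^sub>F y in at_point z. \<alpha> y + \<beta> y = lin_comb (L @ M) (local_param z y)"
    by eventually_elim (simp add: lin_comb_append)
  with * show "germ (\<lambda>y. \<alpha> y + \<beta> y) z (L @ M)" by (auto simp: germ_def)
qed

lemma gm_germ_scaleC:
  assumes "gm_germ \<alpha> z L" shows "gm_germ (a *\<^sub>C \<alpha>) z (map (\<lambda>(f, v). (f, a *\<^sub>C v)) L)"
  using assms
proof transfer
  fix \<alpha> :: "'a \<Rightarrow> 'b" and z L a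
  assume *: "germ \<alpha> z L"
  then have "\<forall>\<^sub>F y in at_point z. \<alpha> y = lin_comb L (local_param z y)" by (auto simp: germ_def)
  then have "\<forall>\<^sub>F y in at_point z. a *\<^sub>C \<alpha> y = lin_comb (map (\<lambda>(f, v). (f, a *\<^sub>C v)) L) (local_param z y)"
    by eventually_elim (simp add: lin_comb_scaleC)
  with * show "germ (\<lambda>y. a *\<^sub>C \<alpha> y) z (map (\<lambda>(f, v). (f, a *\<^sub>C v)) L)" by (auto simp: germ_def)
qed

lemma gm_germ_lie:
  assumes "gm_germ \<alpha> z L" "gm_germ \<beta> z M" shows "gm_germ (lie \<alpha> \<beta>) z (lin_comb_lie L M)"
  using assms
proof transfer
  fix \<alpha> \<beta> :: "'a \<Rightarrow> 'b" and z L M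
  assume *: "germ \<alpha> z L" "germ \<beta> z M"
  then have "\<forall>\<^sub>F y in at_point z. \<alpha> y = lin_comb L (local_param z y)"
    "\<forall>\<^sub>F y in at_point z. \<beta> y = lin_comb M (local_param z y)" by (auto simp: germ_def)
  then have "\<forall>\<^sub>F y in at_point z. lie (\<alpha> y) (\<beta> y) = lin_comb (lin_comb_lie L M) (local_param z y)"
    by eventually_elim (simp add: lin_comb_lie)
  moreover have "\<forall>(f, v) \<in> set (lin_comb_lie L M). f analytic_on {0}"
    using * by (fastforce simp: germ_def lin_comb_lie_def intro!: analytic_intros)
  ultimately show "germ (\<lambda>y. lie (\<alpha> y) (\<beta> y)) z (lin_comb_lie L M)" by (auto simp: germ_def)
qed

lemma deriv_list_append: "deriv_list (L @ M) = deriv_list L @ deriv_list M"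
  by (simp add: deriv_list_def)

lemma deriv_list_scaleC: "deriv_list (map (\<lambda>(f, v). (f, a *\<^sub>C v)) L) = map (\<lambda>(f, v). (f, a *\<^sub>C v)) (deriv_list L)"
  by (simp add: deriv_list_def case_prod_unfold)

lemma deriv_list_lie:
  assumes L: "\<forall>(f, v) \<in> set L. f analytic_on {0}" and M: "\<forall>(f, v) \<in> set M. f analytic_on {0}"
  shows "lin_comb (deriv_list (lin_comb_lie L M)) 0 =
    lie (lin_comb (deriv_list L) 0) (lin_comb M 0) + lie (lin_comb L 0) (lin_comb (deriv_list M) 0)"
  using L
proof (induction L)
  case Nil
  then show ?case by (simp add: lin_comb_lie_def deriv_list_def)
next
  case (Cons p L)
  obtain f v where p: "p = (f, v)" by (cases p)
  have f: "f analytic_on {0}" using Cons.prems p by simp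
  have "lin_comb (deriv_list (map (\<lambda>(g, w). (\<lambda>t. f t * g t, lie v w)) M)) 0
      = lie (deriv f 0 *\<^sub>C v) (lin_comb M 0) + lie (f 0 *\<^sub>C v) (lin_comb (deriv_list M) 0)"
    using M
  proof (induction M)
    case (Cons q M)
    obtain g w where q: "q = (g, w)" by (cases q)
    have "g analytic_on {0}" using Cons.prems q by simp
    with f have "deriv (\<lambda>t. f t * g t) 0 = f 0 * deriv g 0 + deriv f 0 * g 0"
      by (intro complex_derivative_mult_at) auto
    with Cons show ?case
      by (simp add: q deriv_list_def lin_comb_Cons lie_add_right lie_scaleC_right lie_scaleC_left
        scaleC_add_left scaleC_scaleC scaleC_add_right algebra_simps)
  qed (simp add: deriv_list_def)
  moreover have "deriv_list (lin_comb_lie (p # L) M) = deriv_list (map (\<lambda>(g, w). (\<lambda>t. f t * g t, lie v w)) M)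
      @ deriv_list (lin_comb_lie L M)"
    by (simp add: lin_comb_lie_def p deriv_list_def)
  ultimately show ?case
    using Cons by (simp add: p lin_comb_append) (simp add: deriv_list_def lin_comb_Cons lie_add_left algebra_simps)
qed

lemma gm_add:
  assumes "gm_regular \<alpha> z" "gm_regular \<beta> z"
  shows "gm_regular (\<alpha> + \<beta>) z" "gm_value (\<alpha> + \<beta>) z = gm_value \<alpha> z + gm_value \<beta> z"
    "gm_deriv (\<alpha> + \<beta>) z = gm_deriv \<alpha> z + gm_deriv \<beta> z"
proof -
  obtain L M where *: "gm_germ \<alpha> z L" "gm_germ \<beta> z M" using assms by (auto simp: gm_regular_iff)
  from gm_germ_add[OF this] show "gm_regular (\<alpha> + \<beta>) z" "gm_value (\<alpha> + \<beta>) z = gm_value \<alpha> z + gm_value \<beta> z"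
    "gm_deriv (\<alpha> + \<beta>) z = gm_deriv \<alpha> z + gm_deriv \<beta> z"
    using * by (auto simp: gm_regular_iff gm_value_eq gm_deriv_eq deriv_list_append lin_comb_append)
qed

lemma gm_scaleC:
  assumes "gm_regular \<alpha> z"
  shows "gm_regular (a *\<^sub>C \<alpha>) z" "gm_value (a *\<^sub>C \<alpha>) z = a *\<^sub>C gm_value \<alpha> z"
    "gm_deriv (a *\<^sub>C \<alpha>) z = a *\<^sub>C gm_deriv \<alpha> z"
proof -
  obtain L where *: "gm_germ \<alpha> z L" using assms by (auto simp: gm_regular_iff)
  from gm_germ_scaleC[OF this, of a] show "gm_regular (a *\<^sub>C \<alpha>) z" "gm_value (a *\<^sub>C \<alpha>) z = a *\<^sub>C gm_value \<alpha> z"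
    "gm_deriv (a *\<^sub>C \<alpha>) z = a *\<^sub>C gm_deriv \<alpha> z"
    using * by (auto simp: gm_regular_iff gm_value_eq gm_deriv_eq deriv_list_scaleC lin_comb_scaleC)
qed

lemma gm_lie:
  assumes "gm_regular \<alpha> z" "gm_regular \<beta> z"
  shows "gm_regular (lie \<alpha> \<beta>) z" "gm_value (lie \<alpha> \<beta>) z = lie (gm_value \<alpha> z) (gm_value \<beta> z)"
    "gm_deriv (lie \<alpha> \<beta>) z = lie (gm_deriv \<alpha> z) (gm_value \<beta> z) + lie (gm_value \<alpha> z) (gm_deriv \<beta> z)"
proof -
  obtain L M where *: "gm_germ \<alpha> z L" "gm_germ \<beta> z M" using assms by (auto simp: gm_regular_iff)
  have an: "\<forall>(f, v) \<in> set L. f analytic_on {0}" "\<forall>(f, v) \<in> set M. f analytic_on {0}"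
    using * gm_germ_analytic by fast+
  from gm_germ_lie[OF *] show "gm_regular (lie \<alpha> \<beta>) z" "gm_value (lie \<alpha> \<beta>) z = lie (gm_value \<alpha> z) (gm_value \<beta> z)"
    "gm_deriv (lie \<alpha> \<beta>) z = lie (gm_deriv \<alpha> z) (gm_value \<beta> z) + lie (gm_value \<alpha> z) (gm_deriv \<beta> z)"
    using * deriv_list_lie[OF an] by (auto simp: gm_regular_iff gm_value_eq gm_deriv_eq lin_comb_lie)
qed

lemma gm_germ_eps_elt:
  assumes "z \<noteq> base_point" "w \<noteq> base_point" "z \<noteq> w"
  shows "gm_germ (eps_elt v w) z [(\<lambda>t. 1 / (coord z + t - coord w), v)]"
  using assms
proof transfer
  fix z w :: 'a and v :: 'b
  assume z: "z \<noteq> base_point" "w \<noteq> base_point" "z \<noteq> w"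
  then have "coord z \<noteq> coord w" by (simp add: coord_eq_iff)
  with z show "germ (\<lambda>y. (1 / (coord y - coord w)) *\<^sub>C v) z [(\<lambda>t. 1 / (coord z + t - coord w), v)]"
    by (auto simp: germ_def lin_comb_Cons local_param_def intro!: analytic_intros)
qed

lemma gm_eps_elt:
  assumes "z \<noteq> base_point" "w \<noteq> base_point" "z \<noteq> w"
  shows "gm_regular (eps_elt v w) z" "gm_value (eps_elt v w) z = (1 / (coord z - coord w)) *\<^sub>C v"
    "gm_deriv (eps_elt v w) z = (- 1 / (coord z - coord w)^2) *\<^sub>C v"
proof -
  have ne: "coord z \<noteq> coord w" using assms by (simp add: coord_eq_iff)
  have "((\<lambda>t. 1 / (coord z + t - coord w)) has_field_derivative (- 1 / (coord z - coord w)^2)) (at 0)"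
    using ne by (auto intro!: derivative_eq_intros simp: power2_eq_square)
  then have d: "deriv (\<lambda>t. 1 / (coord z + t - coord w)) 0 = - 1 / (coord z - coord w)^2"
    by (rule DERIV_imp_deriv)
  note g = gm_germ_eps_elt[OF assms, of v]
  show "gm_regular (eps_elt v w) z" using g by (auto simp: gm_regular_iff)
  show "gm_value (eps_elt v w) z = (1 / (coord z - coord w)) *\<^sub>C v"
    unfolding gm_value_eq[OF g] by (simp add: lin_comb_Cons)
  show "gm_deriv (eps_elt v w) z = (- 1 / (coord z - coord w)^2) *\<^sub>C v"
    unfolding gm_deriv_eq[OF g] by (simp add: lin_comb_Cons deriv_list_def d del: divide_minus_left)
qed

text \<open>Regularity is an open condition, and one expansion at \<open>z\<close> gives the values and derivatives at
  all nearby points by shifting it.\<close>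

lemma gm_expansion_nearby:
  assumes L: "gm_germ \<alpha> z L" and z: "z \<noteq> base_point"
  shows "\<forall>\<^sub>F y in at_point z. gm_regular \<alpha> y \<and> gm_value \<alpha> y = lin_comb L (coord y - coord z) \<and>
    gm_deriv \<alpha> y = lin_comb (deriv_list L) (coord y - coord z)"
proof -
  define shift where "shift t = map (\<lambda>(f, v :: 'b). (\<lambda>s::complex. f (t + s) :: complex, v)) L" for t
  have shift: "lin_comb (shift t) s = lin_comb L (t + s)" for t s
    unfolding shift_def by (induction L) (auto simp: lin_comb_Cons)
  have "\<forall>\<^sub>F y in at_point z. \<forall>(f, v) \<in> set L. f analytic_on {coord y - coord z}"
  proof -
    have "\<forall>\<^sub>F t in nhds 0. f analytic_on {t}" if "(f, v) \<in> set L" for f v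
      using gm_germ_analytic[OF L that] by (auto simp: analytic_at eventually_nhds)
    then have "\<forall>\<^sub>F t in nhds 0. \<forall>(f, v) \<in> set L. f analytic_on {t}"
      by (auto simp: eventually_ball_finite_distrib)
    then have "\<forall>\<^sub>F t in at 0. \<forall>(f, v) \<in> set L. f analytic_on {t}"
      by (auto simp: eventually_at_filter elim: eventually_mono)
    from eventually_at_pointD[OF this, of z] show ?thesis using z by (simp add: local_param_def)
  qed
  moreover have "\<forall>\<^sub>F y in at_point z. y \<noteq> base_point \<and> ((\<forall>(f, v) \<in> set L. f analytic_on {coord y - coord z}) \<longrightarrow>
      gm_germ \<alpha> y (shift (coord y - coord z)))"
    using L z
  proof (transfer fixing: L shift)
    fix \<alpha> :: "'a \<Rightarrow> 'b" and z
    assume g: "germ \<alpha> z L" and z: "z \<noteq> base_point"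
    then have "\<forall>\<^sub>F y in at_point z. \<alpha> y = lin_comb L (local_param z y)" by (simp add: germ_def)
    from eventually_eventually_at_point[OF z this]
    show "\<forall>\<^sub>F y in at_point z. y \<noteq> base_point \<and> ((\<forall>(f, v) \<in> set L. f analytic_on {coord y - coord z}) \<longrightarrow>
      germ \<alpha> y (shift (coord y - coord z)))"
    proof eventually_elim
      case (elim y)
      have "\<forall>\<^sub>F y' in at_point y. \<alpha> y' = lin_comb (shift (coord y - coord z)) (local_param y y')"
        using conjunct2[OF elim] by eventually_elim (use elim z in \<open>simp add: local_param_def shift\<close>)
      moreover have "(\<lambda>s. f (t + s)) analytic_on {0}" if "f analytic_on {t}" for f t
      proof -
        have "(\<lambda>s. t + s) analytic_on {0}" by (intro analytic_intros)
        from analytic_on_compose[OF this, of f] that show ?thesis by (simp add: o_def)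
      qed
      ultimately show ?case using elim by (auto simp: germ_def shift_def)
    qed
  qed
  ultimately show ?thesis
  proof eventually_elim
    case (elim y)
    then have g: "gm_germ \<alpha> y (shift (coord y - coord z))" by blast
    have "deriv (\<lambda>s. f (t + s)) 0 = deriv f t" for f :: "complex \<Rightarrow> complex" and t
      using deriv_shift_0[of f t] by (simp add: o_def)
    then have "lin_comb (deriv_list (shift t)) 0 = lin_comb (deriv_list L) t" for t
      unfolding shift_def deriv_list_def by (induction L) (auto simp: lin_comb_Cons)
    with g shift show ?case
      by (auto simp: gm_regular_iff gm_value_eq gm_deriv_eq)
  qed
qed


section \<open>Principal parts\<close>

lift_definition gm_represents :: "('p::projective_line, 'g::complex_vector) gminus \<Rightarrow> ('p \<Rightarrow> 'g) \<Rightarrow> bool"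
  is "\<lambda>\<alpha> f. \<forall>z. \<forall>\<^sub>F y in at_point z. \<alpha> y = f y"
proof (intro ext)
  fix \<alpha> \<beta> f :: "'p \<Rightarrow> 'g"
  assume "in_gminus \<alpha> \<and> in_gminus \<beta> \<and> (\<forall>z. \<forall>\<^sub>F y in at_point z. \<alpha> y = \<beta> y)"
  then have *: "\<forall>\<^sub>F y in at_point z. \<alpha> y = \<beta> y" for z by blast
  have "(\<forall>\<^sub>F y in at_point z. \<alpha> y = f y) \<longleftrightarrow> (\<forall>\<^sub>F y in at_point z. \<beta> y = f y)" for z
    by (rule eventually_subst) (use *[of z] in \<open>eventually_elim, simp\<close>)
  then show "(\<forall>z. \<forall>\<^sub>F y in at_point z. \<alpha> y = f y) = (\<forall>z. \<forall>\<^sub>F y in at_point z. \<beta> y = f y)" by simp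
qed

lemma gm_represents_ops:
  assumes "gm_represents \<alpha> f" "gm_represents \<beta> g"
  shows "gm_represents (\<alpha> + \<beta>) (\<lambda>y. f y + g y)" "gm_represents (a *\<^sub>C \<alpha>) (\<lambda>y. a *\<^sub>C f y)"
  using assms by (transfer; force elim: eventually_elim2 eventually_mono)+

lemma gm_represents_lie:
  assumes "gm_represents \<alpha> f" "gm_represents \<beta> g"
  shows "gm_represents (lie \<alpha> \<beta>) (\<lambda>y. lie (f y) (g y))"
  using assms by (transfer; force elim: eventually_elim2)

lemma gm_represents_eqI:
  assumes "gm_represents \<alpha> f" "gm_represents \<beta> g" "\<And>z. \<forall>\<^sub>F y in at_point z. f y = g y"
  shows "\<alpha> = \<beta>"
  using assms
proof transfer
  fix \<alpha> \<beta> f g :: "'a \<Rightarrow> 'b"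
  assume *: "in_gminus \<alpha> \<and> in_gminus \<alpha> \<and> (\<forall>z. \<forall>\<^sub>F y in at_point z. \<alpha> y = \<alpha> y)"
    "in_gminus \<beta> \<and> in_gminus \<beta> \<and> (\<forall>z. \<forall>\<^sub>F y in at_point z. \<beta> y = \<beta> y)"
    "\<forall>z. \<forall>\<^sub>F y in at_point z. \<alpha> y = f y" "\<forall>z. \<forall>\<^sub>F y in at_point z. \<beta> y = g y"
    "\<And>z. \<forall>\<^sub>F y in at_point z. f y = g y"
  have "\<forall>\<^sub>F y in at_point z. \<alpha> y = \<beta> y" for z
    using *(3,4)[THEN spec, of z] *(5)[of z] by eventually_elim simp
  with * show "in_gminus \<alpha> \<and> in_gminus \<beta> \<and> (\<forall>z. \<forall>\<^sub>F y in at_point z. \<alpha> y = \<beta> y)" by blast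
qed

lemma gm_represents_ex: "in_gminus f \<Longrightarrow> \<exists>\<alpha>. gm_represents \<alpha> f"
  by transfer (auto intro!: bexI[of _ f])

lemma gm_represents_eq: "gm_represents \<alpha> f \<Longrightarrow> gm_represents \<beta> f \<Longrightarrow> \<alpha> = \<beta>"
  by (rule gm_represents_eqI) auto

lemma gm_represents_zero: "gm_represents 0 (\<lambda>_. 0)"
  by transfer simp

lemma gm_represents_eps_elt: "gm_represents (eps_elt v z) (\<lambda>y. (1 / (coord y - coord z)) *\<^sub>C v)"
  by transfer simp

definition polynomial_list :: "((complex \<Rightarrow> complex) \<times> 'g) list \<Rightarrow> bool"
  where "polynomial_list L \<longleftrightarrow> (\<forall>(f, v) \<in> set L. \<exists>p. f = poly p \<and> poly p 0 = 0)"

text \<open>The polynomials without constant term in \<open>1 / (u - u(z))\<close>. They vanish at the base-point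
  and have their only pole at \<open>z\<close>; products of two such polynomials are again of this form, so that
  the maps with these coefficients are closed under the bracket.\<close>

definition principal_parts :: "'p::projective_line \<Rightarrow> ('p, 'g::complex_vector) gminus set"
  where "principal_parts z = {\<gamma>. \<exists>L. polynomial_list L \<and>
    gm_represents \<gamma> (\<lambda>y. lin_comb L (1 / (coord y - coord z)))}"

lemma in_gminus_principal:
  fixes L :: "((complex \<Rightarrow> complex) \<times> 'g::complex_vector) list"
  assumes "polynomial_list L"
  shows "in_gminus (\<lambda>y::'p::projective_line. lin_comb L (1 / (coord y - c)))"
  using assms
proof (induction L)
  case Nil
  then show ?case by (simp add: in_gminus_zero)
next
  case (Cons q L)
  then obtain p v where q: "q = (poly p, v)" "poly p 0 = 0"
    by (cases q) (auto simp: polynomial_list_def)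
  let ?\<alpha> = "\<lambda>y::'p. poly p (1 / (coord y - c)) *\<^sub>C v"
  have mero: "(\<lambda>t. poly p (f t)) meromorphic_on A" if "f meromorphic_on A" for f A
    by (induction p) (auto intro!: meromorphic_intros that)
  have ana: "(\<lambda>t. poly p (f t)) analytic_on A" if "f analytic_on A" for f A
    by (induction p) (auto intro!: analytic_intros that)
  have "meromorphic_at ?\<alpha> z" if "z \<noteq> base_point" for z
    unfolding meromorphic_at_def
  proof (intro exI[of _ "[(\<lambda>t. poly p (1 / (coord z + t - c)), v)]"] conjI)
    show "\<forall>(f, w) \<in> set [(\<lambda>t. poly p (1 / (coord z + t - c)), v)]. f meromorphic_on {0}"
      by (auto intro!: mero meromorphic_intros)
  qed (use that in \<open>simp add: lin_comb_def local_param_def\<close>)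
  moreover
  define M where "M = [(\<lambda>t. poly p (t / (1 - c * t)), v)]"
  have M: "\<forall>(f, w) \<in> set M. f analytic_on {0}"
    by (auto simp: M_def intro!: ana analytic_intros)
  have "\<forall>\<^sub>F y in at_point (base_point :: 'p). local_param base_point y \<noteq> 0"
    by (rule eventually_at_pointD) (simp add: eventually_at_filter)
  then have ev: "\<forall>\<^sub>F y in at_point (base_point :: 'p). ?\<alpha> y = lin_comb M (local_param base_point y)"
  proof eventually_elim
    case (elim y)
    then have "1 / (coord y - c) = inverse (coord y) / (1 - c * inverse (coord y))"
      by (auto simp: local_param_def divide_simps)
    then show ?case by (simp add: M_def lin_comb_Cons local_param_def)
  qed
  have "meromorphic_at ?\<alpha> base_point"
    unfolding meromorphic_at_def using M ev
    by (intro exI[of _ M]) (auto intro: analytic_on_imp_meromorphic_on)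
  moreover have "value_at ?\<alpha> base_point 0"
    unfolding value_at_def using M ev q(2)
    by (intro exI[of _ M]) (auto simp: M_def lin_comb_def)
  ultimately have "in_gminus ?\<alpha>"
    unfolding in_gminus_def by metis
  moreover have "polynomial_list L" using Cons.prems by (simp add: polynomial_list_def)
  ultimately show ?case
    using Cons.IH by (simp add: q lin_comb_Cons in_gminus_add)
qed

lemma principal_parts_closed:
  assumes "\<alpha> \<in> principal_parts z" "\<beta> \<in> principal_parts z"
  shows "\<alpha> + \<beta> \<in> principal_parts z" "a *\<^sub>C \<alpha> \<in> principal_parts z"
proof -
  obtain L M where *: "polynomial_list L" "polynomial_list M"
    "gm_represents \<alpha> (\<lambda>y. lin_comb L (1 / (coord y - coord z)))"
    "gm_represents \<beta> (\<lambda>y. lin_comb M (1 / (coord y - coord z)))"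
    using assms by (auto simp: principal_parts_def)
  have "polynomial_list (L @ M)" "polynomial_list (map (\<lambda>(f, v). (f, a *\<^sub>C v)) L)"
    using * by (auto simp: polynomial_list_def)
  with gm_represents_ops[OF *(3,4)] show "\<alpha> + \<beta> \<in> principal_parts z" "a *\<^sub>C \<alpha> \<in> principal_parts z"
    unfolding principal_parts_def by (auto simp flip: lin_comb_append lin_comb_scaleC)
qed

lemma principal_parts_lie:
  assumes "\<alpha> \<in> principal_parts z" "\<beta> \<in> principal_parts z"
  shows "lie \<alpha> \<beta> \<in> principal_parts z"
proof -
  obtain L M where *: "polynomial_list L" "polynomial_list M"
    "gm_represents \<alpha> (\<lambda>y. lin_comb L (1 / (coord y - coord z)))"
    "gm_represents \<beta> (\<lambda>y. lin_comb M (1 / (coord y - coord z)))"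
    using assms by (auto simp: principal_parts_def)
  have "\<exists>r. (\<lambda>t. poly p t * poly q t) = poly r \<and> poly r 0 = 0" if "poly p 0 = (0::complex)" for p q
    using that by (intro exI[of _ "p * q"]) auto
  then have "polynomial_list (lin_comb_lie L M)"
    using *(1,2) by (fastforce simp: polynomial_list_def lin_comb_lie_def)
  with gm_represents_lie[OF *(3,4)] show ?thesis
    unfolding principal_parts_def by (auto simp flip: lin_comb_lie)
qed

text \<open>Multiplying by \<open>t\<close> to the power of the degree and letting \<open>t\<close> tend to \<open>0\<close> gives the leading
  coefficient on one side and \<open>0\<close> on the other.\<close>

lemma poly_inverse_analytic_imp_const:
  fixes q :: "complex poly"
  assumes "g analytic_on {0}" and ev: "\<forall>\<^sub>F t in at 0. poly q (1 / t) = g t"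
  shows "degree q = 0"
proof (rule ccontr)
  assume "degree q \<noteq> 0"
  have "g \<midarrow>0\<rightarrow> g 0" using assms(1) by (intro isContD analytic_at_imp_isCont)
  then have "(\<lambda>t. t ^ degree q * g t) \<midarrow>0\<rightarrow> 0 ^ degree q * g 0" by (intro tendsto_intros)
  then have l1: "(\<lambda>t. t ^ degree q * g t) \<midarrow>0\<rightarrow> 0" using \<open>degree q \<noteq> 0\<close> by (simp add: zero_power)
  have "\<forall>\<^sub>F t in at 0. t \<noteq> (0::complex)" by (simp add: eventually_at_filter)
  with ev have "\<forall>\<^sub>F t in at 0. t ^ degree q * g t = poly (reflect_poly q) t"
    by eventually_elim (simp add: poly_reflect_poly_nz inverse_eq_divide)
  from Lim_transform_eventually[OF l1 this] have "poly (reflect_poly q) \<midarrow>0\<rightarrow> 0" .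
  moreover have "poly (reflect_poly q) \<midarrow>0\<rightarrow> poly (reflect_poly q) 0"
    by (intro isContD) simp
  ultimately have "poly (reflect_poly q) 0 = 0" using LIM_unique by blast
  then show False using \<open>degree q \<noteq> 0\<close> by simp
qed

text \<open>In coordinates: a polynomial in \<open>1 / t\<close> that is holomorphic at \<open>t = 0\<close> is constant.\<close>

lemma principal_parts_regular:
  assumes z: "z \<noteq> base_point" and \<gamma>: "\<gamma> \<in> principal_parts z" and reg: "gm_regular \<gamma> z"
  shows "\<gamma> = 0"
proof -
  obtain L where L: "polynomial_list L" "gm_represents \<gamma> (\<lambda>y. lin_comb L (1 / (coord y - coord z)))"
    using \<gamma> by (auto simp: principal_parts_def)
  obtain M where M: "gm_germ \<gamma> z M" using reg by (auto simp: gm_regular_iff)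
  then have M': "\<forall>(f, v) \<in> set M. f analytic_on {0}" using gm_germ_analytic by fast
  have "\<forall>\<^sub>F y in at_point z. lin_comb L (1 / (coord y - coord z)) = lin_comb M (local_param z y)"
    using L(2) M
  proof (transfer fixing: L M)
    fix \<gamma> :: "'a \<Rightarrow> 'b" and z
    assume "\<forall>z'. \<forall>\<^sub>F y in at_point z'. \<gamma> y = lin_comb L (1 / (coord y - coord z))" "germ \<gamma> z M"
    then have "\<forall>\<^sub>F y in at_point z. \<gamma> y = lin_comb L (1 / (coord y - coord z))"
      "\<forall>\<^sub>F y in at_point z. \<gamma> y = lin_comb M (local_param z y)" by (auto simp: germ_def)
    then show "\<forall>\<^sub>F y in at_point z. lin_comb L (1 / (coord y - coord z)) = lin_comb M (local_param z y)"
      by eventually_elim simp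
  qed
  then have "\<forall>\<^sub>F y in at_point z. lin_comb L (1 / local_param z y) = lin_comb M (local_param z y)"
    using z by (simp add: local_param_def)
  then have ev: "\<forall>\<^sub>F t in at 0. lin_comb L (1 / t) = lin_comb M t"
    by (rule eventually_at_point_iff[THEN iffD1])
  have "lin_comb L s = 0" for s
  proof (rule functionals_separate)
    fix \<phi> :: "'b \<Rightarrow> complex"
    assume add: "\<And>a b. \<phi> (a + b) = \<phi> a + \<phi> b" and scale: "\<And>c a. \<phi> (c *\<^sub>C a) = c * \<phi> a"
    have zero: "\<phi> 0 = 0" using add[of 0 0] by simp
    have "\<exists>q. (\<forall>s. \<phi> (lin_comb L s) = poly q s) \<and> poly q 0 = 0"
      using L(1)
    proof (induction L)
      case Nil
      then show ?case by (intro exI[of _ 0]) (simp add: zero)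
    next
      case (Cons fv L)
      then obtain p v where p: "fv = (poly p, v)" "poly p 0 = 0"
        by (cases fv) (auto simp: polynomial_list_def)
      from Cons obtain q where "\<forall>s. \<phi> (lin_comb L s) = poly q s" "poly q 0 = 0"
        by (auto simp: polynomial_list_def)
      with p show ?case
        by (intro exI[of _ "smult (\<phi> v) p + q"]) (simp add: lin_comb_Cons add scale mult.commute)
    qed
    then obtain q where q: "\<And>s. \<phi> (lin_comb L s) = poly q s" "poly q 0 = 0" by blast
    have "(\<lambda>t. \<phi> (lin_comb M t)) analytic_on {0}"
      using functional_lin_comb[of \<phi>, OF add scale M'] by blast
    moreover have "\<forall>\<^sub>F t in at 0. poly q (1 / t) = \<phi> (lin_comb M t)"
      using ev by eventually_elim (metis q(1))
    ultimately have "degree q = 0" by (rule poly_inverse_analytic_imp_const)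
    then obtain c where "q = [:c:]" by (metis degree_eq_zeroE)
    with q show "\<phi> (lin_comb L s) = 0" by simp
  qed
  then have "gm_represents \<gamma> (\<lambda>_. 0)" using L(2) by simp
  then show ?thesis using gm_represents_zero gm_represents_eq by blast
qed

lemma analytic_split_first:
  assumes "h analytic_on {0}"
  shows "\<exists>h1. h1 analytic_on {0} \<and> (\<forall>t. t \<noteq> 0 \<longrightarrow> h t = h 0 + t * h1 t)"
proof -
  obtain S where S: "open S" "0 \<in> S" "h holomorphic_on S" using assms by (auto simp: analytic_at)
  from pole_lemma_open[OF S(3,1), of 0] S(1,2)
  have "(\<lambda>t. if t = 0 then deriv h 0 else (h t - h 0) / (t - 0)) analytic_on {0}"
    unfolding analytic_at by blast
  then show ?thesis
    by (intro exI[of _ "\<lambda>t. if t = 0 then deriv h 0 else (h t - h 0) / (t - 0)"]) simp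
qed

text \<open>Induction on the order of the pole: \<open>h(t) = h(0) + t h\<^sub>1(t)\<close> splits off the term of lowest
  order.\<close>

lemma principal_part_monomial:
  assumes "h analytic_on {0}"
  shows "\<exists>p g. poly p 0 = 0 \<and> g analytic_on {0} \<and> (\<forall>t. t \<noteq> 0 \<longrightarrow> h t / t ^ n = poly p (1 / t) + g t)"
  using assms
proof (induction n arbitrary: h)
  case 0
  then show ?case by (intro exI[of _ 0] exI[of _ h]) simp
next
  case (Suc n)
  obtain h1 where h1: "h1 analytic_on {0}" "\<And>t. t \<noteq> 0 \<Longrightarrow> h t = h 0 + t * h1 t"
    using analytic_split_first[OF Suc.prems] by blast
  obtain p g where pg: "poly p 0 = 0" "g analytic_on {0}" "\<And>t. t \<noteq> 0 \<Longrightarrow> h1 t / t ^ n = poly p (1 / t) + g t"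
    using Suc.IH[OF h1(1)] by blast
  have "h t / t ^ Suc n = poly (p + monom (h 0) (Suc n)) (1 / t) + g t" if "t \<noteq> 0" for t
  proof -
    have "h t / t ^ Suc n = h 0 / t ^ Suc n + h1 t / t ^ n"
      using that h1(2)[OF that] by (simp add: field_simps)
    then show ?thesis by (simp add: pg(3)[OF that] poly_monom power_divide)
  qed
  moreover have "poly (p + monom (h 0) (Suc n)) 0 = 0" using pg(1) by (simp add: poly_monom)
  ultimately show ?case using pg(2) by blast
qed

lemma meromorphic_principal_part:
  assumes "f meromorphic_on {0}"
  shows "\<exists>p g. poly p 0 = 0 \<and> g analytic_on {0} \<and> (\<forall>\<^sub>F t in at 0. f t = poly p (1 / t) + g t)"
proof -
  obtain F where F: "f has_laurent_expansion F"
    using assms by (auto simp: meromorphic_on_def)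
  define h where "h = eval_fps (fls_base_factor_to_fps F)"
  define m where "m = fls_subdegree F"
  have "0 < fps_conv_radius (fls_base_factor_to_fps F)"
    using F by (simp add: has_laurent_expansion_def fls_conv_radius_altdef)
  then have h: "h analytic_on {0}"
    unfolding h_def by (intro analytic_on_eval_fps analytic_intros) (simp add: zero_ereal_def)
  have ev: "\<forall>\<^sub>F t in at 0. f t = h t * t powi m \<and> t \<noteq> 0"
    using F unfolding has_laurent_expansion_def eval_fls_def h_def m_def
    by (auto simp: eventually_at_filter elim: eventually_mono)
  show ?thesis
  proof (cases "m \<ge> 0")
    case True
    have "(\<lambda>t. h t * t ^ nat m) analytic_on {0}" by (intro analytic_intros h)
    moreover have "\<forall>\<^sub>F t in at 0. f t = poly 0 (1 / t) + h t * t ^ nat m"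
      using ev by eventually_elim (use True in \<open>simp add: power_int_def\<close>)
    ultimately show ?thesis by (metis poly_0)
  next
    case False
    obtain p g where pg: "poly p 0 = 0" "g analytic_on {0}"
      "\<And>t. t \<noteq> 0 \<Longrightarrow> h t / t ^ nat (- m) = poly p (1 / t) + g t"
      using principal_part_monomial[OF h] by blast
    have "\<forall>\<^sub>F t in at 0. f t = poly p (1 / t) + g t"
      using ev
    proof eventually_elim
      case (elim t)
      then have "f t = h t / t ^ nat (- m)" using False by (simp add: power_int_def divide_inverse power_inverse)
      then show ?case using pg(3)[of t] elim by metis
    qed
    with pg show ?thesis by blast
  qed
qed

lemma lin_comb_principal_part:
  assumes "\<forall>(f, v) \<in> set L. f meromorphic_on {0}"
  shows "\<exists>P M. polynomial_list P \<and> (\<forall>(f, v) \<in> set M. f analytic_on {0}) \<and>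
    (\<forall>\<^sub>F t in at 0. lin_comb L t = lin_comb P (1 / t) + lin_comb M t)"
  using assms
proof (induction L)
  case Nil
  show ?case by (intro exI[of _ "[]"]) (simp add: polynomial_list_def)
next
  case (Cons fv L)
  obtain f v where fv: "fv = (f, v)" by (cases fv)
  from Cons obtain P M where PM: "polynomial_list P" "\<forall>(f, v) \<in> set M. f analytic_on {0}"
    "\<forall>\<^sub>F t in at 0. lin_comb L t = lin_comb P (1 / t) + lin_comb M t" by auto
  obtain p g where pg: "poly p 0 = 0" "g analytic_on {0}" "\<forall>\<^sub>F t in at 0. f t = poly p (1 / t) + g t"
    using meromorphic_principal_part[of f] Cons.prems fv by auto
  from PM(3) pg(3) have "\<forall>\<^sub>F t in at 0. lin_comb (fv # L) t
      = lin_comb ((poly p, v) # P) (1 / t) + lin_comb ((g, v) # M) t"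
    by eventually_elim (simp add: fv lin_comb_Cons scaleC_add_left)
  moreover have "polynomial_list ((poly p, v) # P)" using PM pg by (auto simp: polynomial_list_def)
  ultimately show ?case using PM pg
    by (intro exI[of _ "(poly p, v) # P"] exI[of _ "(g, v) # M"]) auto
qed

lemma principal_part_exists:
  fixes \<alpha> :: "('p::projective_line, 'g::complex_vector) gminus"
  assumes z: "z \<noteq> base_point"
  shows "\<exists>\<gamma> \<in> principal_parts z. gm_regular (\<alpha> - \<gamma>) z"
proof -
  have "\<exists>P M. polynomial_list P \<and> (\<forall>\<gamma>. gm_represents \<gamma> (\<lambda>y. lin_comb P (1 / (coord y - coord z))) \<longrightarrow>
      gm_germ (\<alpha> - \<gamma>) z M)"
  proof (transfer fixing: z)
    fix \<alpha> :: "'p \<Rightarrow> 'g"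
    assume "in_gminus \<alpha> \<and> in_gminus \<alpha> \<and> (\<forall>z. \<forall>\<^sub>F y in at_point z. \<alpha> y = \<alpha> y)"
    then have "meromorphic_at \<alpha> z" by (simp add: in_gminus_def)
    then obtain L where L: "\<forall>(f, v) \<in> set L. f meromorphic_on {0}"
      "\<forall>\<^sub>F y in at_point z. \<alpha> y = lin_comb L (local_param z y)" by (auto simp: meromorphic_at_def)
    obtain P M where PM: "polynomial_list P" "\<forall>(f, v) \<in> set M. f analytic_on {0}"
      "\<forall>\<^sub>F t in at 0. lin_comb L t = lin_comb P (1 / t) + lin_comb M t"
      using lin_comb_principal_part[OF L(1)] by blast
    have "germ (\<lambda>y. \<alpha> y - \<gamma> y) z M"
      if "\<forall>z'. \<forall>\<^sub>F y in at_point z'. \<gamma> y = lin_comb P (1 / (coord y - coord z))" for \<gamma>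
    proof -
      from that have "\<forall>\<^sub>F y in at_point z. \<gamma> y = lin_comb P (1 / (coord y - coord z))" by blast
      with L(2) eventually_at_pointD[OF PM(3), of z]
      have "\<forall>\<^sub>F y in at_point z. \<alpha> y - \<gamma> y = lin_comb M (local_param z y)"
        by eventually_elim (use z in \<open>simp add: local_param_def\<close>)
      with PM show ?thesis by (simp add: germ_def)
    qed
    with PM(1) show "\<exists>P M. polynomial_list P \<and> (\<forall>\<gamma>\<in>{x. in_gminus x \<and> in_gminus x \<and> (\<forall>z. \<forall>\<^sub>F y in at_point z. x y = x y)}.
        (\<forall>z'. \<forall>\<^sub>F y in at_point z'. \<gamma> y = lin_comb P (1 / (coord y - coord z))) \<longrightarrow> germ (\<lambda>y. \<alpha> y - \<gamma> y) z M)"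
      by blast
  qed
  then obtain P M where PM: "polynomial_list P"
    "\<And>\<gamma>. gm_represents \<gamma> (\<lambda>y. lin_comb P (1 / (coord y - coord z))) \<Longrightarrow> gm_germ (\<alpha> - \<gamma>) z M" by blast
  obtain \<gamma> :: "('p, 'g) gminus" where \<gamma>: "gm_represents \<gamma> (\<lambda>y. lin_comb P (1 / (coord y - coord z)))"
    using gm_represents_ex[OF in_gminus_principal[OF PM(1)]] by blast
  with PM show ?thesis by (auto simp: principal_parts_def gm_regular_iff intro!: bexI[of _ \<gamma>])
qed

lemma split_at_point:
  assumes "(z :: 'p::projective_line) \<noteq> base_point"
  shows "\<exists>pr. split_lie_algebra {\<alpha> :: ('p, 'g::complex_lie_algebra) gminus. gm_regular \<alpha> z} pr"
  by (rule split_lie_algebraI[where C = "principal_parts z"])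
    (use assms in \<open>auto simp: gm_add gm_scaleC gm_lie principal_parts_closed principal_parts_lie
      principal_part_exists dest: principal_parts_regular\<close>)


section \<open>Existence of the current operators\<close>

lemma eps_elt_add: "eps_elt (v + w) z = eps_elt v z + eps_elt w z"
  by (rule gm_represents_eq[OF gm_represents_eps_elt])
    (use gm_represents_ops(1)[OF gm_represents_eps_elt gm_represents_eps_elt] in \<open>simp add: scaleC_add_right\<close>)

lemma eps_elt_scaleC: "eps_elt (a *\<^sub>C v) z = a *\<^sub>C eps_elt v z"
  by (rule gm_represents_eq[OF gm_represents_eps_elt])
    (use gm_represents_ops(2)[OF gm_represents_eps_elt gm_represents_eps_elt] in
      \<open>simp add: scaleC_scaleC mult.commute\<close>)

lemma eps_add: "eps v z (X + Y) = eps v z X + eps v z Y"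
  and eps_scaleC: "eps v z (a *\<^sub>C X) = a *\<^sub>C eps v z X"
  by (simp_all add: eps_def distrib_left uea_mult_scaleC)

text \<open>This map is \<open>[\<alpha> - \<alpha>(z), v] / (u - u(z))\<close>, where the pole cancels. Hence the recursion for
  \<open>\<iota>\<close> does not leave the enveloping algebra of the maps regular at \<open>z\<close>.\<close>

lemma gm_regular_eps_bracket:
  assumes z: "z \<noteq> base_point" and \<alpha>: "gm_regular \<alpha> z"
  shows "gm_regular (lie \<alpha> (eps_elt v z) + eps_elt (lie v (gm_value \<alpha> z)) z) z"
proof -
  obtain L where L: "gm_germ \<alpha> z L" using \<alpha> by (auto simp: gm_regular_iff)
  then have an: "\<forall>(f, w) \<in> set L. f analytic_on {0}" using gm_germ_analytic by fast
  have "\<exists>M. (\<forall>(f, w) \<in> set M. f analytic_on {0}) \<and>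
      (\<forall>t. t \<noteq> 0 \<longrightarrow> lie (lin_comb L t) v + lie v (lin_comb L 0) = t *\<^sub>C lin_comb M t)"
    using an
  proof (induction L)
    case Nil
    show ?case by (intro exI[of _ "[]"]) simp
  next
    case (Cons fw L)
    obtain f w where fw: "fw = (f, w)" by (cases fw)
    from Cons obtain M where M: "\<forall>(f, w) \<in> set M. f analytic_on {0}"
      "\<And>t. t \<noteq> 0 \<Longrightarrow> lie (lin_comb L t) v + lie v (lin_comb L 0) = t *\<^sub>C lin_comb M t" by auto
    obtain f1 where f1: "f1 analytic_on {0}" "\<And>t. t \<noteq> 0 \<Longrightarrow> f t = f 0 + t * f1 t"
      using analytic_split_first[of f] Cons.prems fw by auto
    have "lie (lin_comb (fw # L) t) v + lie v (lin_comb (fw # L) 0) = t *\<^sub>C lin_comb ((f1, lie w v) # M) t"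
      if "t \<noteq> 0" for t
    proof -
      have "lie (f t *\<^sub>C w) v + lie v (f 0 *\<^sub>C w) = (t * f1 t) *\<^sub>C lie w v"
        by (subst f1(2)[OF that], subst lie_anticomm[of v])
          (simp add: lie_scaleC_left lie_scaleC_right scaleC_add_left lie_add_left)
      then have "lie (lin_comb (fw # L) t) v + lie v (lin_comb (fw # L) 0)
          = (t * f1 t) *\<^sub>C lie w v + (lie (lin_comb L t) v + lie v (lin_comb L 0))"
        by (simp add: fw lin_comb_Cons lie_add_left lie_add_right algebra_simps)
      then show ?thesis
        using M(2)[OF that] by (simp add: lin_comb_Cons scaleC_add_right scaleC_scaleC)
    qed
    with M f1 show ?case by (intro exI[of _ "(f1, lie w v) # M"]) auto
  qed
  then obtain M where M: "\<forall>(f, w) \<in> set M. f analytic_on {0}"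
    "\<And>t. t \<noteq> 0 \<Longrightarrow> lie (lin_comb L t) v + lie v (lin_comb L 0) = t *\<^sub>C lin_comb M t" by blast
  have "gm_germ (lie \<alpha> (eps_elt v z) + eps_elt (lie v (lin_comb L 0)) z) z M"
    using L z
  proof (transfer fixing: L M v z)
    fix \<alpha> :: "'a \<Rightarrow> 'b"
    assume "germ \<alpha> z L"
    then have "\<forall>\<^sub>F y in at_point z. \<alpha> y = lin_comb L (local_param z y)" by (simp add: germ_def)
    with eventually_at_point_coord_neq[OF z]
    have "\<forall>\<^sub>F y in at_point z. lie (\<alpha> y) ((1 / (coord y - coord z)) *\<^sub>C v)
          + (1 / (coord y - coord z)) *\<^sub>C lie v (lin_comb L 0) = lin_comb M (local_param z y)"
    proof eventually_elim
      case (elim y)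
      let ?t = "coord y - coord z"
      from elim z have "lie (\<alpha> y) ((1 / ?t) *\<^sub>C v) + (1 / ?t) *\<^sub>C lie v (lin_comb L 0)
          = (1 / ?t) *\<^sub>C (lie (lin_comb L ?t) v + lie v (lin_comb L 0))"
        by (simp add: local_param_def lie_scaleC_right scaleC_add_right)
      also have "\<dots> = lin_comb M ?t"
        using elim by (subst M(2)) (simp_all add: scaleC_scaleC scaleC_one)
      finally show ?case using z by (simp add: local_param_def)
    qed
    with M(1) show "germ (\<lambda>y. lie (\<alpha> y) ((1 / (coord y - coord z)) *\<^sub>C v)
          + (1 / (coord y - coord z)) *\<^sub>C lie v (lin_comb L 0)) z M" by (simp add: germ_def)
  qed
  then show ?thesis using gm_value_eq[OF L] by (auto simp: gm_regular_iff)
qed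

fun current_word :: "'p::projective_line \<Rightarrow> 'g::quadratic_lie_algebra \<Rightarrow> ('p, 'g) gminus list \<Rightarrow> ('p, 'g) gminus uea"
  where
    "current_word z v [] = uea_of (eps_elt v z)"
  | "current_word z v (\<alpha> # w) = uea_of \<alpha> * current_word z v w - form v (gm_deriv \<alpha> z) *\<^sub>C uea_word w
      + current_word z (lie v (gm_value \<alpha> z)) w"

lemma current_word_add: "current_word z (v + v') w = current_word z v w + current_word z v' w"
  by (induction w arbitrary: v v')
    (simp_all add: eps_elt_add uea_of_add distrib_left form_add_left scaleC_add_left lie_add_left)

lemma current_word_scaleC: "current_word z (a *\<^sub>C v) w = a *\<^sub>C current_word z v w"
  by (induction w arbitrary: v)
    (simp_all add: eps_elt_scaleC uea_of_scaleC uea_mult_scaleC form_scaleC_left scaleC_scaleC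
      lie_scaleC_left scaleC_add_right complex_vector.scale_right_diff_distrib)

lemma uea_map_on_uea_word: "uea_map_on UNIV (uea_word :: 'a::complex_lie_algebra list \<Rightarrow> 'a uea)"
  unfolding uea_map_on_def
  by (simp add: uea_word_append uea_word_Cons uea_of_add uea_of_scaleC uea_of_lie algebra_simps
      uea_scaleC_mult uea_mult_scaleC)

text \<open>The commutation relation at the head of a word holds because
  \<open>(v, c) \<mapsto> ([\<alpha>(z), v], (v, d\<alpha>(z)))\<close> is an action of the regular maps on \<open>\<gg> \<oplus> \<complex>\<close>: the
  Jacobi identity gives the first component, the Leibniz rule for \<open>d[\<alpha>, \<beta>](z)\<close> and the invariance of
  the form the second.\<close>

lemma uea_map_on_current_word:
  fixes z :: "'p::projective_line" and v :: "'g::quadratic_lie_algebra"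
  shows "uea_map_on {\<alpha>. gm_regular \<alpha> z} (current_word z v)"
proof -
  let ?S = "{\<alpha> :: ('p, 'g) gminus. gm_regular \<alpha> z}"
  have U: "uea_map_on UNIV (uea_word :: ('p, 'g) gminus list \<Rightarrow> ('p, 'g) gminus uea)"
    by (rule uea_map_on_uea_word)
  have rel: "uea_word (us @ (a + b) # w) = uea_word (us @ a # w) + uea_word (us @ b # w)"
    "uea_word (us @ (c *\<^sub>C a) # w) = c *\<^sub>C uea_word (us @ a # w)"
    "uea_word (us @ lie a b # w) = uea_word (us @ a # b # w) - uea_word (us @ b # a # w)"
    for us w c and a b :: "('p, 'g) gminus"
    using U unfolding uea_map_on_def by simp_all
  have "(\<forall>a \<in> ?S. \<forall>b \<in> ?S. current_word z v (us @ (a + b) # w)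
            = current_word z v (us @ a # w) + current_word z v (us @ b # w)) \<and>
        (\<forall>c. \<forall>a \<in> ?S. current_word z v (us @ (c *\<^sub>C a) # w) = c *\<^sub>C current_word z v (us @ a # w)) \<and>
        (\<forall>a \<in> ?S. \<forall>b \<in> ?S. current_word z v (us @ a # b # w) - current_word z v (us @ b # a # w)
            = current_word z v (us @ lie a b # w))"
    for us w
  proof (induction us arbitrary: v)
    case Nil
    show ?case
    proof (intro conjI ballI allI; unfold append_Nil mem_Collect_eq)
      fix a b :: "('p, 'g) gminus" assume reg: "gm_regular a z" "gm_regular b z"
      show "current_word z v ((a + b) # w) = current_word z v (a # w) + current_word z v (b # w)"
        using gm_add[OF reg] by (simp add: uea_of_add distrib_right form_add_right scaleC_add_left
          lie_add_right current_word_add)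
      have "lie (lie v (gm_value a z)) (gm_value b z) - lie (lie v (gm_value b z)) (gm_value a z)
          = lie v (lie (gm_value a z) (gm_value b z))"
        by (simp add: lie_derivation_right[of v "gm_value a z"])
      then have cw: "current_word z (lie (lie v (gm_value a z)) (gm_value b z)) w
          = current_word z (lie v (lie (gm_value a z) (gm_value b z))) w
            + current_word z (lie (lie v (gm_value b z)) (gm_value a z)) w"
        by (metis current_word_add diff_add_cancel)
      have "form v (lie (gm_deriv a z) (gm_value b z)) = - form (lie v (gm_value b z)) (gm_deriv a z)"
        by (simp add: form_minus_right form_invariant lie_anticomm[of "gm_deriv a z"])
      then have f: "form v (gm_deriv (lie a b) z)
          = form (lie v (gm_value a z)) (gm_deriv b z) - form (lie v (gm_value b z)) (gm_deriv a z)"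
        by (simp add: gm_lie[OF reg] form_add_right form_invariant)
      show "current_word z v (a # b # w) - current_word z v (b # a # w) = current_word z v (lie a b # w)"
        by (simp add: f gm_lie(2)[OF reg] cw uea_of_lie uea_word_Cons algebra_simps uea_mult_scaleC
            complex_vector.scale_left_diff_distrib)
    next
      fix c and a :: "('p, 'g) gminus" assume reg: "gm_regular a z"
      show "current_word z v ((c *\<^sub>C a) # w) = c *\<^sub>C current_word z v (a # w)"
        using gm_scaleC[OF reg, of c] by (simp add: uea_of_scaleC uea_scaleC_mult form_scaleC_right
          scaleC_scaleC lie_scaleC_right current_word_scaleC scaleC_add_right
          complex_vector.scale_right_diff_distrib)
    qed
  next
    case (Cons s us)
    note IH1 = Cons.IH[of v] and IH2 = Cons.IH[of "lie v (gm_value s z)"]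
    show ?case
    proof (intro conjI ballI allI)
      fix a b assume S: "a \<in> ?S" "b \<in> ?S"
      show "current_word z v ((s # us) @ (a + b) # w)
          = current_word z v ((s # us) @ a # w) + current_word z v ((s # us) @ b # w)"
        using IH1 IH2 S by (simp add: rel distrib_left scaleC_add_right)
      have 1: "current_word z v' (us @ lie a b # w)
          = current_word z v' (us @ a # b # w) - current_word z v' (us @ b # a # w)" for v'
        using Cons.IH[of v'] S by simp
      show "current_word z v ((s # us) @ a # b # w) - current_word z v ((s # us) @ b # a # w)
          = current_word z v ((s # us) @ lie a b # w)"
        by (simp add: rel 1 right_diff_distrib complex_vector.scale_right_diff_distrib)
    next
      fix c a assume S: "a \<in> ?S"
      show "current_word z v ((s # us) @ (c *\<^sub>C a) # w) = c *\<^sub>C current_word z v ((s # us) @ a # w)"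
        using IH1 IH2 S by (simp add: rel uea_mult_scaleC scaleC_add_right
          complex_vector.scale_right_diff_distrib scaleC_scaleC mult.commute)
    qed
  qed
  then show ?thesis unfolding uea_map_on_def by blast
qed

lemma Ugm_singleton: "Ugm {z} = uea_sub {\<alpha>. gm_regular \<alpha> z}"
  by (simp add: Ugm_def)

lemma is_iotaD:
  assumes "is_iota z I"
  shows "X \<in> Ugm {z} \<Longrightarrow> I v X \<in> Ugm {z}" and "X \<notin> Ugm {z} \<Longrightarrow> I v X = undefined"
    and "X \<in> Ugm {z} \<Longrightarrow> Y \<in> Ugm {z} \<Longrightarrow> I v (X + Y) = I v X + I v Y"
    and "X \<in> Ugm {z} \<Longrightarrow> I v (a *\<^sub>C X) = a *\<^sub>C I v X" and "I v 1 = 0"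
    and "X \<in> Ugm {z} \<Longrightarrow> gm_regular \<alpha> z \<Longrightarrow> I v (uea_of \<alpha> * X) = uea_of \<alpha> * I v X +
        (- (eps v z (uea_of \<alpha> * X) - uea_of \<alpha> * eps v z X) - form v (gm_deriv \<alpha> z) *\<^sub>C X
        + I (lie v (gm_value \<alpha> z)) X + eps (lie v (gm_value \<alpha> z)) z X)"
proof -
  note I = assms[unfolded is_iota_def]
  show "X \<in> Ugm {z} \<Longrightarrow> I v X \<in> Ugm {z}" and "X \<notin> Ugm {z} \<Longrightarrow> I v X = undefined"
    using I by (metis PiE_mem, metis PiE_arb)
  show "X \<in> Ugm {z} \<Longrightarrow> Y \<in> Ugm {z} \<Longrightarrow> I v (X + Y) = I v X + I v Y"
    and "X \<in> Ugm {z} \<Longrightarrow> I v (a *\<^sub>C X) = a *\<^sub>C I v X" and "I v 1 = 0" using I by blast+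
  show "I v (uea_of \<alpha> * X) = uea_of \<alpha> * I v X +
        (- (eps v z (uea_of \<alpha> * X) - uea_of \<alpha> * eps v z X) - form v (gm_deriv \<alpha> z) *\<^sub>C X
        + I (lie v (gm_value \<alpha> z)) X + eps (lie v (gm_value \<alpha> z)) z X)"
    if "X \<in> Ugm {z}" "gm_regular \<alpha> z"
  proof -
    have "I v (uea_of \<alpha> * X) - uea_of \<alpha> * I v X =
        - (eps v z (uea_of \<alpha> * X) - uea_of \<alpha> * eps v z X) - form v (gm_deriv \<alpha> z) *\<^sub>C X
        + I (lie v (gm_value \<alpha> z)) X + eps (lie v (gm_value \<alpha> z)) z X"
      using I that by blast
    then show ?thesis by (metis diff_add_cancel add.commute)
  qed
qed

lemma is_iota_unique:
  assumes "is_iota z I" "is_iota z I'"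
  shows "I = I'"
proof (intro ext)
  fix v X
  note I = is_iotaD[OF assms(1)] is_iotaD[OF assms(2)]
  show "I v X = I' v X"
  proof (cases "X \<in> Ugm {z}")
    case True
    then have "X \<in> uea_sub {\<alpha>. gm_regular \<alpha> z}" by (simp add: Ugm_singleton)
    then show ?thesis
      by (induction arbitrary: v rule: uea_sub_induct) (simp_all add: I flip: Ugm_singleton)
  qed (simp add: I)
qed

text \<open>The extension \<open>J\<close> of \<open>current_word\<close> to the enveloping algebra is the current,
  and subtracting \<open>\<epsilon>\<close> from it gives \<open>\<iota>\<close>.\<close>

lemma is_iota_exists:
  fixes z :: "'p::projective_line"
  assumes z: "z \<noteq> base_point"
  shows "\<exists>I. is_iota z (I :: 'g::quadratic_lie_algebra \<Rightarrow> ('p, 'g) gminus uea \<Rightarrow> ('p, 'g) gminus uea)"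
proof -
  obtain pr where "split_lie_algebra {\<alpha> :: ('p, 'g) gminus. gm_regular \<alpha> z} pr"
    using split_at_point[OF z] by blast
  then interpret split_lie_algebra "{\<alpha> :: ('p, 'g) gminus. gm_regular \<alpha> z}" pr .
  have "\<forall>v. \<exists>F :: ('p, 'g) gminus uea \<Rightarrow> ('p, 'g) gminus uea.
      (\<forall>X Y. F (X + Y) = F X + F Y) \<and> (\<forall>a X. F (a *\<^sub>C X) = a *\<^sub>C F X) \<and>
      (\<forall>xs \<in> lists {\<alpha>. gm_regular \<alpha> z}. F (uea_word xs) = current_word z v xs)"
    using uea_sub_lift[OF uea_map_on_current_word] by blast
  from choice[OF this] obtain J :: "'g \<Rightarrow> ('p, 'g) gminus uea \<Rightarrow> ('p, 'g) gminus uea"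
    where J: "\<And>v. (\<forall>X Y. J v (X + Y) = J v X + J v Y) \<and> (\<forall>a X. J v (a *\<^sub>C X) = a *\<^sub>C J v X) \<and>
      (\<forall>xs \<in> lists {\<alpha>. gm_regular \<alpha> z}. J v (uea_word xs) = current_word z v xs)" by blast
  then have J_add: "J v (X + Y) = J v X + J v Y" and J_scaleC: "J v (a *\<^sub>C X) = a *\<^sub>C J v X"
    and J_word: "xs \<in> lists {\<alpha>. gm_regular \<alpha> z} \<Longrightarrow> J v (uea_word xs) = current_word z v xs"
    for v X Y a xs by blast+
  have J_mult: "J v (uea_of \<alpha> * X) = uea_of \<alpha> * J v X - form v (gm_deriv \<alpha> z) *\<^sub>C X + J (lie v (gm_value \<alpha> z)) X"
    if \<alpha>: "gm_regular \<alpha> z" and "X \<in> uea_sub {\<alpha>. gm_regular \<alpha> z}" for v \<alpha> X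
    using that(2)
  proof (induction arbitrary: rule: uea_sub_span_induct)
    case zero
    have "J v 0 = 0" for v using J_scaleC[of v 0 0] by simp
    then show ?case by simp
  next
    case (add X Y)
    then show ?case by (simp add: distrib_left J_add scaleC_add_right algebra_simps)
  next
    case (word c xs)
    then have "J v (uea_of \<alpha> * uea_word xs) = current_word z v (\<alpha> # xs)"
      using \<alpha> by (subst J_word[symmetric]) (auto simp: uea_word_Cons)
    then show ?case using word by (simp add: uea_mult_scaleC J_scaleC J_word scaleC_add_right
        complex_vector.scale_right_diff_distrib scaleC_scaleC mult.commute)
  qed
  define K where "K v X = J v X - eps v z X" for v X
  have K_one: "K v 1 = 0" for v using J_word[of "[]" v] by (simp add: K_def eps_def)
  have K_add: "K v (X + Y) = K v X + K v Y" and K_scaleC: "K v (a *\<^sub>C X) = a *\<^sub>C K v X" for v X Y a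
    by (simp_all add: K_def J_add J_scaleC eps_add eps_scaleC complex_vector.scale_right_diff_distrib)
  have K_mult: "K v (uea_of \<alpha> * X) - uea_of \<alpha> * K v X =
        - (eps v z (uea_of \<alpha> * X) - uea_of \<alpha> * eps v z X) - form v (gm_deriv \<alpha> z) *\<^sub>C X
        + K (lie v (gm_value \<alpha> z)) X + eps (lie v (gm_value \<alpha> z)) z X"
    if "gm_regular \<alpha> z" "X \<in> uea_sub {\<alpha>. gm_regular \<alpha> z}" for v \<alpha> X
    using J_mult[OF that] by (simp add: K_def algebra_simps)
  have K_in: "K v X \<in> uea_sub {\<alpha>. gm_regular \<alpha> z}" if "X \<in> uea_sub {\<alpha>. gm_regular \<alpha> z}" for v X
    using that
  proof (induction arbitrary: v rule: uea_sub_induct)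
    case one
    then show ?case by (simp add: K_one uea_sub_zero)
  next
    case (mult \<alpha> X)
    let ?\<beta> = "lie \<alpha> (eps_elt v z) + eps_elt (lie v (gm_value \<alpha> z)) z"
    have "K v (uea_of \<alpha> * X) = uea_of \<alpha> * K v X + uea_of ?\<beta> * X - form v (gm_deriv \<alpha> z) *\<^sub>C X
        + K (lie v (gm_value \<alpha> z)) X"
      using K_mult[of \<alpha> X v] mult by (simp add: eps_def uea_of_add uea_of_lie algebra_simps)
    moreover have "gm_regular ?\<beta> z" using z mult by (intro gm_regular_eps_bracket) auto
    ultimately show ?case using mult
      by (auto intro!: uea_sub_add uea_sub_diff uea_sub_mult uea_sub_scaleC)
  qed (auto simp: K_add K_scaleC intro: uea_sub_add uea_sub_scaleC)
  let ?U = "uea_sub {\<alpha> :: ('p, 'g) gminus. gm_regular \<alpha> z}"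
  have "is_iota z (\<lambda>v. restrict (K v) ?U)"
    unfolding is_iota_def Ugm_singleton
    using K_in K_one K_add K_scaleC K_mult
    by (auto simp: uea_sub_add uea_sub_scaleC uea_sub_one uea_sub_mult)
  then show ?thesis by blast
qed

lemma is_iota_iota:
  fixes z :: "'p::projective_line"
  assumes "z \<noteq> base_point"
  shows "is_iota z (\<lambda>v :: 'g::quadratic_lie_algebra. iota v z)"
proof -
  obtain I :: "'g \<Rightarrow> ('p, 'g) gminus uea \<Rightarrow> ('p, 'g) gminus uea" where I: "is_iota z I"
    using is_iota_exists[OF assms] by blast
  have "(THE I. is_iota z I) = I"
    by (rule the_equality[of "is_iota z", OF I]) (rule is_iota_unique[OF _ I])
  then have "(\<lambda>v. iota v z) = I" by (simp add: iota_def fun_eq_iff)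
  with I show ?thesis by simp
qed

lemmas iotaD = is_iotaD[OF is_iota_iota]

lemma current_one: "z \<noteq> base_point \<Longrightarrow> current v z 1 = uea_of (eps_elt v z)"
  by (simp add: current_def eps_def iotaD(5))

lemma current_mult:
  assumes "z \<noteq> base_point" "gm_regular \<alpha> z" "X \<in> Ugm {z}"
  shows "current v z (uea_of \<alpha> * X) = uea_of \<alpha> * current v z X - form v (gm_deriv \<alpha> z) *\<^sub>C X
    + current (lie v (gm_value \<alpha> z)) z X"
  by (simp add: current_def iotaD(6)[OF assms(1,3,2)] algebra_simps)

lemma current_add:
  assumes "z \<noteq> base_point" "X \<in> Ugm {z}" "Y \<in> Ugm {z}"
  shows "current v z (X + Y) = current v z X + current v z Y"
  by (simp add: current_def eps_add iotaD(3)[OF assms])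

lemma current_scaleC:
  assumes "z \<noteq> base_point" "X \<in> Ugm {z}"
  shows "current v z (a *\<^sub>C X) = a *\<^sub>C current v z X"
  by (simp add: current_def eps_scaleC scaleC_add_right iotaD(4)[OF assms])

lemma current_diff:
  assumes "z \<noteq> base_point" "X \<in> Ugm {z}" "Y \<in> Ugm {z}"
  shows "current v z (X - Y) = current v z X - current v z Y"
  using current_add[OF assms(1), of X "(- 1) *\<^sub>C Y" v] current_scaleC[OF assms(1,3), of v "- 1"] assms
  by (simp add: Ugm_singleton uea_sub_uminus)

lemma current_linear_left:
  assumes z: "z \<noteq> base_point" and X: "X \<in> Ugm {z}"
  shows "current (v + w) z X = current v z X + current w z X \<and> current (a *\<^sub>C v) z X = a *\<^sub>C current v z X"
  using X[unfolded Ugm_singleton]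
proof (induction arbitrary: v w rule: uea_sub_induct)
  case one
  then show ?case by (simp add: current_one z eps_elt_add eps_elt_scaleC uea_of_add uea_of_scaleC)
next
  case (mult \<alpha> X)
  then have "gm_regular \<alpha> z" "X \<in> Ugm {z}" by (simp_all add: Ugm_singleton)
  note [simp] = current_mult[OF z this]
  show ?case
    by (simp add: mult.IH lie_add_left lie_scaleC_left form_add_left form_scaleC_left distrib_left
      uea_mult_scaleC scaleC_add_left scaleC_add_right complex_vector.scale_right_diff_distrib scaleC_scaleC)
next
  case (add X Y)
  then have "X \<in> Ugm {z}" "Y \<in> Ugm {z}" by (simp_all add: Ugm_singleton)
  note [simp] = current_add[OF z this]
  show ?case by (simp add: add.IH scaleC_add_right algebra_simps)
next
  case (scaleC c X)
  then have "X \<in> Ugm {z}" by (simp add: Ugm_singleton)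
  note [simp] = current_scaleC[OF z this]
  show ?case by (simp add: scaleC.IH scaleC_add_right scaleC_scaleC mult.commute)
qed


section \<open>Commutation of currents\<close>

lemma Ugm_pairD:
  assumes "X \<in> Ugm {z1, z2}"
  shows "X \<in> Ugm {z1}" "X \<in> Ugm {z2}" "X \<in> Ugm {z2, z1}"
  using assms by (auto simp: Ugm_def insert_commute elim!: uea_sub_mono[rotated])

lemma current_in_Ugm:
  assumes z: "z1 \<noteq> z2" "z1 \<noteq> base_point" "z2 \<noteq> base_point" and X: "X \<in> Ugm {z1, z2}"
  shows "current v z1 X \<in> Ugm {z2}"
  using X unfolding Ugm_def
proof (induction arbitrary: v rule: uea_sub_induct)
  case one
  have "gm_regular (eps_elt v z1) z2" using z by (intro gm_eps_elt) auto
  then show ?case using uea_sub_mult[of "eps_elt v z1" _ 1] by (simp add: current_one z uea_sub_one)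
next
  case (mult \<alpha> X)
  then have X: "X \<in> Ugm {z1, z2}" by (simp add: Ugm_def)
  have "X \<in> Ugm {z1}" "X \<in> Ugm {z2}" using Ugm_pairD X by blast+
  with mult show ?case
    by (auto simp: current_mult z Ugm_singleton intro!: uea_sub_add uea_sub_diff uea_sub_mult uea_sub_scaleC)
next
  case (add X Y)
  then have X: "X \<in> Ugm {z1, z2}" "Y \<in> Ugm {z1, z2}" by (simp_all add: Ugm_def)
  have "X \<in> Ugm {z1}" "Y \<in> Ugm {z1}" using Ugm_pairD X by blast+
  with add show ?case by (simp add: current_add z uea_sub_add)
next
  case (scaleC c X)
  then have X: "X \<in> Ugm {z1, z2}" by (simp add: Ugm_def)
  have "X \<in> Ugm {z1}" using Ugm_pairD X by blast
  with scaleC show ?case by (simp add: current_scaleC z uea_sub_scaleC)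
qed

text \<open>Partial fractions for \<open>1 / ((u - u(a)) (u - u(b)))\<close>.\<close>

lemma lie_eps_elt:
  assumes "coord a \<noteq> coord b"
  shows "lie (eps_elt v a) (eps_elt w b)
    = (1 / (coord a - coord b)) *\<^sub>C (eps_elt (lie v w) a - eps_elt (lie v w) b)"
proof -
  have ne: "\<forall>\<^sub>F y in at_point z. coord y \<noteq> c" for z :: 'a and c
  proof (cases "z = base_point")
    case True
    have "\<forall>\<^sub>F t in at 0. t \<noteq> inverse c" by (rule eventually_neq_at_within)
    from eventually_at_pointD[OF this, of z] True show ?thesis
      by (auto simp: local_param_def elim: eventually_mono)
  next
    case False
    have "\<forall>\<^sub>F t in at 0. t \<noteq> c - coord z" by (rule eventually_neq_at_within)
    from eventually_at_pointD[OF this, of z] False show ?thesis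
      by (auto simp: local_param_def elim: eventually_mono)
  qed
  have eq: "lie ((1 / (coord y - coord a)) *\<^sub>C v) ((1 / (coord y - coord b)) *\<^sub>C w) =
      (1 / (coord a - coord b)) *\<^sub>C ((1 / (coord y - coord a)) *\<^sub>C lie v w - (1 / (coord y - coord b)) *\<^sub>C lie v w)"
    if "coord y \<noteq> coord a" "coord y \<noteq> coord b" for y
  proof -
    have "1 / (coord y - coord b) * (1 / (coord y - coord a))
        = 1 / (coord a - coord b) * (1 / (coord y - coord a) - 1 / (coord y - coord b))"
      using assms that by (simp add: field_simps)
    then show ?thesis
      by (simp only: lie_scaleC_left lie_scaleC_right scaleC_scaleC
        flip: complex_vector.scale_left_diff_distrib)
  qed
  have diff: "gm_represents (\<alpha> - \<beta>) (\<lambda>y. f y - g y)" if "gm_represents \<alpha> f" "gm_represents \<beta> g"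
    for \<alpha> \<beta> :: "('a, 'b) gminus" and f g
    using gm_represents_ops(1)[OF that(1) gm_represents_ops(2)[OF that(2) that(2), of "- 1"]] by simp
  note rep = gm_represents_eps_elt
  show ?thesis
    by (rule gm_represents_eqI[OF gm_represents_lie[OF rep rep] gm_represents_ops(2)[OF diff[OF rep rep] rep]])
      (rule eventually_mono[OF eventually_conj[OF ne[of "coord a"] ne[of "coord b"]]], simp add: eq)
qed

text \<open>By the recursion, the commutator of the two currents commutes with \<open>\<alpha>\<close> up to commutators of currents
  for other vectors; the form terms are scalars and drop out. Only its value on \<open>1\<close> has to be
  computed.\<close>

lemma currents_commute:
  fixes z1 z2 :: "'p::projective_line" and v1 v2 :: "'g::quadratic_lie_algebra"
  assumes z: "z1 \<noteq> z2" "z1 \<noteq> base_point" "z2 \<noteq> base_point" and X: "X \<in> Ugm {z1, z2}"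
  shows "current v2 z2 (current v1 z1 X) = current v1 z1 (current v2 z2 X)"
  using X[unfolded Ugm_def]
proof (induction arbitrary: v1 v2 rule: uea_sub_induct)
  case one
  have one: "(1 :: ('p, 'g) gminus uea) \<in> Ugm {z}" for z by (simp add: Ugm_singleton uea_sub_one)
  have ne: "coord z1 \<noteq> coord z2" using z by (simp add: coord_eq_iff)
  \<comment> \<open>The form term is positive because the derivative of \<open>1 / (u - u(a))\<close> is negative.\<close>
  have pair: "current v b (uea_of (eps_elt w a)) = uea_of (eps_elt w a) * uea_of (eps_elt v b)
      + (form v w / (coord b - coord a)^2) *\<^sub>C 1 + (1 / (coord b - coord a)) *\<^sub>C uea_of (eps_elt (lie v w) b)"
    if ab: "a \<noteq> b" "a \<noteq> base_point" "b \<noteq> base_point" for v w :: 'g and a b :: 'p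
  proof -
    note g = gm_eps_elt[OF ab(3,2) ab(1)[symmetric], of w]
    show ?thesis using current_mult[OF ab(3) g(1) one, of v]
      by (simp add: g current_one ab form_scaleC_right form_minus_right lie_scaleC_right eps_elt_scaleC
        uea_of_scaleC)
  qed
  have "uea_of (eps_elt v1 z1) * uea_of (eps_elt v2 z2) - uea_of (eps_elt v2 z2) * uea_of (eps_elt v1 z1)
      = (1 / (coord z1 - coord z2)) *\<^sub>C (uea_of (eps_elt (lie v1 v2) z1) - uea_of (eps_elt (lie v1 v2) z2))"
    by (simp add: lie_eps_elt[OF ne] uea_of_scaleC uea_of_diff flip: uea_of_lie)
  moreover have "eps_elt (lie v2 v1) z2 = - eps_elt (lie v1 v2) z2"
    using eps_elt_scaleC[of "- 1"] by (simp add: lie_anticomm[of v2])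
  moreover have "1 / (coord z2 - coord z1) = - (1 / (coord z1 - coord z2))"
    by (simp add: minus_divide_right)
  ultimately show ?case
    using z by (simp add: current_one pair form_sym[of v2] power2_commute[of "coord z2"] uea_of_minus
      complex_vector.scale_right_diff_distrib algebra_simps)
next
  case (mult \<alpha> X)
  then have X: "X \<in> Ugm {z1, z2}" and \<alpha>: "gm_regular \<alpha> z1" "gm_regular \<alpha> z2" by (simp_all add: Ugm_def)
  then have X1: "X \<in> Ugm {z1}" and X2: "X \<in> Ugm {z2}" using Ugm_pairD by blast+
  have X': "X \<in> Ugm {z2, z1}" using X by (simp add: insert_commute)
  have in2: "current v z1 X \<in> Ugm {z2}" and in1: "current v z2 X \<in> Ugm {z1}" for v
    using current_in_Ugm[OF z X] current_in_Ugm[OF z(1)[symmetric] z(3,2) X'] by auto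
  note closed = uea_sub_mult[of \<alpha>] uea_sub_scaleC uea_sub_add uea_sub_diff
  show ?case using \<alpha> in1 in2 X1 X2
    by (simp add: current_mult z current_add current_diff current_scaleC Ugm_singleton closed mult.IH)
next
  case (add X Y)
  then have X: "X \<in> Ugm {z1, z2}" "Y \<in> Ugm {z1, z2}" by (simp_all add: Ugm_def)
  then have 1: "X \<in> Ugm {z1}" "Y \<in> Ugm {z1}" "X \<in> Ugm {z2}" "Y \<in> Ugm {z2}" using Ugm_pairD by blast+
  have X': "X \<in> Ugm {z2, z1}" "Y \<in> Ugm {z2, z1}" using X by (simp_all add: insert_commute)
  have "current v z1 X \<in> Ugm {z2}" "current v z2 X \<in> Ugm {z1}"
    "current v z1 Y \<in> Ugm {z2}" "current v z2 Y \<in> Ugm {z1}" for v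
    using current_in_Ugm[OF z] current_in_Ugm[OF z(1)[symmetric] z(3,2)] X X' by auto
  with 1 show ?case by (simp add: current_add z add.IH)
next
  case (scaleC c X)
  then have X: "X \<in> Ugm {z1, z2}" by (simp add: Ugm_def)
  then have 1: "X \<in> Ugm {z1}" "X \<in> Ugm {z2}" using Ugm_pairD by blast+
  have X': "X \<in> Ugm {z2, z1}" using X by (simp add: insert_commute)
  have "current v z1 X \<in> Ugm {z2}" "current v z2 X \<in> Ugm {z1}" for v
    using current_in_Ugm[OF z X] current_in_Ugm[OF z(1)[symmetric] z(3,2) X'] by auto
  with 1 show ?case by (simp add: current_scaleC z scaleC.IH)
qed


section \<open>The product of currents at nearby points\<close>

text \<open>An element of the enveloping algebra involves only finitely many maps, each of which is
  regular near \<open>z\<close>.\<close>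

lemma eventually_Ugm:
  assumes z: "z \<noteq> base_point" and X: "X \<in> Ugm {z}"
  shows "\<forall>\<^sub>F y in at_point z. X \<in> Ugm {z, y}"
  using X[unfolded Ugm_singleton]
proof (induction rule: uea_sub_induct)
  case one
  show ?case by (simp add: Ugm_def uea_sub_one)
next
  case (mult \<alpha> X)
  then obtain L where "gm_germ \<alpha> z L" by (auto simp: gm_regular_iff)
  from gm_expansion_nearby[OF this z] mult(3) show ?case
    by eventually_elim (use mult(1) in \<open>auto simp: Ugm_def intro!: uea_sub_mult\<close>)
next
  case (add X Y)
  from add(3,4) show ?case by eventually_elim (simp add: Ugm_def uea_sub_add)
next
  case (scaleC c X)
  from scaleC(2) show ?case by eventually_elim (simp add: Ugm_def uea_sub_scaleC)
qed

lemma current_lie_lin_comb: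
  assumes "y \<noteq> base_point" "X \<in> Ugm {y}"
  shows "current (lie v (lin_comb L t)) y X = (\<Sum>(f, w) \<leftarrow> L. f t *\<^sub>C current (lie v w) y X)"
proof (induction L)
  case Nil
  have "current (0 *\<^sub>C v) y X = 0 *\<^sub>C current v y X" using current_linear_left[OF assms] by blast
  then show ?case by simp
next
  case (Cons p L)
  obtain f w where p: "p = (f, w)" by (cases p)
  show ?case using Cons current_linear_left[OF assms]
    by (simp add: p lin_comb_Cons lie_add_right lie_scaleC_right)
qed

locale current_limits =
  fixes T :: "('p::projective_line, 'g::quadratic_lie_algebra) gminus uea topology" and z :: 'p
  assumes T: "current_topology T" and z: "z \<noteq> base_point"
begin

lemma topspace_T [simp]: "topspace T = UNIV"
  using T by (simp add: current_topology_def)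

lemma lim_add:
  assumes "limitin T f l F" "limitin T g m F" shows "limitin T (\<lambda>y. f y + g y) (l + m) F"
proof -
  have "continuous_map (prod_topology T T) T (\<lambda>(X, Y). X + Y)" using T by (simp add: current_topology_def)
  from continuous_map_limit[OF this, of "\<lambda>y. (f y, g y)" "(l, m)" F] assms show ?thesis
    by (simp add: limitin_pairwise o_def)
qed

lemma lim_scaleC:
  assumes "(c \<longlongrightarrow> a) F" "limitin T f l F" shows "limitin T (\<lambda>y. c y *\<^sub>C f y) (a *\<^sub>C l) F"
proof -
  have "continuous_map (prod_topology euclidean T) T (\<lambda>(a, X). a *\<^sub>C X)"
    using T by (simp add: current_topology_def)
  from continuous_map_limit[OF this, of "\<lambda>y. (c y, f y)" "(a, l)" F] assms show ?thesis
    by (simp add: limitin_pairwise o_def)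
qed

lemma lim_diff:
  assumes "limitin T f l F" "limitin T g m F" shows "limitin T (\<lambda>y. f y - g y) (l - m) F"
  using lim_add[OF assms(1) lim_scaleC[OF tendsto_const assms(2), of "- 1"]] by simp

lemma lim_mult_left: "limitin T f l F \<Longrightarrow> limitin T (\<lambda>y. X * f y) (X * l) F"
  and lim_mult_right: "limitin T f l F \<Longrightarrow> limitin T (\<lambda>y. f y * X) (l * X) F"
  using T continuous_map_limit[of T T "\<lambda>Y. X * Y" f l F] continuous_map_limit[of T T "\<lambda>Y. Y * X" f l F]
  by (simp_all add: current_topology_def o_def)

lemma lim_eps_elt: "limitin T (\<lambda>y. uea_of (eps_elt v y)) (uea_of (eps_elt v z)) (at_point z)"
  using T z by (simp add: current_topology_def)

lemma lim_unique: "limitin T f l (at_point z) \<Longrightarrow> limitin T f m (at_point z) \<Longrightarrow> l = m"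
  using limitin_Hausdorff_unique at_point_neq_bot T by (metis current_topology_def)

definition cont :: "('p \<Rightarrow> ('p, 'g) gminus uea) \<Rightarrow> bool"
  where "cont G \<longleftrightarrow> limitin T G (G z) (at_point z)"

definition has_deriv :: "('p \<Rightarrow> ('p, 'g) gminus uea) \<Rightarrow> ('p, 'g) gminus uea \<Rightarrow> bool"
  where "has_deriv G D \<longleftrightarrow> limitin T (\<lambda>y. (1 / (coord y - coord z)) *\<^sub>C (G y - G z)) D (at_point z)"

lemma cont_cong:
  assumes "\<forall>\<^sub>F y in at_point z. G y = H y" "G z = H z" shows "cont H \<Longrightarrow> cont G"
  unfolding cont_def assms(2)
  by (rule limitin_transform_eventually) (use assms(1) in \<open>auto elim: eventually_mono\<close>)

lemma has_deriv_cong: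
  assumes "\<forall>\<^sub>F y in at_point z. G y = H y" "G z = H z" shows "has_deriv H D \<Longrightarrow> has_deriv G D"
  unfolding has_deriv_def assms(2)
  by (rule limitin_transform_eventually) (use assms(1) in \<open>auto elim: eventually_mono\<close>)

lemma cont_const: "cont (\<lambda>_. X)" and cont_add: "cont G \<Longrightarrow> cont H \<Longrightarrow> cont (\<lambda>y. G y + H y)"
  and cont_mult_left: "cont G \<Longrightarrow> cont (\<lambda>y. X * G y)"
  by (simp_all add: cont_def lim_add lim_mult_left)

lemma has_deriv_const: "has_deriv (\<lambda>_. X) 0"
  by (simp add: has_deriv_def)

lemma has_deriv_add: "has_deriv G D \<Longrightarrow> has_deriv H E \<Longrightarrow> has_deriv (\<lambda>y. G y + H y) (D + E)"
  unfolding has_deriv_def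
  by (drule (1) lim_add) (simp add: add_diff_add flip: scaleC_add_right)

lemma has_deriv_diff: "has_deriv G D \<Longrightarrow> has_deriv H E \<Longrightarrow> has_deriv (\<lambda>y. G y - H y) (D - E)"
  unfolding has_deriv_def
  by (drule (1) lim_diff) (simp add: algebra_simps flip: complex_vector.scale_right_diff_distrib)

lemma has_deriv_mult_left: "has_deriv G D \<Longrightarrow> has_deriv (\<lambda>y. X * G y) (X * D)"
  unfolding has_deriv_def
  by (drule lim_mult_left[where X = X]) (simp add: uea_mult_scaleC right_diff_distrib)

lemma tendsto_coord:
  assumes "(g \<longlongrightarrow> l) (at 0)" shows "((\<lambda>y. g (coord y - coord z)) \<longlongrightarrow> l) (at_point z)"
  using tendsto_local_param[OF assms, of z] z by (simp add: local_param_def)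

lemma cont_scaleC:
  assumes "g analytic_on {0}" "cont G"
  shows "cont (\<lambda>y. g (coord y - coord z) *\<^sub>C G y)"
  using assms lim_scaleC[OF tendsto_coord[of g "g 0"]] analytic_at_imp_isCont[of g 0]
  by (simp add: cont_def isCont_def)

lemma has_deriv_scaleC:
  assumes g: "g analytic_on {0}" and G: "cont G" "has_deriv G D"
  shows "has_deriv (\<lambda>y. g (coord y - coord z) *\<^sub>C G y) (deriv g 0 *\<^sub>C G z + g 0 *\<^sub>C D)"
proof -
  have "(\<lambda>t. (g t - g 0) / t) \<midarrow>0\<rightarrow> deriv g 0"
    using analytic_on_imp_differentiable_at[OF g, of 0]
    by (simp add: DERIV_def flip: DERIV_deriv_iff_field_differentiable)
  from lim_add[OF lim_scaleC[OF tendsto_coord[OF this] G(1)[unfolded cont_def]]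
      lim_scaleC[OF tendsto_const G(2)[unfolded has_deriv_def], of "g 0"]]
  show ?thesis
    unfolding has_deriv_def
    by (rule limitin_transform_eventually[rotated])
      (rule always_eventually, simp add: scaleC_scaleC complex_vector.scale_right_diff_distrib
        complex_vector.scale_left_diff_distrib diff_divide_distrib)
qed

lemma cont_sum_list:
  "(\<And>f w. (f, w) \<in> set L \<Longrightarrow> cont (G f w)) \<Longrightarrow> cont (\<lambda>y. \<Sum>(f, w) \<leftarrow> L. G f w y)"
  by (induction L) (auto intro!: cont_const cont_add)

lemma has_deriv_sum_list:
  assumes "\<And>f w. (f, w) \<in> set L \<Longrightarrow> \<exists>D. has_deriv (G f w) D"
  shows "\<exists>D. has_deriv (\<lambda>y. \<Sum>(f, w) \<leftarrow> L. G f w y) D"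
  using assms
proof (induction L)
  case Nil
  show ?case using has_deriv_const[of 0] by auto
next
  case (Cons p L)
  obtain f w where p: "p = (f, w)" by (cases p)
  from Cons obtain D where "has_deriv (\<lambda>y. \<Sum>(f, w) \<leftarrow> L. G f w y) D" by auto
  moreover from Cons.prems p obtain E where "has_deriv (G f w) E" by auto
  ultimately have "has_deriv (\<lambda>y. G f w y + (\<Sum>(f, w) \<leftarrow> L. G f w y)) (E + D)"
    by (intro has_deriv_add)
  then show ?case unfolding p by auto
qed

text \<open>The difference quotient of \<open>\<epsilon>\<^bsup>[a,b]\<^esup>\<close> is the commutator of \<open>\<epsilon>\<^sup>a(y)\<close> and \<open>\<epsilon>\<^sup>b(z)\<close>, which is
  continuous in \<open>y\<close>.\<close>

lemma has_deriv_eps_elt_lie: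
  "has_deriv (\<lambda>y. uea_of (eps_elt (lie a b) y))
    (uea_of (eps_elt a z) * uea_of (eps_elt b z) - uea_of (eps_elt b z) * uea_of (eps_elt a z))"
proof -
  have lim: "limitin T (\<lambda>y. uea_of (eps_elt a y) * uea_of (eps_elt b z) - uea_of (eps_elt b z) * uea_of (eps_elt a y))
     (uea_of (eps_elt a z) * uea_of (eps_elt b z) - uea_of (eps_elt b z) * uea_of (eps_elt a z)) (at_point z)"
    by (intro lim_diff lim_mult_left lim_mult_right lim_eps_elt)
  have "\<forall>\<^sub>F y in at_point z. uea_of (eps_elt a y) * uea_of (eps_elt b z) - uea_of (eps_elt b z) * uea_of (eps_elt a y)
      = (1 / (coord y - coord z)) *\<^sub>C (uea_of (eps_elt (lie a b) y) - uea_of (eps_elt (lie a b) z))"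
    using eventually_at_point_coord_neq[OF z]
    by eventually_elim (simp add: lie_eps_elt uea_of_scaleC uea_of_diff flip: uea_of_lie)
  from limitin_transform_eventually[OF this lim] show ?thesis unfolding has_deriv_def .
qed

text \<open>The recursion at a nearby point in terms of one expansion of \<open>\<alpha>\<close>: the point enters only
  through holomorphic coefficients and through currents applied to the shorter element \<open>X\<close>.\<close>

lemma current_mult_near:
  fixes v :: 'g
  assumes L: "gm_germ \<alpha> z L" and X: "X \<in> Ugm {z}"
  defines "G \<equiv> \<lambda>y. uea_of \<alpha> * current v y X + (- form v (lin_comb (deriv_list L) (coord y - coord z))) *\<^sub>C X
    + (\<Sum>(f, w) \<leftarrow> L. f (coord y - coord z) *\<^sub>C current (lie v w) y X)"
  shows "\<forall>\<^sub>F y in at_point z. current v y (uea_of \<alpha> * X) = G y" "current v z (uea_of \<alpha> * X) = G z"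
proof -
  have 1: "current v y (uea_of \<alpha> * X) = G y"
    if "y \<noteq> base_point" "gm_regular \<alpha> y" "gm_value \<alpha> y = lin_comb L (coord y - coord z)"
      "gm_deriv \<alpha> y = lin_comb (deriv_list L) (coord y - coord z)" "X \<in> Ugm {y}" for y
    by (simp add: current_mult that current_lie_lin_comb G_def)
  show "\<forall>\<^sub>F y in at_point z. current v y (uea_of \<alpha> * X) = G y"
    using gm_expansion_nearby[OF L z] eventually_Ugm[OF z X] eventually_at_point_neq_base[of z]
    by eventually_elim (rule 1; blast dest: Ugm_pairD)
  show "current v z (uea_of \<alpha> * X) = G z"
    by (rule 1) (use z X L in \<open>auto simp: gm_value_eq gm_deriv_eq gm_regular_iff\<close>)
qed

text \<open>Induction along the recursion. Differentiability passes from \<open>X\<close> to \<open>\<alpha>X\<close> because the recursion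
  for the bracket \<open>[a, b]\<close> only calls currents of brackets, namely of \<open>[a, b]\<close> itself and of
  the \<open>[[a, b], w]\<close>.\<close>

lemma current_cont_has_deriv:
  assumes X: "X \<in> Ugm {z}"
  shows "cont (\<lambda>y. current v y X)" and "\<exists>D. has_deriv (\<lambda>y. current (lie a b) y X) D"
proof -
  have "(\<forall>v. cont (\<lambda>y. current v y X)) \<and> (\<forall>a b. \<exists>D. has_deriv (\<lambda>y. current (lie a b) y X) D)"
    using X[unfolded Ugm_singleton]
  proof (induction rule: uea_sub_induct)
    case one
    have 1: "\<forall>\<^sub>F y in at_point z. current v y 1 = uea_of (eps_elt v y)" for v
      using eventually_at_point_neq_base[of z] by eventually_elim (simp add: current_one)
    have "cont (\<lambda>y. current v y 1)" for v
      by (rule cont_cong[OF 1 current_one[OF z]]) (simp add: cont_def lim_eps_elt)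
    moreover have "\<exists>D. has_deriv (\<lambda>y. current (lie a b) y 1) D" for a b
      by (rule exI, rule has_deriv_cong[OF 1 current_one[OF z] has_deriv_eps_elt_lie])
    ultimately show ?case by simp
  next
    case (mult \<alpha> X)
    then have IHc: "cont (\<lambda>y. current v y X)" and IHd: "\<exists>D. has_deriv (\<lambda>y. current (lie a b) y X) D"
      for v a b by auto
    obtain L where L: "gm_germ \<alpha> z L" using mult by (auto simp: gm_regular_iff)
    have X: "X \<in> Ugm {z}" using mult by (simp add: Ugm_singleton)
    have dL: "\<forall>(f, w) \<in> set (deriv_list L). f analytic_on {0}"
      using gm_germ_analytic[OF L] by (auto simp: deriv_list_def intro: analytic_deriv)
    have "(\<lambda>t. form v (lin_comb (deriv_list L) t)) analytic_on {0}" for v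
      using functional_lin_comb[of "form v", OF form_add_right form_scaleC_right dL] ..
    then have g: "(\<lambda>t. - form v (lin_comb (deriv_list L) t)) analytic_on {0}" for v
      by (intro analytic_intros)
    show ?case
    proof (intro conjI allI)
      fix v
      have "cont (\<lambda>y. \<Sum>(f, w) \<leftarrow> L. f (coord y - coord z) *\<^sub>C current (lie v w) y X)"
        by (intro cont_sum_list cont_scaleC IHc) (rule gm_germ_analytic[OF L])
      then show "cont (\<lambda>y. current v y (uea_of \<alpha> * X))"
        by (intro cont_cong[OF current_mult_near[OF L X]] cont_add cont_mult_left
          cont_scaleC[OF g cont_const] IHc)
    next
      fix a b
      have "\<exists>D. has_deriv (\<lambda>y. \<Sum>(f, w) \<leftarrow> L. f (coord y - coord z) *\<^sub>C current (lie (lie a b) w) y X) D"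
      proof (rule has_deriv_sum_list)
        fix f w assume "(f, w) \<in> set L"
        then have f: "f analytic_on {0}" by (rule gm_germ_analytic[OF L])
        obtain D where "has_deriv (\<lambda>y. current (lie (lie a b) w) y X) D" using IHd by auto
        from has_deriv_scaleC[OF f IHc this]
        show "\<exists>D. has_deriv (\<lambda>y. f (coord y - coord z) *\<^sub>C current (lie (lie a b) w) y X) D" by (rule exI)
      qed
      then obtain D where D: "has_deriv
        (\<lambda>y. \<Sum>(f, w) \<leftarrow> L. f (coord y - coord z) *\<^sub>C current (lie (lie a b) w) y X) D" by auto
      obtain E where E: "has_deriv (\<lambda>y. current (lie a b) y X) E" using IHd by auto
      show "\<exists>D. has_deriv (\<lambda>y. current (lie a b) y (uea_of \<alpha> * X)) D"
        by (rule exI, rule has_deriv_cong[OF current_mult_near[OF L X]],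
          rule has_deriv_add[OF has_deriv_add[OF has_deriv_mult_left[OF E]
            has_deriv_scaleC[OF g cont_const has_deriv_const]] D])
    qed
  next
    case (add X Y)
    then have X: "X \<in> Ugm {z}" "Y \<in> Ugm {z}" by (simp_all add: Ugm_singleton)
    have 1: "\<forall>\<^sub>F y in at_point z. current v y (X + Y) = current v y X + current v y Y" for v
      using eventually_Ugm[OF z X(1)] eventually_Ugm[OF z X(2)] eventually_at_point_neq_base[of z]
      by eventually_elim (rule current_add; blast dest: Ugm_pairD)
    note cong = cont_cong[OF 1 current_add[OF z X]] has_deriv_cong[OF 1 current_add[OF z X]]
    show ?case
    proof (intro conjI allI)
      fix v show "cont (\<lambda>y. current v y (X + Y))"
        by (intro cong cont_add) (use add in auto)
    next
      fix a b
      obtain D E where "has_deriv (\<lambda>y. current (lie a b) y X) D" "has_deriv (\<lambda>y. current (lie a b) y Y) E"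
        using add by blast
      from cong(2)[OF has_deriv_add[OF this]] show "\<exists>D. has_deriv (\<lambda>y. current (lie a b) y (X + Y)) D"
        by (rule exI)
    qed
  next
    case (scaleC c X)
    then have X: "X \<in> Ugm {z}" by (simp add: Ugm_singleton)
    have 1: "\<forall>\<^sub>F y in at_point z. current v y (c *\<^sub>C X) = c *\<^sub>C current v y X" for v
      using eventually_Ugm[OF z X] eventually_at_point_neq_base[of z]
      by eventually_elim (rule current_scaleC; blast dest: Ugm_pairD)
    note cong = cont_cong[OF 1 current_scaleC[OF z X]] has_deriv_cong[OF 1 current_scaleC[OF z X]]
    have c: "(\<lambda>_. c) analytic_on {0}" by simp
    have IH: "cont (\<lambda>y. current v y X)" for v using scaleC by auto
    show ?case
    proof (intro conjI allI)
      fix v show "cont (\<lambda>y. current v y (c *\<^sub>C X))"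
        by (rule cong, rule cont_scaleC[OF c IH])
    next
      fix a b
      obtain D where "has_deriv (\<lambda>y. current (lie a b) y X) D" using scaleC by blast
      from cong(2)[OF has_deriv_scaleC[OF c IH this]] show "\<exists>D. has_deriv (\<lambda>y. current (lie a b) y (c *\<^sub>C X)) D"
        by (rule exI)
    qed
  qed
  then show "cont (\<lambda>y. current v y X)" "\<exists>D. has_deriv (\<lambda>y. current (lie a b) y X) D" by auto
qed

text \<open>The derivative that defines \<open>iota_deriv\<close> exists, and differs from that of the current by a
  commutator.\<close>

lemma has_deriv_current_lie:
  assumes X: "X \<in> Ugm {z}"
  shows "has_deriv (\<lambda>y. current (lie a b) y X) (iota_deriv T (lie a b) z X
    + eps a z (eps b z X) - eps b z (eps a z X))"
proof -
  obtain D where D: "has_deriv (\<lambda>y. current (lie a b) y X) D"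
    using current_cont_has_deriv(2)[OF X] by auto
  have "limitin T (\<lambda>y. ((1 / (coord y - coord z)) *\<^sub>C (uea_of (eps_elt (lie a b) y) - uea_of (eps_elt (lie a b) z))) * X)
      ((uea_of (eps_elt a z) * uea_of (eps_elt b z) - uea_of (eps_elt b z) * uea_of (eps_elt a z)) * X) (at_point z)"
    using has_deriv_eps_elt_lie[of a b] unfolding has_deriv_def by (rule lim_mult_right)
  then have eps: "has_deriv (\<lambda>y. eps (lie a b) y X) (eps a z (eps b z X) - eps b z (eps a z X))"
    by (simp add: has_deriv_def eps_def uea_scaleC_mult left_diff_distrib mult.assoc)
  have iota: "has_deriv (\<lambda>y. iota (lie a b) y X) (D - (eps a z (eps b z X) - eps b z (eps a z X)))"
    using has_deriv_diff[OF D eps] by (simp add: current_def)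
  then have "iota_deriv T (lie a b) z X = D - (eps a z (eps b z X) - eps b z (eps a z X))"
    unfolding iota_deriv_def has_deriv_def by (intro the_equality) (auto dest: lim_unique)
  then have "D = iota_deriv T (lie a b) z X + eps a z (eps b z X) - eps b z (eps a z X)"
    by (simp add: algebra_simps)
  with D show ?thesis by simp
qed

text \<open>Moving the second current past \<open>\<epsilon>\<^sub>1\<close> by its recursion produces the double pole and the
  simple pole that are subtracted. The residue at the simple pole is a current at the moving point,
  so that a difference quotient remains.\<close>

lemma current_product_limit:
  assumes X: "X \<in> Ugm {z}"
  shows "limitin T (\<lambda>y. current v2 y (current v1 z X) - (form v1 v2 / (coord z - coord y)^2) *\<^sub>C X
        - (1 / (coord y - coord z)) *\<^sub>C current (lie v2 v1) z X)
      (iota v2 z (iota v1 z X) + eps v2 z (eps v1 z X) + eps v2 z (iota v1 z X) + eps v1 z (iota v2 z X)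
        + iota_deriv T (lie v2 v1) z X) (at_point z)"
proof -
  let ?Y = "iota v1 z X"
  have Y: "?Y \<in> Ugm {z}" using iotaD(1)[OF z X] .
  have cont: "limitin T (\<lambda>y. current v2 y Z) (current v2 z Z) (at_point z)" if "Z \<in> Ugm {z}" for Z
    using current_cont_has_deriv(1)[OF that] unfolding cont_def .
  have "limitin T (\<lambda>y. uea_of (eps_elt v1 z) * current v2 y X + current v2 y ?Y
        + (1 / (coord y - coord z)) *\<^sub>C (current (lie v2 v1) y X - current (lie v2 v1) z X))
      (uea_of (eps_elt v1 z) * current v2 z X + current v2 z ?Y +
        (iota_deriv T (lie v2 v1) z X + eps v2 z (eps v1 z X) - eps v1 z (eps v2 z X))) (at_point z)"
    using has_deriv_current_lie[OF X] by (intro lim_add lim_mult_left cont X Y) (simp add: has_deriv_def)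
  moreover have "\<forall>\<^sub>F y in at_point z. uea_of (eps_elt v1 z) * current v2 y X + current v2 y ?Y
        + (1 / (coord y - coord z)) *\<^sub>C (current (lie v2 v1) y X - current (lie v2 v1) z X)
      = current v2 y (current v1 z X) - (form v1 v2 / (coord z - coord y)^2) *\<^sub>C X
        - (1 / (coord y - coord z)) *\<^sub>C current (lie v2 v1) z X"
    using eventually_Ugm[OF z X] eventually_Ugm[OF z Y] eventually_at_point_neq_base[of z]
      eventually_at_point_coord_neq[OF z]
  proof eventually_elim
    case (elim y)
    then have ne: "y \<noteq> z" and Xy: "X \<in> Ugm {y}" and Yy: "?Y \<in> Ugm {y}" using Ugm_pairD by blast+
    note g = gm_eps_elt[OF elim(3) z ne, of v1]
    have "current v2 y (uea_of (eps_elt v1 z) * X) = uea_of (eps_elt v1 z) * current v2 y X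
        + (form v1 v2 / (coord z - coord y)^2) *\<^sub>C X + (1 / (coord y - coord z)) *\<^sub>C current (lie v2 v1) y X"
      using current_mult[OF elim(3) g(1) Xy] current_linear_left[OF elim(3) Xy, of "lie v2 v1" _ "1 / (coord y - coord z)"]
      by (simp add: g form_scaleC_right form_minus_right lie_scaleC_right form_sym[of v2]
        power2_commute[of "coord z"])
    moreover have "current v1 z X = uea_of (eps_elt v1 z) * X + ?Y"
      by (simp add: current_def eps_def)
    moreover have "uea_of (eps_elt v1 z) * X \<in> Ugm {y}"
      using uea_sub_mult[of "eps_elt v1 z"] g(1) Xy by (simp add: Ugm_singleton)
    ultimately show ?case
      by (simp add: current_add elim Yy complex_vector.scale_right_diff_distrib algebra_simps)
  qed
  ultimately have "limitin T (\<lambda>y. current v2 y (current v1 z X) - (form v1 v2 / (coord z - coord y)^2) *\<^sub>C X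
        - (1 / (coord y - coord z)) *\<^sub>C current (lie v2 v1) z X)
      (uea_of (eps_elt v1 z) * current v2 z X + current v2 z ?Y +
        (iota_deriv T (lie v2 v1) z X + eps v2 z (eps v1 z X) - eps v1 z (eps v2 z X))) (at_point z)"
    by (rule limitin_transform_eventually[rotated])
  moreover have "uea_of (eps_elt v1 z) * current v2 z X + current v2 z ?Y +
        (iota_deriv T (lie v2 v1) z X + eps v2 z (eps v1 z X) - eps v1 z (eps v2 z X))
      = iota v2 z (iota v1 z X) + eps v2 z (eps v1 z X) + eps v2 z (iota v1 z X) + eps v1 z (iota v2 z X)
        + iota_deriv T (lie v2 v1) z X"
    by (simp add: current_def eps_def algebra_simps)
  ultimately show ?thesis by simp
qed

end

theorem proposition11p3:
  fixes z1 z2 :: "'p::projective_line" and v1 v2 :: "'g::quadratic_lie_algebra"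
  assumes "z1 \<noteq> z2" and "z1 \<noteq> base_point" and "z2 \<noteq> base_point"
  shows "(\<forall>X \<in> Ugm {z1, z2} :: ('p, 'g) gminus uea set.
            current v1 z1 X \<in> Ugm {z2} \<and> current v2 z2 X \<in> Ugm {z1} \<and>
            current v2 z2 (current v1 z1 X) = current v1 z1 (current v2 z2 X)) \<and>
         (\<forall>X \<in> Ugm {z1} :: ('p, 'g) gminus uea set.
            (\<forall>\<^sub>F z in at_point z1. X \<in> Ugm {z1, z}) \<and>
            (\<forall>T. current_topology T \<longrightarrow>
              limitin T
                (\<lambda>z. current v2 z (current v1 z1 X)
                    - (form v1 v2 / (coord z1 - coord z)^2) *\<^sub>C X
                    - (1 / (coord z - coord z1)) *\<^sub>C current (lie v2 v1) z1 X)
                (iota v2 z1 (iota v1 z1 X) + eps v2 z1 (eps v1 z1 X)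
                  + eps v2 z1 (iota v1 z1 X) + eps v1 z1 (iota v2 z1 X)
                  + iota_deriv T (lie v2 v1) z1 X)
                (at_point z1)))"
proof (intro conjI ballI allI impI)
  fix X :: "('p, 'g) gminus uea" assume X: "X \<in> Ugm {z1, z2}"
  show "current v1 z1 X \<in> Ugm {z2}" using current_in_Ugm[OF assms X] .
  show "current v2 z2 X \<in> Ugm {z1}"
    using current_in_Ugm[OF assms(1)[symmetric] assms(3,2) Ugm_pairD(3)[OF X]] .
  show "current v2 z2 (current v1 z1 X) = current v1 z1 (current v2 z2 X)"
    using currents_commute[OF assms X] .
next
  fix X :: "('p, 'g) gminus uea" assume X: "X \<in> Ugm {z1}"
  show "\<forall>\<^sub>F z in at_point z1. X \<in> Ugm {z1, z}" using eventually_Ugm[OF assms(2) X] .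
  fix T :: "('p, 'g) gminus uea topology" assume "current_topology T"
  then interpret current_limits T z1 using assms(2) by unfold_locales
  show "limitin T
      (\<lambda>z. current v2 z (current v1 z1 X) - (form v1 v2 / (coord z1 - coord z)^2) *\<^sub>C X
        - (1 / (coord z - coord z1)) *\<^sub>C current (lie v2 v1) z1 X)
      (iota v2 z1 (iota v1 z1 X) + eps v2 z1 (eps v1 z1 X) + eps v2 z1 (iota v1 z1 X)
        + eps v1 z1 (iota v2 z1 X) + iota_deriv T (lie v2 v1) z1 X) (at_point z1)"
    using current_product_limit[OF X] .
qed

end
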